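(* Let $N$ be an ordered negative support family for $\mathbf v_0$. For any $q(\partial_{\mathbf t})\in(\widehat Q_N)^{\perp,\mathbb C[\partial_{\mathbf t}]}$, the series $$\bigl(q(\partial_{\mathbf t})\bullet\widehat F_N(\mathbf x,\mathbf t)\bigr)_{|\mathbf t=\mathbf 0}$$ is an $A$-hypergeometric series (with parameter $\boldsymbol\beta$) in direction $\mathbf w$. Moreover, the coefficients of $\mathbf x^{\mathbf v_0}$ obtained in this way (as polynomials in $\mathbf y=\log\mathbf x$, for $q$ ranging over $(\widehat Q_N)^{\perp,\mathbb C[\partial_{\mathbf t}]}$) are precisely the elements of $$\Xi\bigl((\widehat Q_N:\widehat m_N(\mathbf t))^{\perp,\mathbb C[\partial_{\mathbf t}]}\bigr),$$ and $$C_{\mathbf v_0,N}=\Xi\bigl((\widehat Q_N:\widehat m_N(\mathbf t))^{\perp,\mathbb C[\partial_{\mathbf t}]}\bigr).$$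
   Context: $\mathbb N$ is the set of nonnegative integers. Let $A=(\mathbf a_1,\dots,\mathbf a_n)=(a_{ij})$ be a $d\times n$ integer matrix of rank $d$ whose columns all lie in a single affine hyperplane of $\mathbb Q^d$ not passing through the origin. Put $L=\operatorname{Ker}_{\mathbb Z}(A)\subset\mathbb Z^n$. The toric ideal is $I_A=\langle\partial_{\mathbf x}^{\mathbf u}-\partial_{\mathbf x}^{\mathbf v}\mid A\mathbf u=A\mathbf v,\ \mathbf u,\mathbf v\in\mathbb N^n\rangle\subset\mathbb C[\partial_1,\dots,\partial_n]$. For $\boldsymbol\beta\in\mathbb C^d$, $H_A(\boldsymbol\beta)$ is the left ideal of the Weyl algebra $D=\mathbb C\langle x_1,\dots,x_n,\partial_1,\dots,\partial_n\rangle$ generated by $I_A$ and the Euler operators $\sum_j a_{ij}\theta_j-\beta_i$ ($1\le i\le d$), $\theta_j=x_j\partial_j$. Fix a generic weight $\mathbf w\in\mathbb R^n$: $\mathbf w\cdot\mathbf u\ne0$ for every nonzero $\mathbf u\in L$ (in particular $\operatorname{in}_{\mathbf w}(I_A)$, the ideal generated by the parts of maximal $\mathbf w$-weight of elements of $I_A$, is a monomial ideal). A fake exponent of $H_A(\boldsymbol\beta)$ with respect to $\mathbf w$ is a zero in $\mathbb C^n$ of the ideal $(D\operatorname{in}_{\mathbf w}(I_A)\cap\mathbb C[\boldsymbol\theta])+\langle A\boldsymbol\theta-\boldsymbol\beta\rangle\subset\mathbb C[\boldsymbol\theta]$, $\boldsymbol\theta=(\theta_1,\dots,\theta_n)$.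 Fix a fake exponent $\mathbf v_0$. A formal logarithmic series $\sum_{\mathbf u\in L}\mathbf x^{\mathbf v_0+\mathbf u}r_{\mathbf u}(\log\mathbf x)$ with $r_{\mathbf u}\in\mathbb C[\mathbf y]$, $\mathbf y=(y_1,\dots,y_n)$, $\log\mathbf x=(\log x_1,\dots,\log x_n)$, is an $A$-hypergeometric series with parameter $\boldsymbol\beta$ if it is annihilated by $H_A(\boldsymbol\beta)$. It is in direction $\mathbf w$ if the degrees of the $r_{\mathbf u}$ are bounded and the set of $\mathbf u$ with $r_{\mathbf u}\ne0$ is contained in $\{\mathbf w\cdot\mathbf u\ge0\}$ and in a finite union of translates of a rational polyhedral cone on which $\mathbf w$ is positive away from the origin. For $\mathbf v\in\mathbb C^n$ let $\operatorname{nsupp}(\mathbf v)=\{j\mid v_j\in\mathbb Z_{<0}\}$. For $\mathbf u\in L$ put $I_{\mathbf u}=\operatorname{nsupp}(\mathbf v_0+\mathbf u)$; put $\mathrm{NS}=\{I_{\mathbf u}\mid\mathbf u\in L\}$ and $\mathcal N_{\mathbf v_0}=\{I\in\mathrm{NS}\mid \mathbf w\cdot\mathbf u\ge0\text{ for every }\mathbf u\in L\text{ with }I_{\mathbf u}=I\}$. A negative support family for $\mathbf v_0$ is a set $N$ with $I_{\mathbf 0}\in N\subset\mathcal N_{\mathbf v_0}$; it is ordered if $I\in N$, $J\in\mathrm{NS}$, $J\subset I$ imply $J\in N$. Put $N^c=\mathrm{NS}\setminus N$ and $K_N=\bigcap_{I\in N}I$. $C_{\mathbf v_0,N}$ is the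 space of all polynomials $r_{\mathbf 0}(\mathbf y)$ occurring as the coefficient of $\mathbf x^{\mathbf v_0}$ in a formal logarithmic series $\sum_{\mathbf u\in L,\,I_{\mathbf u}\in N}\mathbf x^{\mathbf v_0+\mathbf u}r_{\mathbf u}(\log\mathbf x)$, $r_{\mathbf u}\in\mathbb C[\mathbf y]$, annihilated by $H_A(\boldsymbol\beta)$. Let $\mathbf t=(t_1,\dots,t_n)$ and $\mathbf t^S=\prod_{j\in S}t_j$ for $S\subset\{1,\dots,n\}$ (empty product $=1$). Write $\mathbf u=\mathbf u_+-\mathbf u_-$ with $\mathbf u_\pm\in\mathbb N^n$ of disjoint supports, and $[\boldsymbol\alpha]_{\boldsymbol\nu}=\prod_{j=1}^n\prod_{k=0}^{\nu_j-1}(\alpha_j-k)$. Put $\widehat m_N(\mathbf t)=\mathbf t^{I_{\mathbf 0}\setminus K_N}$, $\widehat a_{\mathbf u}(\mathbf t)=\dfrac{[\mathbf v_0+\mathbf t]_{\mathbf u_-}}{[\mathbf v_0+\mathbf t+\mathbf u]_{\mathbf u_+}}$ (in the quotient field of $\mathbb C[[\mathbf t]]$), and $$\widehat F_N(\mathbf x,\mathbf t)=\widehat m_N(\mathbf t)\sum_{\mathbf u\in L,\ I_{\mathbf u}\in N}\widehat a_{\mathbf u}(\mathbf t)\,\mathbf x^{\mathbf v_0+\mathbf t+\mathbf u},\qquad \mathbf x^{\mathbf v_0+\mathbf t+\mathbf u}=\mathbf x^{\mathbf v_0+\mathbf u}\exp\Bigl(\sum_j t_j\log x_j\Bigr);$$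 for $I_{\mathbf u}\in N$ the products $\widehat m_N\widehat a_{\mathbf u}$ lie in $\mathbb C[[\mathbf t]]$. In $\mathbb C[[\mathbf t]]$ define the ideals $\widehat M_N=\langle\mathbf t^{I\setminus K_N}\mid I\in N\rangle$, $\widehat P_N=\langle\mathbf t^{(I\cup J)\setminus K_N}\mid I\in N,J\in N^c\rangle$, $\langle A\mathbf t\rangle=\langle\sum_j a_{ij}t_j\mid1\le i\le d\rangle$, $\widehat Q_N=\langle A\mathbf t\rangle\widehat M_N+\widehat P_N$, and $\widehat Q_N:\widehat m_N=\{f\in\mathbb C[[\mathbf t]]\mid f\widehat m_N\in\widehat Q_N\}$. For $P\subset\mathbb C[[\mathbf t]]$, $P^{\perp,\mathbb C[\partial_{\mathbf t}]}=\{q\in\mathbb C[\partial_{\mathbf t}]\mid (q(\partial_{\mathbf t})\bullet p(\mathbf t))_{|\mathbf t=\mathbf 0}=0\ \forall p\in P\}$, where $\bullet$ is the usual differential action. $\Xi:\mathbb C[\partial_{\mathbf t}]\to\mathbb C[\mathbf y]$ is the $\mathbb C$-linear isomorphism with $\Xi(\partial_{\mathbf t}^{\boldsymbol\alpha})=\mathbf y^{\boldsymbol\alpha}$. *)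

theory Defs
  imports
    "HOL-Analysis.Analysis"
    "HOL-Library.Poly_Mapping"
    "HOL-Library.Function_Algebras"
    "HOL-Computational_Algebra.Fraction_Field"
begin

abbreviation lookup :: "('a \<Rightarrow>\<^sub>0 'b::zero) \<Rightarrow> 'a \<Rightarrow> 'b" where
  "lookup \<equiv> Poly_Mapping.lookup"

abbreviation keys :: "('a \<Rightarrow>\<^sub>0 'b::zero) \<Rightarrow> 'a set" where
  "keys \<equiv> Poly_Mapping.keys"


section \<open>Complex vector spaces\<close>

class complex_vector = ab_group_add +
  fixes scaleC :: "complex \<Rightarrow> 'a \<Rightarrow> 'a"  (infixr \<open>*\<^sub>C\<close> 75)
  assumes scaleC_add_right: "c *\<^sub>C (x + y) = c *\<^sub>C x + c *\<^sub>C y"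
    and scaleC_add_left: "(c + d) *\<^sub>C x = c *\<^sub>C x + d *\<^sub>C x"
    and scaleC_scaleC [simp]: "c *\<^sub>C (d *\<^sub>C x) = (c * d) *\<^sub>C x"
    and scaleC_one [simp]: "1 *\<^sub>C x = x"
begin

lemma scaleC_zero_left [simp]: "0 *\<^sub>C x = 0"
  using scaleC_add_left [of 0 0 x] by simp

lemma scaleC_zero_right [simp]: "c *\<^sub>C 0 = 0"
  using scaleC_add_right [of c 0 0] by simp

lemma scaleC_sum: "c *\<^sub>C (\<Sum>i\<in>I. f i) = (\<Sum>i\<in>I. c *\<^sub>C f i)"
  by (induction I rule: infinite_finite_induct) (simp_all add: scaleC_add_right)

end

instantiation complex :: complex_vector
begin
definition scaleC_complex :: "complex \<Rightarrow> complex \<Rightarrow> complex" where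
  "scaleC_complex = (*)"
instance by standard (simp_all add: scaleC_complex_def algebra_simps)
end

instantiation "fun" :: (type, complex_vector) complex_vector
begin
definition scaleC_fun :: "complex \<Rightarrow> ('a \<Rightarrow> 'b) \<Rightarrow> 'a \<Rightarrow> 'b" where
  "scaleC_fun c f = (\<lambda>x. c *\<^sub>C f x)"
instance
  by standard (simp_all add: scaleC_fun_def fun_eq_iff scaleC_add_right scaleC_add_left)
end

instantiation poly_mapping :: (type, complex_vector) complex_vector
begin
lift_definition scaleC_poly_mapping :: "complex \<Rightarrow> ('a \<Rightarrow>\<^sub>0 'b) \<Rightarrow> 'a \<Rightarrow>\<^sub>0 'b" is
  "\<lambda>c f x. c *\<^sub>C f x"
  by (erule rev_finite_subset) auto
instance
  by standard (transfer; simp add: fun_eq_iff scaleC_add_right scaleC_add_left)+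
end

lemma lookup_scaleC [simp]: "lookup (c *\<^sub>C p) k = c *\<^sub>C lookup p k"
  by transfer simp

definition clinear :: "('a::complex_vector \<Rightarrow> 'b::complex_vector) \<Rightarrow> bool" where
  "clinear f \<longleftrightarrow> (\<forall>x y. f (x + y) = f x + f y) \<and> (\<forall>c x. f (c *\<^sub>C x) = c *\<^sub>C f x)"

lemma clinearI:
  "\<lbrakk>\<And>x y. f (x + y) = f x + f y; \<And>c x. f (c *\<^sub>C x) = c *\<^sub>C f x\<rbrakk> \<Longrightarrow> clinear f"
  by (simp add: clinear_def)

lemma clinear_add: "clinear f \<Longrightarrow> f (x + y) = f x + f y"
  and clinear_scale: "clinear f \<Longrightarrow> f (c *\<^sub>C x) = c *\<^sub>C f x"
  by (simp_all add: clinear_def)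

lemma clinear_zero: "clinear f \<Longrightarrow> f 0 = 0"
  using clinear_scale [of f 0 0] by simp

lemma clinear_sum: "clinear f \<Longrightarrow> f (\<Sum>i\<in>I. g i) = (\<Sum>i\<in>I. f (g i))"
  by (induction I rule: infinite_finite_induct) (simp_all add: clinear_zero clinear_add)

lemma clinear_comp: "\<lbrakk>clinear f; clinear g\<rbrakk> \<Longrightarrow> clinear (\<lambda>x. f (g x))"
  by (simp add: clinear_def)


section \<open>Multi-indices, polynomials and commuting operators\<close>

text \<open>Keeps unit vectors of multi-indices in the form \<open>axis j 1\<close> under simplification; undone at
  the end of the theory.\<close>

declare One_nat_def [simp del]

text \<open>Polynomials in \<open>n\<close> commuting indeterminates; the name of the indeterminates
  (\<open>\<partial>\<close>, \<open>\<theta>\<close>, \<open>\<partial>\<^sub>t\<close> or \<open>y\<close>) depends on the use.\<close>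

type_synonym 'n cpoly = "(nat ^ 'n) \<Rightarrow>\<^sub>0 complex"

abbreviation unit_vec :: "'n::finite \<Rightarrow> 'a::zero_neq_one ^ 'n" where
  "unit_vec j \<equiv> axis j 1"

abbreviation Const :: "complex \<Rightarrow> 'n::finite cpoly" where
  "Const c \<equiv> Poly_Mapping.single 0 c"

abbreviation Var :: "'n \<Rightarrow> 'n::finite cpoly" where
  "Var j \<equiv> Poly_Mapping.single (unit_vec j) 1"

lemma unit_vec_nth: "unit_vec j $ i = (if i = j then 1 else 0)"
  by (simp add: axis_def)

definition poly_eval :: "'n::finite cpoly \<Rightarrow> complex ^ 'n \<Rightarrow> complex" where
  "poly_eval p v = (\<Sum>\<alpha>\<in>keys p. lookup p \<alpha> * (\<Prod>j\<in>UNIV. v $ j ^ (\<alpha> $ j)))"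

lift_definition poly_deriv :: "'n::finite \<Rightarrow> 'n cpoly \<Rightarrow> 'n cpoly" is
  "\<lambda>j p \<alpha>. of_nat (\<alpha> $ j + 1) * p (\<alpha> + unit_vec j)"
proof -
  fix j :: 'n and p :: "nat ^ 'n \<Rightarrow> complex"
  assume fin: "finite {\<alpha>. p \<alpha> \<noteq> 0}"
  have "finite ((\<lambda>\<alpha>. \<alpha> + unit_vec j) -` {\<alpha>. p \<alpha> \<noteq> 0})"
    by (rule finite_vimageI [OF fin]) (simp add: inj_on_def)
  then show "finite {\<alpha>. of_nat (\<alpha> $ j + 1) * p (\<alpha> + unit_vec j) \<noteq> 0}"
    by (rule rev_finite_subset) auto
qed

text \<open>\<open>multi_pow T \<alpha> m\<close> is \<open>T\<^sub>1\<^bsup>\<alpha>\<^sub>1\<^esup> \<dots> T\<^sub>n\<^bsup>\<alpha>\<^sub>n\<^esup> m\<close>. It is only used for pairwise commuting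
  operators, where the order of the factors chosen by \<^const>\<open>Finite_Set.fold\<close> is irrelevant.\<close>

definition multi_pow :: "('n::finite \<Rightarrow> 'v \<Rightarrow> 'v) \<Rightarrow> nat ^ 'n \<Rightarrow> 'v \<Rightarrow> 'v" where
  "multi_pow T \<alpha> m = Finite_Set.fold (\<lambda>j. T j ^^ (\<alpha> $ j)) m UNIV"

definition poly_apply ::
    "('n::finite \<Rightarrow> 'v \<Rightarrow> 'v) \<Rightarrow> 'n cpoly \<Rightarrow> 'v \<Rightarrow> 'v::complex_vector" where
  "poly_apply T q m = (\<Sum>\<alpha>\<in>keys q. lookup q \<alpha> *\<^sub>C multi_pow T \<alpha> m)"

lemma funpow_commute: "(\<And>m. f (g m) = g (f m)) \<Longrightarrow> (f ^^ k) (g m) = g ((f ^^ k) m)"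
  by (induction k) simp_all

context
  fixes T :: "'n::finite \<Rightarrow> 'v \<Rightarrow> 'v"
  assumes commute: "\<And>i j m. T i (T j m) = T j (T i m)"
begin

lemma funpow_commute_family: "(T i ^^ k) ((T j ^^ l) m) = (T j ^^ l) ((T i ^^ k) m)"
  by (rule funpow_commute, rule funpow_commute [symmetric], rule commute)

lemma comp_fun_commute_family: "comp_fun_commute (\<lambda>j. T j ^^ (\<alpha> $ j))"
  by standard (simp add: fun_eq_iff funpow_commute_family)

lemma multi_pow_zero [simp]: "multi_pow T 0 m = m"
proof -
  have "Finite_Set.fold (\<lambda>(j::'n) m. m) m A = m" for A
  proof (induction A rule: infinite_finite_induct)
    case (insert x F)
    interpret comp_fun_commute "\<lambda>(j::'n) (m::'v). m"
      by standard simp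
    from insert show ?case by simp
  qed simp_all
  then show ?thesis by (simp add: multi_pow_def id_def)
qed

lemma multi_pow_Suc: "multi_pow T (\<alpha> + unit_vec j) m = T j (multi_pow T \<alpha> m)"
proof -
  interpret a: comp_fun_commute "\<lambda>j. T j ^^ (\<alpha> $ j)" by (rule comp_fun_commute_family)
  interpret b: comp_fun_commute "\<lambda>i. T i ^^ ((\<alpha> + unit_vec j) $ i)"
    by (rule comp_fun_commute_family)
  have rest: "Finite_Set.fold (\<lambda>i. T i ^^ ((\<alpha> + unit_vec j) $ i)) m (UNIV - {j})
      = Finite_Set.fold (\<lambda>i. T i ^^ (\<alpha> $ i)) m (UNIV - {j})"
    by (rule Finite_Set.fold_cong [where S = UNIV])
       (auto simp: unit_vec_nth comp_fun_commute_on_def fun_eq_iff funpow_commute_family)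
  have "multi_pow T (\<alpha> + unit_vec j) m
      = (T j ^^ ((\<alpha> + unit_vec j) $ j)) (Finite_Set.fold (\<lambda>i. T i ^^ (\<alpha> $ i)) m (UNIV - {j}))"
    unfolding multi_pow_def using b.fold_rec [of UNIV j m] rest by simp
  also have "\<dots> = T j ((T j ^^ (\<alpha> $ j)) (Finite_Set.fold (\<lambda>i. T i ^^ (\<alpha> $ i)) m (UNIV - {j})))"
    by (simp add: unit_vec_nth flip: Suc_eq_plus1)
  also have "(T j ^^ (\<alpha> $ j)) (Finite_Set.fold (\<lambda>i. T i ^^ (\<alpha> $ i)) m (UNIV - {j})) = multi_pow T \<alpha> m"
    unfolding multi_pow_def using a.fold_rec [of UNIV j m] by simp
  finally show ?thesis .
qed

end

lemma multi_index_induct [case_names zero Suc]: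
  fixes \<alpha> :: "nat ^ 'n"
  assumes zero: "P 0" and Suc: "\<And>\<alpha> j. P \<alpha> \<Longrightarrow> P (\<alpha> + unit_vec j)"
  shows "P \<alpha>"
proof (induction "\<Sum>j\<in>UNIV. \<alpha> $ j" arbitrary: \<alpha>)
  case 0
  then have "\<alpha> = 0" by (simp add: vec_eq_iff)
  with zero show ?case by simp
next
  case (Suc k)
  then obtain j where j: "\<alpha> $ j \<noteq> 0"
    by (metis nat.distinct(1) sum.neutral)
  define \<beta> where "\<beta> = \<alpha> - unit_vec j"
  have \<alpha>: "\<alpha> = \<beta> + unit_vec j"
    using j by (auto simp: \<beta>_def vec_eq_iff unit_vec_nth)
  have "(\<Sum>i\<in>UNIV. \<alpha> $ i) = (\<Sum>i\<in>UNIV. \<beta> $ i) + (\<Sum>i\<in>UNIV. unit_vec j $ i)"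
    by (simp add: \<alpha> sum.distrib)
  also have "(\<Sum>i\<in>UNIV. unit_vec j $ i) = (1::nat)"
    by (simp add: unit_vec_nth)
  finally have "k = (\<Sum>i\<in>UNIV. \<beta> $ i)" using Suc.hyps(2) by simp
  from Suc.hyps(1) [OF this] show ?case unfolding \<alpha> by (rule assms(2))
qed


section \<open>The Weyl algebra\<close>

text \<open>An element is stored as its finite family of coefficients with respect to the basis of
  normally ordered monomials \<open>x\<^sup>a \<partial>\<^sup>b\<close>.\<close>

typedef (overloaded) 'n weyl = "UNIV :: ((nat ^ 'n) \<times> (nat ^ 'n::finite) \<Rightarrow>\<^sub>0 complex) set"
  morphisms weyl_coeffs Weyl
  by simp

setup_lifting type_definition_weyl

instantiation weyl :: (finite) complex_vector
begin
lift_definition zero_weyl :: "'a weyl" is 0 .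
lift_definition plus_weyl :: "'a weyl \<Rightarrow> 'a weyl \<Rightarrow> 'a weyl" is "(+)" .
lift_definition minus_weyl :: "'a weyl \<Rightarrow> 'a weyl \<Rightarrow> 'a weyl" is "(-)" .
lift_definition uminus_weyl :: "'a weyl \<Rightarrow> 'a weyl" is uminus .
lift_definition scaleC_weyl :: "complex \<Rightarrow> 'a weyl \<Rightarrow> 'a weyl" is scaleC .
instance
  by standard (transfer; simp add: scaleC_add_right scaleC_add_left algebra_simps)+
end

lift_definition weyl_monom :: "nat ^ 'n \<Rightarrow> nat ^ 'n \<Rightarrow> 'n::finite weyl" is
  "\<lambda>a b. Poly_Mapping.single (a, b) 1" .

definition weyl_extend ::
    "(nat ^ 'n \<Rightarrow> nat ^ 'n \<Rightarrow> 'v) \<Rightarrow> 'n::finite weyl \<Rightarrow> 'v::complex_vector" where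
  "weyl_extend f P = (\<Sum>(a, b)\<in>keys (weyl_coeffs P). lookup (weyl_coeffs P) (a, b) *\<^sub>C f a b)"

lemma weyl_extend_eq:
  assumes "finite S" "keys (weyl_coeffs P) \<subseteq> S"
  shows "weyl_extend f P = (\<Sum>(a, b)\<in>S. lookup (weyl_coeffs P) (a, b) *\<^sub>C f a b)"
  unfolding weyl_extend_def
  by (rule sum.mono_neutral_left) (use assms in \<open>auto simp: in_keys_iff\<close>)

lemma clinear_weyl_extend: "clinear (weyl_extend f)"
proof (rule clinearI)
  fix P Q :: "'a weyl"
  let ?S = "keys (weyl_coeffs P) \<union> keys (weyl_coeffs Q)"
  have "keys (weyl_coeffs (P + Q)) \<subseteq> ?S"
    by (simp add: plus_weyl.rep_eq keys_add)
  then show "weyl_extend f (P + Q) = weyl_extend f P + weyl_extend f Q"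
    by (simp add: weyl_extend_eq [of ?S] plus_weyl.rep_eq lookup_add scaleC_add_left
        sum.distrib split_beta)
next
  fix c and P :: "'a weyl"
  have "keys (weyl_coeffs (c *\<^sub>C P)) \<subseteq> keys (weyl_coeffs P)"
    by (auto simp: scaleC_weyl.rep_eq in_keys_iff)
  then show "weyl_extend f (c *\<^sub>C P) = c *\<^sub>C weyl_extend f P"
    by (simp add: weyl_extend_eq [of "keys (weyl_coeffs P)"] scaleC_weyl.rep_eq
        scaleC_sum split_beta scaleC_complex_def)
qed

lemma weyl_extend_monom [simp]: "weyl_extend f (weyl_monom a b) = f a b"
  by (simp add: weyl_extend_def weyl_monom.rep_eq)

lemma weyl_coeffs_sum: "weyl_coeffs (\<Sum>x\<in>S. f x) = (\<Sum>x\<in>S. weyl_coeffs (f x))"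
  by (induction S rule: infinite_finite_induct) (simp_all add: zero_weyl.rep_eq plus_weyl.rep_eq)

lemma weyl_extend_weyl_monom [simp]: "weyl_extend weyl_monom P = P"
proof -
  have "lookup (weyl_coeffs (weyl_extend weyl_monom P)) k = lookup (weyl_coeffs P) k" for k
    by (simp add: weyl_extend_def split_beta weyl_coeffs_sum lookup_sum scaleC_weyl.rep_eq weyl_monom.rep_eq
        lookup_single scaleC_complex_def when_def in_keys_iff if_distrib [where f = "\<lambda>x. _ * x"]
        cong: if_cong)
  then show ?thesis
    by (metis poly_mapping_eqI weyl_coeffs_inject)
qed

lemma weyl_eqI:
  assumes "clinear f" "clinear g" "\<And>a b. f (weyl_monom a b) = g (weyl_monom a b)"
  shows "f P = g P"
proof -
  have "f (weyl_extend weyl_monom P) = g (weyl_extend weyl_monom P)"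
    unfolding weyl_extend_def
    by (simp add: clinear_sum [OF assms(1)] clinear_sum [OF assms(2)] split_beta
        clinear_scale [OF assms(1)] clinear_scale [OF assms(2)] assms(3))
  then show ?thesis by simp
qed

text \<open>The operator \<open>\<Sum> c\<^bsub>a,b\<^esub> X\<^sup>a D\<^sup>b\<close> for operators \<open>X\<^sub>j\<close>, \<open>D\<^sub>j\<close> satisfying the relations of
  the Weyl algebra.\<close>

definition weyl_apply ::
    "('n \<Rightarrow> 'v \<Rightarrow> 'v) \<Rightarrow> ('n \<Rightarrow> 'v \<Rightarrow> 'v) \<Rightarrow> 'n::finite weyl \<Rightarrow> 'v \<Rightarrow> 'v::complex_vector" where
  "weyl_apply X D P m = weyl_extend (\<lambda>a b. multi_pow X a (multi_pow D b m)) P"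

locale weyl_rep =
  fixes X D :: "'n::finite \<Rightarrow> 'v::complex_vector \<Rightarrow> 'v"
  assumes linear_X: "clinear (X j)" and linear_D: "clinear (D j)"
    and commute_X: "X i (X j m) = X j (X i m)"
    and commute_D: "D i (D j m) = D j (D i m)"
    and D_X: "D j (X i m) = X i (D j m) + (if i = j then m else 0)"

text \<open>Left multiplication by \<open>x\<^sub>j\<close> and by \<open>\<partial>\<^sub>j\<close>, the latter from
  \<open>\<partial>\<^sub>j x\<^sup>a \<partial>\<^sup>b = x\<^sup>a \<partial>\<^sub>j \<partial>\<^sup>b + a\<^sub>j x\<^bsup>a - e\<^sub>j\<^esup> \<partial>\<^sup>b\<close>.\<close>

definition weyl_left_x :: "'n \<Rightarrow> 'n weyl \<Rightarrow> 'n::finite weyl" where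
  "weyl_left_x j = weyl_extend (\<lambda>a b. weyl_monom (a + unit_vec j) b)"

definition weyl_left_d :: "'n \<Rightarrow> 'n weyl \<Rightarrow> 'n::finite weyl" where
  "weyl_left_d j = weyl_extend (\<lambda>a b.
     weyl_monom a (b + unit_vec j) + of_nat (a $ j) *\<^sub>C weyl_monom (a - unit_vec j) b)"

text \<open>The product is the left regular representation: a normally ordered \<open>x\<^sup>a \<partial>\<^sup>b\<close> acts on \<open>Q\<close> by
  iterated left multiplication.\<close>

instantiation weyl :: (finite) "{one, times}"
begin
definition one_weyl :: "'a weyl" where
  "one_weyl = weyl_monom 0 0"
definition times_weyl :: "'a weyl \<Rightarrow> 'a weyl \<Rightarrow> 'a weyl" where
  "P * Q = weyl_apply weyl_left_x weyl_left_d P Q"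
instance ..
end

context weyl_rep
begin

lemmas X_pow_zero = multi_pow_zero [where T = X, OF commute_X]
lemmas X_pow_Suc = multi_pow_Suc [where T = X, OF commute_X]
lemmas D_pow_zero = multi_pow_zero [where T = D, OF commute_D]
lemmas D_pow_Suc = multi_pow_Suc [where T = D, OF commute_D]

lemma clinear_multi_pow:
  assumes "\<And>j. clinear (T j)" and "\<And>i j m. T i (T j m) = T j (T i m)"
  shows "clinear (multi_pow T a)"
proof (induction a rule: multi_index_induct)
  case zero
  show ?case by (rule clinearI) (simp_all add: multi_pow_zero [where T = T, OF assms(2)])
next
  case (Suc a j)
  then show ?case
    using clinear_comp [OF assms(1) Suc, of j]
    by (simp add: multi_pow_Suc [where T = T, OF assms(2)] clinear_def)
qed

lemma clinear_apply_left: "clinear (\<lambda>P. weyl_apply X D P m)"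
  unfolding weyl_apply_def by (rule clinear_weyl_extend)

lemma clinear_apply_right: "clinear (weyl_apply X D P)"
proof -
  have "clinear (multi_pow X a)" "clinear (multi_pow D a)" for a
    using clinear_multi_pow [where T = X, OF linear_X commute_X]
      clinear_multi_pow [where T = D, OF linear_D commute_D] by blast+
  then show ?thesis
    by (intro clinearI)
       (simp_all add: weyl_apply_def weyl_extend_def clinear_add clinear_scale scaleC_add_right
         sum.distrib split_beta scaleC_sum mult.commute)
qed

lemma apply_monom: "weyl_apply X D (weyl_monom a b) m = multi_pow X a (multi_pow D b m)"
  by (simp add: weyl_apply_def)

lemma D_multi_pow_X:
  "D j (multi_pow X a m) = multi_pow X a (D j m) + of_nat (a $ j) *\<^sub>C multi_pow X (a - unit_vec j) m"
proof (induction a rule: multi_index_induct)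
  case zero
  show ?case by (simp add: X_pow_zero)
next
  case (Suc a i)
  note [simp] = X_pow_Suc clinear_add [OF linear_X] clinear_scale [OF linear_X]
  show ?case
  proof (cases "i = j")
    case True
    have *: "a $ j \<noteq> 0 \<Longrightarrow> X j (multi_pow X (a - unit_vec j) m) = multi_pow X a m"
      by (subst X_pow_Suc [symmetric])
         (rule arg_cong [where f = "\<lambda>a. multi_pow X a m"], auto simp: vec_eq_iff unit_vec_nth)
    have "of_nat (a $ j) *\<^sub>C X j (multi_pow X (a - unit_vec j) m) = of_nat (a $ j) *\<^sub>C multi_pow X a m"
      by (cases "a $ j = 0") (simp_all add: *)
    then show ?thesis
      using True Suc by (simp add: D_X scaleC_add_left)
  next
    case False
    have "of_nat (a $ j) *\<^sub>C X i (multi_pow X (a - unit_vec j) m)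
        = of_nat (a $ j) *\<^sub>C multi_pow X (a + unit_vec i - unit_vec j) m"
    proof (cases "a $ j = 0")
      case ne: False
      have "a + unit_vec i - unit_vec j = a - unit_vec j + unit_vec i"
        using ne False by (auto simp: vec_eq_iff unit_vec_nth)
      then show ?thesis by simp
    qed simp
    then show ?thesis
      using False Suc by (simp add: D_X unit_vec_nth)
  qed
qed

lemma apply_left_x: "weyl_apply X D (weyl_left_x j Q) m = X j (weyl_apply X D Q m)"
  by (rule weyl_eqI [of "\<lambda>Q. weyl_apply X D (weyl_left_x j Q) m"])
     (simp_all add: weyl_left_x_def apply_monom X_pow_Suc clinear_comp [OF linear_X clinear_apply_left]
       clinear_comp [OF clinear_apply_left clinear_weyl_extend])

lemma apply_left_d: "weyl_apply X D (weyl_left_d j Q) m = D j (weyl_apply X D Q m)"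
  by (rule weyl_eqI [of "\<lambda>Q. weyl_apply X D (weyl_left_d j Q) m"])
     (simp_all add: weyl_left_d_def clinear_comp [OF linear_D clinear_apply_left]
       clinear_comp [OF clinear_apply_left clinear_weyl_extend] apply_monom D_pow_Suc D_multi_pow_X clinear_add [OF clinear_apply_left]
       clinear_scale [OF clinear_apply_left])

end

lemma clinear_left_x: "clinear (weyl_left_x j)" and clinear_left_d: "clinear (weyl_left_d j)"
  by (simp_all add: weyl_left_x_def weyl_left_d_def clinear_weyl_extend)

lemma left_x_monom: "weyl_left_x j (weyl_monom a b) = weyl_monom (a + unit_vec j) b"
  by (simp add: weyl_left_x_def)

lemma left_d_monom: "weyl_left_d j (weyl_monom a b)
    = weyl_monom a (b + unit_vec j) + of_nat (a $ j) *\<^sub>C weyl_monom (a - unit_vec j) b"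
  by (simp add: weyl_left_d_def)

lemmas left_simps = left_x_monom left_d_monom clinear_add [OF clinear_left_x]
  clinear_add [OF clinear_left_d] clinear_scale [OF clinear_left_x] clinear_scale [OF clinear_left_d]

interpretation weyl_left: weyl_rep weyl_left_x weyl_left_d
proof
  fix i j :: 'a and m :: "'a weyl"
  show "clinear (weyl_left_x j :: 'a weyl \<Rightarrow> _)" "clinear (weyl_left_d j :: 'a weyl \<Rightarrow> _)"
    by (rule clinear_left_x clinear_left_d)+
  show "weyl_left_x i (weyl_left_x j m) = weyl_left_x j (weyl_left_x i m)"
    by (rule weyl_eqI [of "\<lambda>m. weyl_left_x i (weyl_left_x j m)"])
       (simp_all add: clinear_comp clinear_left_x left_simps ac_simps)
  show "weyl_left_d i (weyl_left_d j m) = weyl_left_d j (weyl_left_d i m)"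
  proof (rule weyl_eqI [of "\<lambda>m. weyl_left_d i (weyl_left_d j m)"])
    fix a b :: "nat ^ 'a"
    have "a - unit_vec i - unit_vec j = a - unit_vec j - unit_vec i"
      by (simp add: vec_eq_iff add.commute)
    then show "weyl_left_d i (weyl_left_d j (weyl_monom a b)) = weyl_left_d j (weyl_left_d i (weyl_monom a b))"
      by (cases "i = j") (simp_all add: left_simps ac_simps scaleC_add_right unit_vec_nth)
  qed (simp_all add: clinear_comp clinear_left_d)
  have lin: "clinear (\<lambda>m. weyl_left_x i (weyl_left_d j m) + (if i = j then m else 0))"
    by (rule clinearI) (simp_all add: left_simps scaleC_add_right)
  show "weyl_left_d j (weyl_left_x i m) = weyl_left_x i (weyl_left_d j m) + (if i = j then m else 0)"
  proof (rule weyl_eqI [OF _ lin, of "\<lambda>m. weyl_left_d j (weyl_left_x i m)"])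
    fix a b :: "nat ^ 'a"
    have "of_nat (a $ j) *\<^sub>C weyl_monom (a + unit_vec i - unit_vec j) b
        = of_nat (a $ j) *\<^sub>C weyl_monom (a - unit_vec j + unit_vec i) b"
    proof (cases "a $ j = 0")
      case False
      then have "a + unit_vec i - unit_vec j = a - unit_vec j + unit_vec i"
        by (auto simp: vec_eq_iff unit_vec_nth)
      then show ?thesis by simp
    qed simp
    then show "weyl_left_d j (weyl_left_x i (weyl_monom a b))
        = weyl_left_x i (weyl_left_d j (weyl_monom a b)) + (if i = j then weyl_monom a b else 0)"
      by (auto simp: left_simps unit_vec_nth scaleC_add_left ac_simps)
  qed (simp add: clinear_comp clinear_left_x clinear_left_d)
qed

lemma (in weyl_rep) apply_times: "weyl_apply X D (P * Q) m = weyl_apply X D P (weyl_apply X D Q m)"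
proof (rule weyl_eqI [of "\<lambda>P. weyl_apply X D (P * Q) m"])
  show "clinear (\<lambda>P. weyl_apply X D (P * Q) m)"
    unfolding times_weyl_def
    by (rule clinear_comp [OF clinear_apply_left weyl_left.clinear_apply_left])
  show "clinear (\<lambda>P. weyl_apply X D P (weyl_apply X D Q m))"
    by (rule clinear_apply_left)
  fix a b
  have d: "weyl_apply X D (multi_pow weyl_left_d b R) m = multi_pow D b (weyl_apply X D R m)" for R
    by (induction b rule: multi_index_induct)
       (simp_all add: D_pow_zero weyl_left.D_pow_zero
         D_pow_Suc weyl_left.D_pow_Suc apply_left_d)
  have x: "weyl_apply X D (multi_pow weyl_left_x a R) m = multi_pow X a (weyl_apply X D R m)" for R
    by (induction a rule: multi_index_induct)
       (simp_all add: X_pow_zero weyl_left.X_pow_zero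
         X_pow_Suc weyl_left.X_pow_Suc apply_left_x)
  show "weyl_apply X D (weyl_monom a b * Q) m
      = weyl_apply X D (weyl_monom a b) (weyl_apply X D Q m)"
    by (simp add: times_weyl_def weyl_left.apply_monom apply_monom x d)
qed

lemma (in weyl_rep) apply_one: "weyl_apply X D 1 m = m"
  by (simp add: one_weyl_def apply_monom X_pow_zero D_pow_zero)

instance weyl :: (finite) ring_1
proof
  fix P Q R :: "'a weyl"
  show "P * Q * R = P * (Q * R)"
    using weyl_left.apply_times [of P Q R] by (simp only: times_weyl_def)
  show "1 * P = P"
    using weyl_left.apply_one [of P] by (simp only: times_weyl_def)
  show "(P + Q) * R = P * R + Q * R"
    unfolding times_weyl_def by (rule clinear_add [OF weyl_left.clinear_apply_left])
  show "P * (Q + R) = P * Q + P * R"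
    unfolding times_weyl_def by (rule clinear_add [OF weyl_left.clinear_apply_right])
  show "P * 1 = P"
  proof (rule weyl_eqI [of "\<lambda>P. P * 1"])
    show "clinear (\<lambda>P::'a weyl. P * 1)"
      unfolding times_weyl_def by (rule weyl_left.clinear_apply_left)
    show "clinear (\<lambda>P::'a weyl. P)" by (rule clinearI) simp_all
    fix a b :: "nat ^ 'a"
    have d: "multi_pow weyl_left_d b (weyl_monom 0 0) = weyl_monom 0 b"
      by (induction b rule: multi_index_induct)
         (simp_all add: weyl_left.D_pow_zero
           weyl_left.D_pow_Suc left_simps)
    have "multi_pow weyl_left_x a (weyl_monom 0 b) = weyl_monom a b"
      by (induction a rule: multi_index_induct)
         (simp_all add: weyl_left.X_pow_zero
           weyl_left.X_pow_Suc left_simps)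
    then show "weyl_monom a b * 1 = weyl_monom a b"
      by (simp add: times_weyl_def one_weyl_def weyl_left.apply_monom d)
  qed
  have "weyl_coeffs (1::'a weyl) \<noteq> weyl_coeffs 0"
    by (simp add: one_weyl_def weyl_monom.rep_eq zero_weyl.rep_eq)
       (metis lookup_single_eq lookup_zero zero_neq_one)
  then show "(0::'a weyl) \<noteq> 1" by auto
qed

definition weyl_x :: "'n \<Rightarrow> 'n::finite weyl" where
  "weyl_x j = weyl_monom (unit_vec j) 0"

definition weyl_d :: "'n \<Rightarrow> 'n::finite weyl" where
  "weyl_d j = weyl_monom 0 (unit_vec j)"

definition weyl_theta :: "'n \<Rightarrow> 'n::finite weyl" where
  "weyl_theta j = weyl_x j * weyl_d j"

lemma weyl_x_times: "weyl_x j * P = weyl_left_x j P"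
  and weyl_d_times: "weyl_d j * P = weyl_left_d j P"
  using weyl_left.X_pow_Suc [of 0 j P]
    weyl_left.D_pow_Suc [of 0 j P]
  by (simp_all add: weyl_x_def weyl_d_def times_weyl_def weyl_left.apply_monom
      weyl_left.X_pow_zero weyl_left.D_pow_zero)

lemma weyl_relations:
  "weyl_x i * weyl_x j = weyl_x j * weyl_x i"
  "weyl_d i * weyl_d j = weyl_d j * weyl_d i"
  "weyl_d i * weyl_x j - weyl_x j * weyl_d i = (if i = j then 1 else 0)"
  by (auto simp: weyl_x_times weyl_d_times)
     (auto simp: weyl_x_def weyl_d_def one_weyl_def left_simps unit_vec_nth ac_simps)

text \<open>The images of a polynomial under the inclusions of \<open>\<complex>[\<partial>]\<close> and of \<open>\<complex>[\<theta>]\<close> in the Weyl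
  algebra.\<close>

definition poly_d :: "'n cpoly \<Rightarrow> 'n::finite weyl" where
  "poly_d p = poly_apply (\<lambda>j. (*) (weyl_d j)) p 1"

definition poly_theta :: "'n cpoly \<Rightarrow> 'n::finite weyl" where
  "poly_theta p = poly_apply (\<lambda>j. (*) (weyl_theta j)) p 1"

inductive_set left_ideal :: "'a::ring_1 set \<Rightarrow> 'a set" for S where
  zero: "0 \<in> left_ideal S"
| step: "\<lbrakk>g \<in> S; h \<in> left_ideal S\<rbrakk> \<Longrightarrow> p * g + h \<in> left_ideal S"


section \<open>Ideals of commutative rings\<close>

abbreviation ideal_of :: "'a::comm_ring_1 set \<Rightarrow> 'a set" where
  "ideal_of \<equiv> module.span (*)"

definition ideal_sum :: "'a::comm_ring_1 set \<Rightarrow> 'a set \<Rightarrow> 'a set" where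
  "ideal_sum I J = {f + g | f g. f \<in> I \<and> g \<in> J}"

definition ideal_prod :: "'a::comm_ring_1 set \<Rightarrow> 'a set \<Rightarrow> 'a set" where
  "ideal_prod I J = ideal_of {f * g | f g. f \<in> I \<and> g \<in> J}"

definition ideal_colon :: "'a::comm_ring_1 set \<Rightarrow> 'a \<Rightarrow> 'a set" where
  "ideal_colon I m = {f. f * m \<in> I}"


section \<open>Formal power series in several variables\<close>

typedef (overloaded) ('n, 'a) mfps = "UNIV :: (nat ^ 'n::finite \<Rightarrow> 'a) set"
  morphisms mfps_nth Mfps
  by simp

setup_lifting type_definition_mfps

lemma mfps_eqI: "(\<And>\<gamma>. mfps_nth f \<gamma> = mfps_nth g \<gamma>) \<Longrightarrow> f = g"
  by (metis ext mfps_nth_inject)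

lemma mfps_nth_Mfps [simp]: "mfps_nth (Mfps f) = f"
  by (simp add: Mfps_inverse)

instantiation mfps :: (finite, ab_group_add) ab_group_add
begin
lift_definition zero_mfps :: "('a, 'b) mfps" is "\<lambda>_. 0" .
lift_definition plus_mfps :: "('a, 'b) mfps \<Rightarrow> ('a, 'b) mfps \<Rightarrow> ('a, 'b) mfps" is
  "\<lambda>f g \<gamma>. f \<gamma> + g \<gamma>" .
lift_definition minus_mfps :: "('a, 'b) mfps \<Rightarrow> ('a, 'b) mfps \<Rightarrow> ('a, 'b) mfps" is
  "\<lambda>f g \<gamma>. f \<gamma> - g \<gamma>" .
lift_definition uminus_mfps :: "('a, 'b) mfps \<Rightarrow> ('a, 'b) mfps" is "\<lambda>f \<gamma>. - f \<gamma>" .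
instance by standard (transfer; simp add: fun_eq_iff algebra_simps)+
end

instantiation mfps :: (finite, complex_vector) complex_vector
begin
lift_definition scaleC_mfps :: "complex \<Rightarrow> ('a, 'b) mfps \<Rightarrow> ('a, 'b) mfps" is
  "\<lambda>c f \<gamma>. c *\<^sub>C f \<gamma>" .
instance by standard (transfer; simp add: fun_eq_iff scaleC_add_right scaleC_add_left)+
end

lemma finite_nat_vec_atMost: "finite {\<alpha> :: nat ^ 'n. \<forall>j. \<alpha> $ j \<le> \<gamma> $ j}"
proof -
  have "finite (Pi\<^sub>E UNIV (\<lambda>j::'n. {..\<gamma> $ j}))"
    by (rule finite_PiE) simp_all
  then have "finite ((\<lambda>f. \<chi> j. f j) ` Pi\<^sub>E UNIV (\<lambda>j::'n. {..\<gamma> $ j}))"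
    by (rule finite_imageI)
  moreover have "{\<alpha> :: nat ^ 'n. \<forall>j. \<alpha> $ j \<le> \<gamma> $ j} \<subseteq> (\<lambda>f. \<chi> j. f j) ` Pi\<^sub>E UNIV (\<lambda>j::'n. {..\<gamma> $ j})"
  proof
    fix \<alpha> :: "nat ^ 'n" assume "\<alpha> \<in> {\<alpha>. \<forall>j. \<alpha> $ j \<le> \<gamma> $ j}"
    then show "\<alpha> \<in> (\<lambda>f. \<chi> j. f j) ` Pi\<^sub>E UNIV (\<lambda>j::'n. {..\<gamma> $ j})"
      by (intro image_eqI [where x = "\<lambda>j. \<alpha> $ j"]) (auto simp: PiE_def)
  qed
  ultimately show ?thesis by (rule finite_subset [rotated])
qed

lemma finite_splittings [simp]: "finite {(\<alpha>, \<beta>). \<alpha> + \<beta> = (\<gamma> :: nat ^ 'n)}"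
proof (rule finite_subset)
  show "{(\<alpha>, \<beta>). \<alpha> + \<beta> = \<gamma>} \<subseteq> {\<alpha>. \<forall>j. \<alpha> $ j \<le> \<gamma> $ j} \<times> {\<alpha>. \<forall>j. \<alpha> $ j \<le> \<gamma> $ j}"
    by (auto simp: vec_eq_iff) (metis le_add1, metis le_add2)
  show "finite ({\<alpha>. \<forall>j. \<alpha> $ j \<le> \<gamma> $ j} \<times> {\<alpha>. \<forall>j. \<alpha> $ j \<le> \<gamma> $ j})"
    by (intro finite_cartesian_product finite_nat_vec_atMost)
qed

instantiation mfps :: (finite, comm_ring_1) comm_ring_1
begin

lift_definition one_mfps :: "('a, 'b) mfps" is "\<lambda>\<gamma>. if \<gamma> = 0 then 1 else 0" .

lift_definition times_mfps :: "('a, 'b) mfps \<Rightarrow> ('a, 'b) mfps \<Rightarrow> ('a, 'b) mfps" is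
  "\<lambda>f g \<gamma>. \<Sum>(\<alpha>, \<beta>)\<in>{(\<alpha>, \<beta>). \<alpha> + \<beta> = \<gamma>}. f \<alpha> * g \<beta>" .

instance
proof
  fix f g h :: "('a, 'b) mfps"
  show "f * g * h = f * (g * h)"
  proof (rule mfps_eqI)
    fix \<gamma> :: "nat ^ 'a"
    let ?S = "\<lambda>\<gamma> :: nat ^ 'a. {(\<alpha>, \<beta>). \<alpha> + \<beta> = \<gamma>}"
    let ?f = "mfps_nth f" and ?g = "mfps_nth g" and ?h = "mfps_nth h"
    have "mfps_nth (f * g * h) \<gamma>
        = (\<Sum>p\<in>?S \<gamma>. \<Sum>q\<in>?S (fst p). ?f (fst q) * ?g (snd q) * ?h (snd p))"
      by (simp add: times_mfps.rep_eq split_beta sum_distrib_right)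
    also have "\<dots>
        = (\<Sum>(p, q)\<in>Sigma (?S \<gamma>) (\<lambda>p. ?S (fst p)). ?f (fst q) * ?g (snd q) * ?h (snd p))"
      by (rule sum.Sigma) simp_all
    also have "\<dots> = (\<Sum>(p, q)\<in>Sigma (?S \<gamma>) (\<lambda>p. ?S (snd p)). ?f (fst p) * (?g (fst q) * ?h (snd q)))"
      by (rule sum.reindex_bij_witness
          [where j = "\<lambda>(p, q). ((fst q, snd q + snd p), (snd q, snd p))"
             and i = "\<lambda>(p, q). ((fst p + fst q, snd q), (fst p, fst q))"])
         (auto simp: ac_simps)
    also have "\<dots> = (\<Sum>p\<in>?S \<gamma>. \<Sum>q\<in>?S (snd p). ?f (fst p) * (?g (fst q) * ?h (snd q)))"
      by (rule sum.Sigma [symmetric]) simp_all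
    also have "\<dots> = mfps_nth (f * (g * h)) \<gamma>"
      by (simp add: times_mfps.rep_eq split_beta sum_distrib_left)
    finally show "mfps_nth (f * g * h) \<gamma> = mfps_nth (f * (g * h)) \<gamma>" .
  qed
  show "f * g = g * f"
    by (rule mfps_eqI, unfold times_mfps.rep_eq,
        rule sum.reindex_bij_witness [where i = prod.swap and j = prod.swap])
       (auto simp: ac_simps)
  show "1 * f = f"
  proof (rule mfps_eqI)
    fix \<gamma> :: "nat ^ 'a"
    have "mfps_nth (1 * f) \<gamma> = (\<Sum>(\<alpha>, \<beta>)\<in>{(0, \<gamma>)}. mfps_nth 1 \<alpha> * mfps_nth f \<beta>)"
      unfolding times_mfps.rep_eq
      by (rule sum.mono_neutral_right) (auto simp: one_mfps.rep_eq split: if_splits)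
    then show "mfps_nth (1 * f) \<gamma> = mfps_nth f \<gamma>" by (simp add: one_mfps.rep_eq)
  qed
  show "(f + g) * h = f * h + g * h"
    by (rule mfps_eqI)
       (simp add: times_mfps.rep_eq plus_mfps.rep_eq algebra_simps sum.distrib split_beta)
  have "mfps_nth (0::('a, 'b) mfps) 0 \<noteq> mfps_nth 1 0"
    by (simp add: zero_mfps.rep_eq one_mfps.rep_eq)
  then show "(0::('a, 'b) mfps) \<noteq> 1" by metis
qed

end

text \<open>The ring of formal power series over a domain is a domain: compare lowest total degree parts
  by a weight that is injective on multi-indices of that degree.\<close>

lemma ex_inj_weight:
  "\<exists>\<phi> :: nat ^ 'n::finite \<Rightarrow> nat. (\<forall>\<alpha> \<beta>. \<phi> (\<alpha> + \<beta>) = \<phi> \<alpha> + \<phi> \<beta>) \<and>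
     inj_on \<phi> {\<alpha>. \<forall>j. \<alpha> $ j < B}"
proof -
  have "\<exists>c :: 'n \<Rightarrow> nat. inj_on (\<lambda>\<alpha> :: nat ^ 'n. \<Sum>j\<in>S. \<alpha> $ j * c j)
      {\<alpha>. (\<forall>j\<in>S. \<alpha> $ j < B) \<and> (\<forall>j. j \<notin> S \<longrightarrow> \<alpha> $ j = 0)}" if "finite S" for S
    using that
  proof (induction S)
    case empty
    show ?case by (auto simp: inj_on_def vec_eq_iff)
  next
    case (insert s S)
    then obtain c :: "'n \<Rightarrow> nat" where c: "inj_on (\<lambda>\<alpha> :: nat ^ 'n. \<Sum>j\<in>S. \<alpha> $ j * c j)
      {\<alpha>. (\<forall>j\<in>S. \<alpha> $ j < B) \<and> (\<forall>j. j \<notin> S \<longrightarrow> \<alpha> $ j = 0)}" by blast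
    define c' where "c' j = (if j = s then 1 else B * c j)" for j
    have split: "(\<Sum>j\<in>insert s S. \<alpha> $ j * c' j) = \<alpha> $ s + B * (\<Sum>j\<in>S. \<alpha> $ j * c j)" for \<alpha> :: "nat ^ 'n"
    proof -
      have "(\<Sum>j\<in>S. \<alpha> $ j * c' j) = (\<Sum>j\<in>S. B * (\<alpha> $ j * c j))"
        by (rule sum.cong) (use insert in \<open>auto simp: c'_def\<close>)
      then show ?thesis using insert by (simp add: c'_def sum_distrib_left)
    qed
    have "inj_on (\<lambda>\<alpha> :: nat ^ 'n. \<Sum>j\<in>insert s S. \<alpha> $ j * c' j)
      {\<alpha>. (\<forall>j\<in>insert s S. \<alpha> $ j < B) \<and> (\<forall>j. j \<notin> insert s S \<longrightarrow> \<alpha> $ j = 0)}"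
    proof (rule inj_onI)
      fix \<alpha> \<beta> :: "nat ^ 'n"
      assume \<alpha>: "\<alpha> \<in> {\<alpha>. (\<forall>j\<in>insert s S. \<alpha> $ j < B) \<and> (\<forall>j. j \<notin> insert s S \<longrightarrow> \<alpha> $ j = 0)}"
        and \<beta>: "\<beta> \<in> {\<alpha>. (\<forall>j\<in>insert s S. \<alpha> $ j < B) \<and> (\<forall>j. j \<notin> insert s S \<longrightarrow> \<alpha> $ j = 0)}"
        and eq: "(\<Sum>j\<in>insert s S. \<alpha> $ j * c' j) = (\<Sum>j\<in>insert s S. \<beta> $ j * c' j)"
      from eq have eq': "\<alpha> $ s + B * (\<Sum>j\<in>S. \<alpha> $ j * c j) = \<beta> $ s + B * (\<Sum>j\<in>S. \<beta> $ j * c j)"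
        by (simp only: split)
      have lt: "\<alpha> $ s < B" "\<beta> $ s < B" using \<alpha> \<beta> by auto
      have s: "\<alpha> $ s = \<beta> $ s"
        using arg_cong [OF eq', of "\<lambda>x. x mod B"] lt by simp
      then have S: "(\<Sum>j\<in>S. \<alpha> $ j * c j) = (\<Sum>j\<in>S. \<beta> $ j * c j)"
        using eq' lt by simp
      define z where "z \<alpha> = (\<chi> j. if j = s then 0 else \<alpha> $ j)" for \<alpha> :: "nat ^ 'n"
      have zsum: "(\<Sum>j\<in>S. z \<alpha> $ j * c j) = (\<Sum>j\<in>S. \<alpha> $ j * c j)" for \<alpha>
        by (rule sum.cong) (use insert in \<open>auto simp: z_def\<close>)
      have "z \<alpha> = z \<beta>"
        by (rule inj_onD [OF c]) (use \<alpha> \<beta> S insert in \<open>auto simp only: zsum\<close>, auto simp: z_def)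
      show "\<alpha> = \<beta>"
        unfolding vec_eq_iff
      proof
        fix j
        show "\<alpha> $ j = \<beta> $ j"
          using s arg_cong [OF \<open>z \<alpha> = z \<beta>\<close>, of "\<lambda>x. x $ j"]
          by (cases "j = s") (simp_all add: z_def)
      qed
    qed
    then show ?case by blast
  qed
  from this [of UNIV] obtain c :: "'n \<Rightarrow> nat"
    where "inj_on (\<lambda>\<alpha> :: nat ^ 'n. \<Sum>j\<in>UNIV. \<alpha> $ j * c j) {\<alpha>. \<forall>j. \<alpha> $ j < B}" by auto
  moreover have "(\<Sum>j\<in>UNIV. (\<alpha> + \<beta>) $ j * c j) = (\<Sum>j\<in>UNIV. \<alpha> $ j * c j) + (\<Sum>j\<in>UNIV. \<beta> $ j * c j)"
    for \<alpha> \<beta> :: "nat ^ 'n"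
    by (simp add: sum.distrib algebra_simps)
  ultimately show ?thesis by (intro exI [of _ "\<lambda>\<alpha>. \<Sum>j\<in>UNIV. \<alpha> $ j * c j"]) auto
qed

instance mfps :: (finite, idom) idom
proof
  fix f g :: "('a, 'b) mfps"
  assume "f \<noteq> 0" "g \<noteq> 0"
  define deg where "deg \<alpha> = (\<Sum>j\<in>UNIV. \<alpha> $ j)" for \<alpha> :: "nat ^ 'a"
  have deg_add: "deg (\<alpha> + \<beta>) = deg \<alpha> + deg \<beta>" for \<alpha> \<beta> by (simp add: deg_def sum.distrib)
  have deg_ge: "\<alpha> $ j \<le> deg \<alpha>" for \<alpha> j
    unfolding deg_def by (rule member_le_sum) simp_all
  define low where "low h \<alpha> \<longleftrightarrow> mfps_nth h \<alpha> \<noteq> 0 \<and> (\<forall>\<beta>. mfps_nth h \<beta> \<noteq> 0 \<longrightarrow> deg \<alpha> \<le> deg \<beta>)"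
    for h :: "('a, 'b) mfps" and \<alpha>
  have ex_low: "\<exists>\<alpha>. low h \<alpha>" if "h \<noteq> 0" for h
  proof -
    from that obtain \<alpha> where "mfps_nth h \<alpha> \<noteq> 0"
      by (metis mfps_eqI zero_mfps.rep_eq)
    then show ?thesis
      unfolding low_def using ex_has_least_nat [of "\<lambda>\<alpha>. mfps_nth h \<alpha> \<noteq> 0" \<alpha> deg] by blast
  qed
  obtain \<alpha>1 \<beta>1 where low1: "low f \<alpha>1" "low g \<beta>1"
    using ex_low \<open>f \<noteq> 0\<close> \<open>g \<noteq> 0\<close> by blast
  obtain \<phi> :: "nat ^ 'a \<Rightarrow> nat" where \<phi>_add: "\<And>\<alpha> \<beta>. \<phi> (\<alpha> + \<beta>) = \<phi> \<alpha> + \<phi> \<beta>"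
    and \<phi>_inj: "inj_on \<phi> {\<alpha>. \<forall>j. \<alpha> $ j < deg \<alpha>1 + deg \<beta>1 + 1}"
    using ex_inj_weight by blast
  obtain \<alpha>0 where \<alpha>0: "low f \<alpha>0" "\<And>\<alpha>. low f \<alpha> \<Longrightarrow> \<phi> \<alpha>0 \<le> \<phi> \<alpha>"
    using ex_has_least_nat [of "low f" \<alpha>1 \<phi>] low1 by blast
  obtain \<beta>0 where \<beta>0: "low g \<beta>0" "\<And>\<beta>. low g \<beta> \<Longrightarrow> \<phi> \<beta>0 \<le> \<phi> \<beta>"
    using ex_has_least_nat [of "low g" \<beta>1 \<phi>] low1 by blast
  have only: "\<alpha> = \<alpha>0 \<and> \<beta> = \<beta>0"
    if "\<alpha> + \<beta> = \<alpha>0 + \<beta>0" "mfps_nth f \<alpha> * mfps_nth g \<beta> \<noteq> 0" for \<alpha> \<beta>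
  proof -
    have ne: "mfps_nth f \<alpha> \<noteq> 0" "mfps_nth g \<beta> \<noteq> 0" using that by auto
    have "deg \<alpha> + deg \<beta> = deg \<alpha>0 + deg \<beta>0" using that deg_add by metis
    moreover have "deg \<alpha>0 \<le> deg \<alpha>" "deg \<beta>0 \<le> deg \<beta>"
      using ne \<alpha>0(1) \<beta>0(1) by (auto simp: low_def)
    ultimately have "deg \<alpha> = deg \<alpha>0" "deg \<beta> = deg \<beta>0" by auto
    then have low: "low f \<alpha>" "low g \<beta>" using ne \<alpha>0(1) \<beta>0(1) by (auto simp: low_def)
    have "\<phi> \<alpha> + \<phi> \<beta> = \<phi> \<alpha>0 + \<phi> \<beta>0" using that \<phi>_add by metis
    then have eq: "\<phi> \<alpha> = \<phi> \<alpha>0" using \<alpha>0(2) [OF low(1)] \<beta>0(2) [OF low(2)] by auto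
    have small: "\<alpha>' $ j < deg \<alpha>1 + deg \<beta>1 + 1" if "low f \<alpha>'" for \<alpha>' j
    proof -
      have "deg \<alpha>' \<le> deg \<alpha>1" using that low1(1) by (auto simp: low_def)
      with deg_ge [of \<alpha>' j] show ?thesis by simp
    qed
    have "\<alpha> = \<alpha>0"
      by (rule inj_onD [OF \<phi>_inj eq]) (use small low \<alpha>0(1) in auto)
    then show ?thesis using that(1) by simp
  qed
  have "mfps_nth (f * g) (\<alpha>0 + \<beta>0) = (\<Sum>(\<alpha>, \<beta>)\<in>{(\<alpha>0, \<beta>0)}. mfps_nth f \<alpha> * mfps_nth g \<beta>)"
    unfolding times_mfps.rep_eq
    by (rule sum.mono_neutral_right) (use only in auto)
  also have "\<dots> \<noteq> 0" using \<alpha>0(1) \<beta>0(1) by (simp add: low_def)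
  finally show "f * g \<noteq> 0" by (auto simp: zero_mfps.rep_eq)
qed

definition mfps_const :: "'a \<Rightarrow> ('n::finite, 'a::zero) mfps" where
  "mfps_const c = Mfps (\<lambda>\<gamma>. if \<gamma> = 0 then c else 0)"

definition mfps_var :: "'n \<Rightarrow> ('n::finite, 'a::zero_neq_one) mfps" where
  "mfps_var j = Mfps (\<lambda>\<gamma>. if \<gamma> = unit_vec j then 1 else 0)"

definition mfps_map :: "('a \<Rightarrow> 'b) \<Rightarrow> ('n::finite, 'a) mfps \<Rightarrow> ('n, 'b) mfps" where
  "mfps_map h f = Mfps (\<lambda>\<gamma>. h (mfps_nth f \<gamma>))"

definition mfps_deriv :: "'n \<Rightarrow> ('n::finite, 'a::comm_ring_1) mfps \<Rightarrow> ('n, 'a) mfps" where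
  "mfps_deriv j f = Mfps (\<lambda>\<gamma>. of_nat (\<gamma> $ j + 1) * mfps_nth f (\<gamma> + unit_vec j))"

text \<open>\<open>(q(\<partial>\<^sub>t) \<bullet> f)|\<^bsub>t = 0\<^esub>\<close>\<close>

definition diff_at_0 ::
    "'n cpoly \<Rightarrow> ('n::finite, 'a::{comm_ring_1, complex_vector}) mfps \<Rightarrow> 'a" where
  "diff_at_0 q f = mfps_nth (poly_apply mfps_deriv q f) 0"

definition perp :: "('n::finite, complex) mfps set \<Rightarrow> 'n cpoly set" where
  "perp P = {q. \<forall>p\<in>P. diff_at_0 q p = 0}"

text \<open>\<open>\<complex>[\<partial>\<^sub>t]\<close> and \<open>\<complex>[y]\<close> have the same representation; here \<^const>\<open>Poly_Mapping.single\<close> monomials of the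
  argument stand for \<open>\<partial>\<^sub>t\<^sup>\<alpha>\<close> and \<open>Var j\<close> for \<open>y\<^sub>j\<close>.\<close>

definition Xi :: "'n cpoly \<Rightarrow> 'n::finite cpoly" where
  "Xi q = (\<Sum>\<alpha>\<in>keys q. lookup q \<alpha> *\<^sub>C (\<Prod>j\<in>UNIV. Var j ^ (\<alpha> $ j)))"


section \<open>The hypergeometric ideal and fake exponents\<close>

definition vec_of_nat :: "nat ^ 'n \<Rightarrow> 'a::semiring_1 ^ 'n" where
  "vec_of_nat u = (\<chi> j. of_nat (u $ j))"

definition vec_of_int :: "int ^ 'n \<Rightarrow> 'a::ring_1 ^ 'n" where
  "vec_of_int u = (\<chi> j. of_int (u $ j))"

definition in_affine_hyperplane :: "int ^ 'n ^ 'd \<Rightarrow> bool" where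
  "in_affine_hyperplane A \<longleftrightarrow> (\<exists>(c :: rat ^ 'd) b. c \<noteq> 0 \<and> b \<noteq> 0 \<and>
     (\<forall>j. (\<Sum>i\<in>UNIV. c $ i * of_int (A $ i $ j)) = b))"

definition int_kernel :: "int ^ 'n ^ 'd \<Rightarrow> (int ^ 'n) set" where
  "int_kernel A = {u. A *v u = 0}"

definition toric_ideal :: "int ^ 'n ^ 'd \<Rightarrow> 'n::finite cpoly set" where
  "toric_ideal A = ideal_of {Poly_Mapping.single u 1 - Poly_Mapping.single v 1 | u v.
     A *v vec_of_nat u = A *v vec_of_nat v}"

definition euler :: "int ^ 'n ^ 'd \<Rightarrow> complex ^ 'd \<Rightarrow> 'd \<Rightarrow> 'n::finite cpoly" where
  "euler A \<beta> i = (\<Sum>j\<in>UNIV. of_int (A $ i $ j) * Var j) - Const (\<beta> $ i)"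

definition hyp_ideal :: "int ^ 'n ^ 'd \<Rightarrow> complex ^ 'd \<Rightarrow> 'n::finite weyl set" where
  "hyp_ideal A \<beta> = left_ideal (poly_d ` toric_ideal A \<union> range (\<lambda>i. poly_theta (euler A \<beta> i)))"

definition generic_weight :: "int ^ 'n ^ 'd \<Rightarrow> real ^ 'n \<Rightarrow> bool" where
  "generic_weight A w \<longleftrightarrow> (\<forall>u\<in>int_kernel A. u \<noteq> 0 \<longrightarrow> w \<bullet> vec_of_int u \<noteq> 0)"

definition initial_form :: "real ^ 'n \<Rightarrow> 'n cpoly \<Rightarrow> 'n::finite cpoly" where
  "initial_form w f =
     (\<Sum>\<alpha> | \<alpha> \<in> keys f \<and> (\<forall>\<gamma>\<in>keys f. w \<bullet> vec_of_nat \<gamma> \<le> w \<bullet> vec_of_nat \<alpha>).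
        Poly_Mapping.single \<alpha> (lookup f \<alpha>))"

definition initial_ideal :: "real ^ 'n \<Rightarrow> 'n cpoly set \<Rightarrow> 'n::finite cpoly set" where
  "initial_ideal w I = ideal_of (initial_form w ` I)"

definition fake_indicial_ideal ::
    "int ^ 'n ^ 'd \<Rightarrow> complex ^ 'd \<Rightarrow> real ^ 'n \<Rightarrow> 'n::finite cpoly set" where
  "fake_indicial_ideal A \<beta> w =
     ideal_sum {p. poly_theta p \<in> left_ideal (poly_d ` initial_ideal w (toric_ideal A))}
               (ideal_of (range (euler A \<beta>)))"

definition fake_exponent ::
    "int ^ 'n ^ 'd \<Rightarrow> complex ^ 'd \<Rightarrow> real ^ 'n \<Rightarrow> complex ^ 'n::finite \<Rightarrow> bool" where
  "fake_exponent A \<beta> w v \<longleftrightarrow> (\<forall>p\<in>fake_indicial_ideal A \<beta> w. poly_eval p v = 0)"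


section \<open>Formal logarithmic series\<close>

text \<open>A formal sum \<open>\<Sum>\<^sub>v x\<^sup>v r\<^sub>v(log x)\<close> over exponents \<open>v \<in> \<complex>\<^sup>n\<close> is represented by its family of
  coefficients \<open>r\<^sub>v \<in> \<complex>[y]\<close>.\<close>

type_synonym 'n log_series = "complex ^ 'n \<Rightarrow> 'n cpoly"

definition log_x :: "'n \<Rightarrow> 'n log_series \<Rightarrow> 'n::finite log_series" where
  "log_x j \<phi> = (\<lambda>v. \<phi> (v - unit_vec j))"

text \<open>From \<open>\<partial>\<^sub>j (x\<^sup>v r(log x)) = x\<^bsup>v - e\<^sub>j\<^esup> (v\<^sub>j r + \<partial>r/\<partial>y\<^sub>j)(log x)\<close>.\<close>

definition log_d :: "'n \<Rightarrow> 'n log_series \<Rightarrow> 'n::finite log_series" where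
  "log_d j \<phi> = (\<lambda>v. (v $ j + 1) *\<^sub>C \<phi> (v + unit_vec j) + poly_deriv j (\<phi> (v + unit_vec j)))"

definition weyl_act :: "'n weyl \<Rightarrow> 'n log_series \<Rightarrow> 'n::finite log_series" where
  "weyl_act = weyl_apply log_x log_d"

lemma poly_deriv_add: "poly_deriv j (p + q) = poly_deriv j p + poly_deriv j q"
  and poly_deriv_scaleC: "poly_deriv j (c *\<^sub>C p) = c *\<^sub>C poly_deriv j p"
  by (rule poly_mapping_eqI;
      simp add: poly_deriv.rep_eq lookup_add algebra_simps scaleC_complex_def)+

lemma poly_deriv_commute: "poly_deriv i (poly_deriv j p) = poly_deriv j (poly_deriv i p)"
  by (rule poly_mapping_eqI) (auto simp: poly_deriv.rep_eq unit_vec_nth ac_simps)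

interpretation log_series: weyl_rep log_x log_d
proof
  fix i j :: 'a and m :: "'a log_series"
  show "clinear (log_x j :: 'a log_series \<Rightarrow> _)"
    by (rule clinearI) (simp_all add: log_x_def fun_eq_iff scaleC_fun_def)
  show "clinear (log_d j :: 'a log_series \<Rightarrow> _)"
    by (rule clinearI)
       (simp_all add: log_d_def fun_eq_iff scaleC_fun_def scaleC_add_right poly_deriv_add
         poly_deriv_scaleC ac_simps)
  show "log_x i (log_x j m) = log_x j (log_x i m)"
    by (simp add: log_x_def fun_eq_iff algebra_simps)
  show "log_d i (log_d j m) = log_d j (log_d i m)"
    by (cases "i = j")
       (simp_all add: log_d_def fun_eq_iff scaleC_add_right poly_deriv_add poly_deriv_scaleC
         poly_deriv_commute [of i j] unit_vec_nth ac_simps)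
  have step: "c *\<^sub>C p = p + (c - 1) *\<^sub>C p" for c and p :: "'a cpoly"
    using scaleC_add_left [of 1 "c - 1" p] by simp
  show "log_d j (log_x i m) = log_x i (log_d j m) + (if i = j then m else 0)"
    by (auto simp: log_d_def log_x_def fun_eq_iff unit_vec_nth algebra_simps scaleC_add_left
        intro: step)
qed

lemma weyl_act_times: "weyl_act (P * Q) \<phi> = weyl_act P (weyl_act Q \<phi>)"
  unfolding weyl_act_def by (rule log_series.apply_times)

text \<open>\<open>\<Sum>\<^sub>u x\<^bsup>v\<^sub>0 + u\<^esup> r\<^sub>u(log x)\<close>, the sum being over \<open>u \<in> \<int>\<^sup>n\<close>. For each \<open>v\<close> at most one \<open>u\<close>
  contributes.\<close>

definition log_series_at :: "complex ^ 'n \<Rightarrow> (int ^ 'n \<Rightarrow> 'n cpoly) \<Rightarrow> 'n::finite log_series" where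
  "log_series_at v0 r = (\<lambda>v. Sum_any (\<lambda>u. r u when v = v0 + vec_of_int u))"

definition annihilated ::
    "int ^ 'n ^ 'd \<Rightarrow> complex ^ 'd \<Rightarrow> 'n::finite log_series \<Rightarrow> bool" where
  "annihilated A \<beta> \<phi> \<longleftrightarrow> (\<forall>P\<in>hyp_ideal A \<beta>. weyl_act P \<phi> = 0)"

definition hypergeometric_series ::
    "int ^ 'n ^ 'd \<Rightarrow> complex ^ 'd \<Rightarrow> complex ^ 'n \<Rightarrow> (int ^ 'n \<Rightarrow> 'n::finite cpoly) \<Rightarrow> bool" where
  "hypergeometric_series A \<beta> v0 r \<longleftrightarrow>
     (\<forall>u. r u \<noteq> 0 \<longrightarrow> u \<in> int_kernel A) \<and> annihilated A \<beta> (log_series_at v0 r)"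

definition rational_polyhedral_cone :: "(real ^ 'n) set \<Rightarrow> bool" where
  "rational_polyhedral_cone C \<longleftrightarrow>
     (\<exists>G. finite G \<and> (\<forall>g\<in>G. \<forall>j. g $ j \<in> \<rat>) \<and> C = convex_cone hull G)"

definition in_direction :: "real ^ 'n \<Rightarrow> (int ^ 'n \<Rightarrow> 'n::finite cpoly) \<Rightarrow> bool" where
  "in_direction w r \<longleftrightarrow>
     (\<exists>b. \<forall>u. \<forall>\<alpha>\<in>keys (r u). (\<Sum>j\<in>UNIV. \<alpha> $ j) \<le> b) \<and>
     (\<forall>u. r u \<noteq> 0 \<longrightarrow> w \<bullet> vec_of_int u \<ge> 0) \<and>
     (\<exists>C T. rational_polyhedral_cone C \<and> (\<forall>x\<in>C. x \<noteq> 0 \<longrightarrow> w \<bullet> x > 0) \<and> finite T \<and>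
        (\<forall>u. r u \<noteq> 0 \<longrightarrow> vec_of_int u \<in> (\<Union>p\<in>T. (+) p ` C)))"


section \<open>Negative support families\<close>

definition nsupp :: "complex ^ 'n \<Rightarrow> 'n set" where
  "nsupp v = {j. \<exists>k::int. k < 0 \<and> v $ j = of_int k}"

definition nsupp_at :: "complex ^ 'n \<Rightarrow> int ^ 'n \<Rightarrow> 'n set" where
  "nsupp_at v0 u = nsupp (v0 + vec_of_int u)"

definition NS :: "int ^ 'n ^ 'd \<Rightarrow> complex ^ 'n \<Rightarrow> 'n set set" where
  "NS A v0 = nsupp_at v0 ` int_kernel A"

definition NS_nonneg :: "int ^ 'n ^ 'd \<Rightarrow> real ^ 'n \<Rightarrow> complex ^ 'n \<Rightarrow> 'n set set" where
  "NS_nonneg A w v0 =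
     {I \<in> NS A v0. \<forall>u\<in>int_kernel A. nsupp_at v0 u = I \<longrightarrow> w \<bullet> vec_of_int u \<ge> 0}"

definition negative_support_family ::
    "int ^ 'n ^ 'd \<Rightarrow> real ^ 'n \<Rightarrow> complex ^ 'n \<Rightarrow> 'n set set \<Rightarrow> bool" where
  "negative_support_family A w v0 N \<longleftrightarrow> nsupp_at v0 0 \<in> N \<and> N \<subseteq> NS_nonneg A w v0"

definition ordered_family :: "int ^ 'n ^ 'd \<Rightarrow> complex ^ 'n \<Rightarrow> 'n set set \<Rightarrow> bool" where
  "ordered_family A v0 N \<longleftrightarrow> (\<forall>I\<in>N. \<forall>J\<in>NS A v0. J \<subseteq> I \<longrightarrow> J \<in> N)"

text \<open>The space \<open>C\<^bsub>v\<^sub>0,N\<^esub>\<close>.\<close>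

definition initial_coeff_space ::
    "int ^ 'n ^ 'd \<Rightarrow> complex ^ 'd \<Rightarrow> complex ^ 'n \<Rightarrow> 'n set set \<Rightarrow> 'n::finite cpoly set" where
  "initial_coeff_space A \<beta> v0 N =
     {r 0 | r. (\<forall>u. r u \<noteq> 0 \<longrightarrow> u \<in> int_kernel A \<and> nsupp_at v0 u \<in> N) \<and>
               annihilated A \<beta> (log_series_at v0 r)}"


section \<open>The perturbed series and the associated ideals\<close>

definition t_prod :: "'n set \<Rightarrow> ('n::finite, complex) mfps" where
  "t_prod S = (\<Prod>j\<in>S. mfps_var j)"

definition pos_part :: "int ^ 'n \<Rightarrow> nat ^ 'n" where
  "pos_part u = (\<chi> j. nat (u $ j))"

definition neg_part :: "int ^ 'n \<Rightarrow> nat ^ 'n" where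
  "neg_part u = (\<chi> j. nat (- u $ j))"

definition falling :: "'a::comm_ring_1 ^ 'n::finite \<Rightarrow> nat ^ 'n \<Rightarrow> 'a" where
  "falling \<alpha> \<nu> = (\<Prod>j\<in>UNIV. \<Prod>k<\<nu> $ j. \<alpha> $ j - of_nat k)"

text \<open>\<open>v + t\<close>\<close>

definition perturb :: "complex ^ 'n \<Rightarrow> ('n::finite, complex) mfps ^ 'n" where
  "perturb v = (\<chi> j. mfps_const (v $ j) + mfps_var j)"

definition m_hat :: "complex ^ 'n \<Rightarrow> 'n set set \<Rightarrow> ('n::finite, complex) mfps" where
  "m_hat v0 N = t_prod (nsupp_at v0 0 - \<Inter>N)"

definition a_hat :: "complex ^ 'n \<Rightarrow> int ^ 'n \<Rightarrow> ('n::finite, complex) mfps fract" where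
  "a_hat v0 u = Fract (falling (perturb v0) (neg_part u))
                      (falling (perturb (v0 + vec_of_int u)) (pos_part u))"

text \<open>The product of \<open>m_hat\<close> and \<open>a_hat\<close> as an element of \<open>\<complex>[[t]]\<close>, to which it belongs whenever
  the negative support of \<open>v\<^sub>0 + u\<close> is in \<open>N\<close>.\<close>

definition ma_hat :: "complex ^ 'n \<Rightarrow> 'n set set \<Rightarrow> int ^ 'n \<Rightarrow> ('n::finite, complex) mfps" where
  "ma_hat v0 N u = (THE f. Fract f 1 = Fract (m_hat v0 N) 1 * a_hat v0 u)"

text \<open>\<open>exp (\<Sum>\<^sub>j t\<^sub>j y\<^sub>j) = \<Sum>\<^sub>\<alpha> y\<^sup>\<alpha> t\<^sup>\<alpha> / \<alpha>!\<close> as an element of \<open>\<complex>[y][[t]]\<close>\<close>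

definition exp_ty :: "('n::finite, 'n cpoly) mfps" where
  "exp_ty = Mfps (\<lambda>\<alpha>. Poly_Mapping.single \<alpha> (1 / (\<Prod>j\<in>UNIV. fact (\<alpha> $ j))))"

text \<open>The coefficient, in \<open>\<complex>[y][[t]]\<close> with \<open>y = log x\<close>, of \<open>x\<^bsup>v\<^sub>0 + u\<^esup>\<close> in the perturbed series.\<close>

definition F_hat ::
    "int ^ 'n ^ 'd \<Rightarrow> complex ^ 'n \<Rightarrow> 'n set set \<Rightarrow> int ^ 'n \<Rightarrow> ('n::finite, 'n cpoly) mfps" where
  "F_hat A v0 N u = (if u \<in> int_kernel A \<and> nsupp_at v0 u \<in> N
     then mfps_map Const (ma_hat v0 N u) * exp_ty else 0)"

text \<open>The coefficients of \<open>(q(\<partial>\<^sub>t) \<bullet> F)|\<^bsub>t = 0\<^esub>\<close>.\<close>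

definition F_series ::
    "int ^ 'n ^ 'd \<Rightarrow> complex ^ 'n \<Rightarrow> 'n set set \<Rightarrow> 'n cpoly \<Rightarrow> int ^ 'n \<Rightarrow> 'n::finite cpoly" where
  "F_series A v0 N q = (\<lambda>u. diff_at_0 q (F_hat A v0 N u))"

definition M_hat :: "'n set set \<Rightarrow> ('n::finite, complex) mfps set" where
  "M_hat N = ideal_of {t_prod (I - \<Inter>N) | I. I \<in> N}"

definition P_hat ::
    "int ^ 'n ^ 'd \<Rightarrow> complex ^ 'n \<Rightarrow> 'n set set \<Rightarrow> ('n::finite, complex) mfps set" where
  "P_hat A v0 N = ideal_of {t_prod ((I \<union> J) - \<Inter>N) | I J. I \<in> N \<and> J \<in> NS A v0 - N}"

definition At_ideal :: "int ^ 'n ^ 'd \<Rightarrow> ('n::finite, complex) mfps set" where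
  "At_ideal A = ideal_of (range (\<lambda>i. \<Sum>j\<in>UNIV. of_int (A $ i $ j) * mfps_var j))"

definition Q_hat ::
    "int ^ 'n ^ 'd \<Rightarrow> complex ^ 'n \<Rightarrow> 'n set set \<Rightarrow> ('n::finite, complex) mfps set" where
  "Q_hat A v0 N = ideal_sum (ideal_prod (At_ideal A) (M_hat N)) (P_hat A v0 N)"

declare One_nat_def [simp]

end

theory Submission
  imports Defs
begin

text \<open>Let \<open>f \<in> \<complex>[[t]]\<close> act on \<open>\<complex>[y]\<close> as the differential operator \<open>f(\<partial>\<^sub>y)\<close>. This action is adjoint to
  multiplication under \<open>(q, f) \<mapsto> (q(\<partial>\<^sub>t) \<bullet> f)|\<^bsub>t = 0\<^esub>\<close>. So the orthogonal space of an ideal consists of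
  the polynomials killed by its generators, and the coefficient of \<open>x\<^bsup>v\<^sub>0 + u\<^esup>\<close> in the series of \<open>q\<close>
  is \<open>(m a\<^sub>u)(\<partial>\<^sub>y) q\<close>. Here \<open>m a\<^sub>u\<close> is a unit times \<open>t\<^bsup>I\<^sub>u - K\<^esup>\<close>, so that the equations of \<open>H\<^sub>A(\<beta>)\<close> for
  a series supported on \<open>N\<close> relate coefficients by operators that are units times squarefree
  monomials, and they hold for the series of \<open>q\<close> if and only if \<open>q\<close> is killed by the generators of
  \<open>Q\<^sub>N\<close>. Conversely, the equations between the coefficients of an arbitrary solution are the pairwise
  syzygies of the monomials \<open>t\<^bsup>I - K\<^esup>\<close>, hence the coefficients have a common antiderivative \<open>q\<close> and
  every solution supported on \<open>N\<close> is the series of some \<open>q\<close>. Finally \<open>m(\<partial>\<^sub>y) Q\<^sub>N\<^sup>\<bottom> = (Q\<^sub>N : m)\<^sup>\<bottom>\<close> by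
  duality, where homogeneity of \<open>Q\<^sub>N\<close> reduces the topology of \<open>\<complex>[[t]]\<close> to finitely many degrees.\<close>

declare One_nat_def [simp del]

section \<open>Power series acting on polynomials by differential operators\<close>

lemma nat_vec_le_iff: "\<alpha> \<le> \<gamma> \<longleftrightarrow> (\<exists>\<delta>. \<gamma> = \<alpha> + (\<delta> :: nat ^ 'n))"
proof
  assume "\<alpha> \<le> \<gamma>"
  then have "\<gamma> = \<alpha> + (\<gamma> - \<alpha>)"
    by (simp add: vec_eq_iff less_eq_vec_def)
  then show "\<exists>\<delta>. \<gamma> = \<alpha> + \<delta>" ..
qed (auto simp: less_eq_vec_def)

lemma nat_vec_diff_add: "\<alpha> \<le> \<gamma> \<Longrightarrow> \<gamma> - \<alpha> + \<alpha> = (\<gamma> :: nat ^ 'n)"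
  by (simp add: vec_eq_iff less_eq_vec_def)

lemma nat_vec_le_add [simp]: "\<alpha> \<le> \<alpha> + (\<gamma> :: nat ^ 'n)" "\<alpha> \<le> \<gamma> + (\<alpha> :: nat ^ 'n)"
  by (simp_all add: less_eq_vec_def)

definition mfps_monom :: "nat ^ 'n \<Rightarrow> ('n::finite, 'a::zero_neq_one) mfps" where
  "mfps_monom \<alpha> = Mfps (\<lambda>\<gamma>. if \<gamma> = \<alpha> then 1 else 0)"

lemma mfps_nth_monom: "mfps_nth (mfps_monom \<alpha>) \<gamma> = (if \<gamma> = \<alpha> then 1 else 0)"
  by (simp add: mfps_monom_def)

lemma mfps_var_eq_monom: "mfps_var j = mfps_monom (unit_vec j)"
  by (simp add: mfps_var_def mfps_monom_def)

lemma mfps_one_eq_monom: "1 = mfps_monom 0"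
  by (rule mfps_eqI) (simp add: mfps_nth_monom one_mfps.rep_eq)

lemma mfps_nth_monom_mult:
  fixes g :: "('n::finite, 'a::comm_ring_1) mfps"
  shows "mfps_nth (mfps_monom \<alpha> * g) \<gamma> = (if \<alpha> \<le> \<gamma> then mfps_nth g (\<gamma> - \<alpha>) else 0)"
proof (cases "\<alpha> \<le> \<gamma>")
  case True
  have "mfps_nth (mfps_monom \<alpha> * g) \<gamma>
      = (\<Sum>(a, b)\<in>{(\<alpha>, \<gamma> - \<alpha>)}. mfps_nth (mfps_monom \<alpha> :: ('n, 'a) mfps) a * mfps_nth g b)"
    unfolding times_mfps.rep_eq
    by (rule sum.mono_neutral_right [OF finite_splittings])
       (use True in \<open>auto simp: mfps_nth_monom add.commute [of \<alpha>] nat_vec_diff_add split: if_splits\<close>)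
  then show ?thesis using True by (simp add: mfps_nth_monom)
next
  case False
  then have "mfps_nth (mfps_monom \<alpha> :: ('n, 'a) mfps) a * mfps_nth g b = 0" if "a + b = \<gamma>" for a b
    using that by (auto simp: mfps_nth_monom nat_vec_le_iff)
  then show ?thesis using False by (auto simp: times_mfps.rep_eq intro!: sum.neutral)
qed

lemma mfps_monom_mult: "mfps_monom \<alpha> * mfps_monom \<beta> = (mfps_monom (\<alpha> + \<beta>) :: ('n::finite, 'a::comm_ring_1) mfps)"
  by (rule mfps_eqI)
     (auto simp: mfps_nth_monom_mult mfps_nth_monom add.commute [of \<alpha>] dest: nat_vec_diff_add)

lemma mfps_nth_const_mult:
  fixes g :: "('n::finite, 'a::comm_ring_1) mfps"
  shows "mfps_nth (mfps_const c * g) \<gamma> = c * mfps_nth g \<gamma>"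
proof -
  have "mfps_nth (mfps_const c * g) \<gamma>
      = (\<Sum>(a, b)\<in>{(0, \<gamma>)}. mfps_nth (mfps_const c :: ('n, 'a) mfps) a * mfps_nth g b)"
    unfolding times_mfps.rep_eq
    by (rule sum.mono_neutral_right) (auto simp: mfps_const_def split: if_splits)
  then show ?thesis by (simp add: mfps_const_def)
qed

lemma mfps_nth_sum: "mfps_nth (\<Sum>i\<in>I. f i) \<gamma> = (\<Sum>i\<in>I. mfps_nth (f i) \<gamma>)"
  by (induction I rule: infinite_finite_induct) (simp_all add: zero_mfps.rep_eq plus_mfps.rep_eq)

lemma mfps_nth_of_int:
  "mfps_nth (of_int k :: ('n::finite, 'a::comm_ring_1) mfps) \<gamma> = (if \<gamma> = 0 then of_int k else 0)"
proof -
  have nat: "mfps_nth (of_nat m :: ('n, 'a) mfps) \<gamma> = (if \<gamma> = 0 then of_nat m else 0)" for m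
    by (induction m) (simp_all add: zero_mfps.rep_eq plus_mfps.rep_eq one_mfps.rep_eq)
  show ?thesis
    by (cases k rule: int_cases2) (simp_all add: nat uminus_mfps.rep_eq)
qed

lemma mfps_const_of_int: "mfps_const (of_int k) = (of_int k :: ('n::finite, 'a::comm_ring_1) mfps)"
  by (rule mfps_eqI) (simp add: mfps_nth_of_int mfps_const_def)

lemma mfps_const_of_nat: "mfps_const (of_nat k) = (of_nat k :: ('n::finite, 'a::comm_ring_1) mfps)"
  using mfps_const_of_int [of "int k"] by simp

lemma mfps_const_diff: "mfps_const (a - b) = mfps_const a - (mfps_const b :: ('n::finite, 'a::comm_ring_1) mfps)"
  by (rule mfps_eqI) (simp add: mfps_const_def minus_mfps.rep_eq)

section \<open>The duality between polynomials and power series\<close>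

definition mi_fact :: "nat ^ 'n::finite \<Rightarrow> nat" where
  "mi_fact \<alpha> = (\<Prod>j\<in>UNIV. fact (\<alpha> $ j))"

lemma mi_fact_nonzero [simp]: "mi_fact \<alpha> \<noteq> 0"
  by (simp add: mi_fact_def)

lemma mi_fact_zero [simp]: "mi_fact 0 = 1"
  by (simp add: mi_fact_def)

lemma mi_fact_Suc: "mi_fact (\<alpha> + unit_vec j) = (\<alpha> $ j + 1) * mi_fact \<alpha>"
proof -
  have "mi_fact (\<alpha> + unit_vec j) = fact (\<alpha> $ j + 1) * (\<Prod>i\<in>UNIV - {j}. fact ((\<alpha> + unit_vec j) $ i))"
    unfolding mi_fact_def by (subst prod.remove [of UNIV j]) (simp_all add: unit_vec_nth)
  also have "(\<Prod>i\<in>UNIV - {j}. fact ((\<alpha> + unit_vec j) $ i)) = (\<Prod>i\<in>UNIV - {j}. fact (\<alpha> $ i) :: nat)"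
    by (rule prod.cong) (auto simp: unit_vec_nth)
  also have "fact (\<alpha> $ j + 1) * \<dots> = (\<alpha> $ j + 1) * mi_fact \<alpha>"
    by (simp add: mi_fact_def prod.remove [of UNIV j "\<lambda>j. fact (\<alpha> $ j)"] One_nat_def algebra_simps)
  finally show ?thesis .
qed

text \<open>The closed form of \<open>diff_at_0\<close> for complex coefficients: applying the
  monomial operator with exponent \<alpha> to a series and setting t = 0 gives \<alpha>! times its
  coefficient at \<alpha>.\<close>

definition pairing :: "'n cpoly \<Rightarrow> ('n::finite, complex) mfps \<Rightarrow> complex" where
  "pairing q f = (\<Sum>\<alpha>\<in>keys q. lookup q \<alpha> * of_nat (mi_fact \<alpha>) * mfps_nth f \<alpha>)"

lemma pairing_eq:
  assumes "finite S" "keys q \<subseteq> S"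
  shows "pairing q f = (\<Sum>\<alpha>\<in>S. lookup q \<alpha> * of_nat (mi_fact \<alpha>) * mfps_nth f \<alpha>)"
  unfolding pairing_def
  by (rule sum.mono_neutral_left) (use assms in \<open>auto simp: in_keys_iff\<close>)

lemma pairing_add_left: "pairing (p + q) f = pairing p f + pairing q f"
  using keys_add [of p q]
  by (simp add: pairing_eq [of "keys p \<union> keys q"] lookup_add algebra_simps sum.distrib)

lemma pairing_scaleC_left: "pairing (c *\<^sub>C p) f = c * pairing p f"
proof -
  have "keys (c *\<^sub>C p) \<subseteq> keys p"
    by (auto simp: in_keys_iff)
  then show ?thesis
    by (simp add: pairing_eq [of "keys p"] scaleC_complex_def sum_distrib_left mult.assoc)
qed

lemma pairing_zero_left [simp]: "pairing 0 f = 0"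
  and pairing_zero_right [simp]: "pairing p 0 = 0"
  by (simp_all add: pairing_def zero_mfps.rep_eq)

lemma pairing_add_right: "pairing p (f + g) = pairing p f + pairing p g"
  by (simp add: pairing_def plus_mfps.rep_eq algebra_simps sum.distrib)

lemma pairing_const_mult: "pairing p (mfps_const c * f) = c * pairing p f"
  by (simp add: pairing_def mfps_nth_const_mult sum_distrib_left mult.left_commute mult.assoc)

lemma pairing_sum_right: "pairing p (\<Sum>i\<in>I. f i) = (\<Sum>i\<in>I. pairing p (f i))"
  by (induction I rule: infinite_finite_induct) (simp_all add: pairing_add_right)

lemma pairing_monom: "pairing q (mfps_monom \<gamma>) = of_nat (mi_fact \<gamma>) * lookup q \<gamma>"
  by (cases "\<gamma> \<in> keys q")
     (auto simp: pairing_def mfps_nth_monom in_keys_iff if_distrib [where f = "\<lambda>x. _ * x"] cong: if_cong)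

lemma pairing_eqI:
  assumes "\<And>\<gamma>. pairing p (mfps_monom \<gamma>) = pairing q (mfps_monom \<gamma>)"
  shows "p = q"
  using assms by (intro poly_mapping_eqI) (simp add: pairing_monom)

text \<open>The differential operator \<open>f(\<partial>\<^sub>y)\<close>, defined as the adjoint
  of multiplication by f. By \<open>pairing_monom\<close> the coefficient at \<gamma> of a
  polynomial is its pairing with the monomial of exponent \<gamma>, divided by \<gamma>!, so
  adjointness leaves no other choice.\<close>

definition act :: "('n::finite, complex) mfps \<Rightarrow> 'n cpoly \<Rightarrow> 'n cpoly" where
  "act f q = Abs_poly_mapping (\<lambda>\<gamma>. pairing q (mfps_monom \<gamma> * f) / of_nat (mi_fact \<gamma>))"

text \<open>Only those \<gamma> contribute that lie below some exponent occurring in q, so the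
  family of coefficients has finite support and really is a polynomial.\<close>

lemma lookup_act: "lookup (act f q) \<gamma> = pairing q (mfps_monom \<gamma> * f) / of_nat (mi_fact \<gamma>)"
proof -
  have "{\<gamma>. pairing q (mfps_monom \<gamma> * f) / of_nat (mi_fact \<gamma>) \<noteq> 0} \<subseteq> (\<Union>\<alpha>\<in>keys q. {\<gamma>. \<forall>j. \<gamma> $ j \<le> \<alpha> $ j})"
  proof
    fix \<gamma> assume "\<gamma> \<in> {\<gamma>. pairing q (mfps_monom \<gamma> * f) / of_nat (mi_fact \<gamma>) \<noteq> 0}"
    then have "pairing q (mfps_monom \<gamma> * f) \<noteq> 0" by auto
    then obtain \<alpha> where "\<alpha> \<in> keys q" "mfps_nth (mfps_monom \<gamma> * f) \<alpha> \<noteq> 0"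
      unfolding pairing_def by (metis (mono_tags, lifting) mult_zero_right sum.neutral)
    then show "\<gamma> \<in> (\<Union>\<alpha>\<in>keys q. {\<gamma>. \<forall>j. \<gamma> $ j \<le> \<alpha> $ j})"
      by (auto simp: mfps_nth_monom_mult less_eq_vec_def split: if_splits)
  qed
  then have "finite {\<gamma>. pairing q (mfps_monom \<gamma> * f) / of_nat (mi_fact \<gamma>) \<noteq> 0}"
    by (rule finite_subset) (simp add: finite_nat_vec_atMost)
  then show ?thesis by (simp add: act_def)
qed

text \<open>Adjointness extends from monomials to all series g because each coefficient of f * g is
  a finite Cauchy sum, and one finite set S of exponents serves all monomials of q at once.\<close>

lemma pairing_act: "pairing (act f q) g = pairing q (f * g)"
proof -
  let ?S = "\<lambda>\<alpha>. {\<gamma> :: nat ^ 'a. \<forall>j. \<gamma> $ j \<le> \<alpha> $ j}"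
  define S where "S = (\<Union>\<alpha>\<in>keys q. ?S \<alpha>)"
  have fin: "finite S" unfolding S_def by (simp add: finite_nat_vec_atMost)
  have inner: "(\<Sum>\<gamma>\<in>S. mfps_nth (mfps_monom \<gamma> * f) \<alpha> * mfps_nth g \<gamma>) = mfps_nth (f * g) \<alpha>"
    if "\<alpha> \<in> keys q" for \<alpha>
  proof -
    have "(\<Sum>\<gamma>\<in>S. mfps_nth (mfps_monom \<gamma> * f) \<alpha> * mfps_nth g \<gamma>)
        = (\<Sum>\<gamma>\<in>?S \<alpha>. mfps_nth f (\<alpha> - \<gamma>) * mfps_nth g \<gamma>)"
      by (rule sum.mono_neutral_cong_right [OF fin])
         (use that in \<open>auto simp: S_def mfps_nth_monom_mult less_eq_vec_def\<close>)
    also have "\<dots> = mfps_nth (f * g) \<alpha>"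
      unfolding times_mfps.rep_eq
      by (rule sum.reindex_bij_witness [where i = snd and j = "\<lambda>\<gamma>. (\<alpha> - \<gamma>, \<gamma>)"])
         (auto simp: vec_eq_iff split_beta, metis add_diff_cancel_right', metis le_add2)
    finally show ?thesis .
  qed
  have zero: "lookup (act f q) \<gamma> = 0" if "\<gamma> \<notin> S" for \<gamma>
  proof -
    have "mfps_nth (mfps_monom \<gamma> * f) \<alpha> = 0" if "\<alpha> \<in> keys q" for \<alpha>
      using that \<open>\<gamma> \<notin> S\<close> by (auto simp: S_def mfps_nth_monom_mult less_eq_vec_def)
    then show ?thesis by (simp add: lookup_act pairing_def)
  qed
  then have "keys (act f q) \<subseteq> S" by (auto simp: in_keys_iff)
  then have "pairing (act f q) g = (\<Sum>\<gamma>\<in>S. pairing q (mfps_monom \<gamma> * f) * mfps_nth g \<gamma>)"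
    by (simp add: pairing_eq [OF fin] lookup_act)
  also have "\<dots> = (\<Sum>\<alpha>\<in>keys q. \<Sum>\<gamma>\<in>S. lookup q \<alpha> * of_nat (mi_fact \<alpha>) * (mfps_nth (mfps_monom \<gamma> * f) \<alpha> * mfps_nth g \<gamma>))"
    unfolding pairing_def sum_distrib_right by (subst sum.swap) (simp add: ac_simps)
  also have "\<dots> = pairing q (f * g)"
    by (simp add: pairing_def inner flip: sum_distrib_left)
  finally show ?thesis .
qed

lemma act_mult: "act (f * g) q = act f (act g q)"
  by (rule pairing_eqI) (simp add: pairing_act ac_simps)

lemma act_one [simp]: "act 1 q = q"
  by (rule pairing_eqI) (simp add: pairing_act)

lemma act_add_left: "act (f + g) q = act f q + act g q"
  by (rule pairing_eqI) (simp add: pairing_act pairing_add_left pairing_add_right distrib_right)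

lemma act_zero_left [simp]: "act 0 q = 0" and act_zero_right [simp]: "act f 0 = 0"
  by (rule pairing_eqI; simp add: pairing_act)+

lemma act_const: "act (mfps_const c) q = c *\<^sub>C q"
  by (rule pairing_eqI) (simp add: pairing_act pairing_const_mult pairing_scaleC_left)

lemma act_sum_left: "act (\<Sum>i\<in>I. f i) q = (\<Sum>i\<in>I. act (f i) q)"
  by (induction I rule: infinite_finite_induct) (simp_all add: act_add_left)

lemma act_commute: "act f (act g q) = act g (act f q)"
  by (simp add: mult.commute flip: act_mult)

lemma act_var: "act (mfps_var j) q = poly_deriv j q"
  by (rule poly_mapping_eqI)
     (simp add: lookup_act mfps_var_eq_monom mfps_monom_mult pairing_monom mi_fact_Suc poly_deriv.rep_eq)

text \<open>By adjointness, orthogonality to the whole principal ideal of f is one differential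
  equation for q; monomials g already detect whether a polynomial vanishes.\<close>

lemma act_eq_zero_iff: "act f q = 0 \<longleftrightarrow> (\<forall>g. pairing q (f * g) = 0)"
proof
  assume "\<forall>g. pairing q (f * g) = 0"
  then show "act f q = 0" by (intro pairing_eqI) (simp add: pairing_act)
qed (metis pairing_act pairing_zero_left)

lemma dvd_one_obtain:
  fixes f :: "'a::comm_ring_1"
  assumes "f dvd 1"
  obtains g where "f * g = 1" "g dvd 1"
  using assms by (metis dvdE dvd_triv_right)

lemma act_unit_cancel:
  assumes "U dvd 1"
  shows "act U p = act U q \<longleftrightarrow> p = q"
proof
  obtain V where "U * V = 1" using assms by (rule dvd_one_obtain)
  moreover assume "act U p = act U q"
  then have "act (V * U) p = act (V * U) q" by (simp only: act_mult)
  ultimately show "p = q" by (simp add: mult.commute)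
qed simp


section \<open>Evaluation at t = 0, the exponential factor and orthogonal spaces\<close>

lemma mfps_deriv_commute: "mfps_deriv i (mfps_deriv j f) = mfps_deriv j (mfps_deriv i f)"
  by (rule mfps_eqI) (auto simp: mfps_deriv_def unit_vec_nth ac_simps)

text \<open>Clearing the denominator of (\<gamma> + \<alpha>)! / \<gamma>! keeps the identity
  meaningful over every commutative coefficient ring, in particular for series over \<complex>[y].
  The case \<gamma> = 0 evaluates \<open>diff_at_0\<close>.\<close>

lemma mfps_nth_multi_pow_deriv:
  "of_nat (mi_fact \<gamma>) * mfps_nth (multi_pow mfps_deriv \<alpha> f) \<gamma>
     = of_nat (mi_fact (\<gamma> + \<alpha>)) * mfps_nth f (\<gamma> + \<alpha>)"
proof (induction \<alpha> arbitrary: \<gamma> rule: multi_index_induct)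
  case zero
  show ?case by (simp add: multi_pow_zero [of mfps_deriv, OF mfps_deriv_commute])
next
  case (Suc \<alpha> j)
  have "of_nat (mi_fact \<gamma>) * mfps_nth (multi_pow mfps_deriv (\<alpha> + unit_vec j) f) \<gamma>
      = of_nat (mi_fact (\<gamma> + unit_vec j)) * mfps_nth (multi_pow mfps_deriv \<alpha> f) (\<gamma> + unit_vec j)"
    by (simp add: multi_pow_Suc [of mfps_deriv, OF mfps_deriv_commute] mi_fact_Suc)
       (simp add: mfps_deriv_def ac_simps)
  then show ?case by (simp add: Suc ac_simps)
qed

lemma clinear_mfps_nth: "clinear (\<lambda>f. mfps_nth f \<gamma>)"
  by (rule clinearI) (simp_all add: plus_mfps.rep_eq scaleC_mfps.rep_eq)

lemma diff_at_0_eq: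
  "diff_at_0 q f = (\<Sum>\<alpha>\<in>keys q. lookup q \<alpha> *\<^sub>C (of_nat (mi_fact \<alpha>) * mfps_nth f \<alpha>))"
  using mfps_nth_multi_pow_deriv [of 0 _ f]
  by (simp add: diff_at_0_def poly_apply_def clinear_sum [OF clinear_mfps_nth]
      clinear_scale [OF clinear_mfps_nth])

lemma diff_at_0_eq_pairing: "diff_at_0 q f = pairing q f"
  by (simp add: diff_at_0_eq pairing_def scaleC_complex_def mult.assoc)

lemma lookup_of_nat_mult: "lookup (of_nat n * p) \<gamma> = of_nat n * lookup (p :: 'n::finite cpoly) \<gamma>"
  by (induction n) (simp_all add: distrib_right lookup_add)

text \<open>The coefficient of \<open>y^\<gamma>\<close> in f(t) exp(t y) is
  \<open>t^\<gamma> * f / \<gamma>!\<close>. Pairing it with q gives the coefficient of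
  \<open>act f q\<close> at \<gamma>, so the factor exp(t y) turns evaluation at t = 0 into the
  action of f on q.\<close>

lemma diff_at_0_exp: "diff_at_0 q (mfps_map Const f * exp_ty) = act f q"
proof (rule poly_mapping_eqI)
  fix \<gamma>
  have coeff: "of_nat (mi_fact \<gamma>) * lookup (mfps_nth (mfps_map Const f * exp_ty) \<alpha>) \<gamma> = mfps_nth (mfps_monom \<gamma> * f) \<alpha>" for \<alpha>
  proof -
    have "lookup (mfps_nth (mfps_map Const f * exp_ty) \<alpha>) \<gamma>
      = (\<Sum>(a, b)\<in>{(a, b). a + b = \<alpha>}. if b = \<gamma> then mfps_nth f a / of_nat (mi_fact b) else 0)"
      unfolding times_mfps.rep_eq lookup_sum split_beta
      by (rule sum.cong) (auto simp: mfps_map_def exp_ty_def mult_single lookup_single mi_fact_def when_def)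
    also have "\<dots> = (\<Sum>(a, b)\<in>(if \<gamma> \<le> \<alpha> then {(\<alpha> - \<gamma>, \<gamma>)} else {}). mfps_nth f a / of_nat (mi_fact b))"
      by (rule sum.mono_neutral_cong_right) (auto simp: nat_vec_diff_add split: if_splits)
    finally show ?thesis by (auto simp: mfps_nth_monom_mult)
  qed
  have "of_nat (mi_fact \<gamma>) * lookup (diff_at_0 q (mfps_map Const f * exp_ty)) \<gamma> = pairing q (mfps_monom \<gamma> * f)"
    unfolding diff_at_0_eq pairing_def lookup_sum sum_distrib_left coeff [symmetric]
    by (rule sum.cong) (simp_all add: lookup_of_nat_mult scaleC_complex_def)
  then show "lookup (diff_at_0 q (mfps_map Const f * exp_ty)) \<gamma> = lookup (act f q) \<gamma>"
    by (simp add: lookup_act field_simps)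
qed

lemma Var_power: "Var j ^ k = (Poly_Mapping.single (axis j k) 1 :: 'n::finite cpoly)"
proof (induction k)
  case 0
  have "axis j 0 = (0 :: nat ^ 'n)" by (simp add: vec_eq_iff axis_def)
  then show ?case by (simp only: power_0 single_one)
next
  case (Suc k)
  have "unit_vec j + axis j k = (axis j (Suc k) :: nat ^ 'n)" by (simp add: vec_eq_iff axis_def)
  with Suc show ?case by (simp add: mult_single)
qed

text \<open>The rings \<open>\<complex>[\<partial>\<^sub>t]\<close> and \<open>\<complex>[y]\<close>
  share one representation, in which the product of powers of variables with exponent \<alpha> is
  the basis element of \<alpha>.\<close>

lemma Xi_eq [simp]: "Xi q = q"
proof -
  have prod: "(\<Prod>j\<in>S. Var j ^ (\<alpha> $ j)) = (Poly_Mapping.single (\<chi> j. if j \<in> S then \<alpha> $ j else 0) 1 :: 'a cpoly)"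
    if "finite S" for S and \<alpha> :: "nat ^ 'a"
    using that
  proof (induction S)
    case empty
    have "(\<chi> j. if j \<in> {} then \<alpha> $ j else 0) = (0 :: nat ^ 'a)" by (simp add: vec_eq_iff)
    then show ?case by (simp del: zero_vec_def)
  next
    case (insert x F)
    have "axis x (\<alpha> $ x) + (\<chi> j. if j \<in> F then \<alpha> $ j else 0) = (\<chi> j. if j \<in> insert x F then \<alpha> $ j else 0)"
      using insert.hyps by (auto simp: vec_eq_iff axis_def)
    with insert show ?case by (simp add: Var_power mult_single)
  qed
  have all: "(\<Prod>j\<in>UNIV. Var j ^ (\<alpha> $ j)) = (Poly_Mapping.single \<alpha> 1 :: 'a cpoly)" for \<alpha> :: "nat ^ 'a"
    using prod [of UNIV \<alpha>] by simp
  show ?thesis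
  proof (rule poly_mapping_eqI)
    fix \<gamma>
    show "lookup (Xi q) \<gamma> = lookup q \<gamma>"
      by (simp add: Xi_def all lookup_sum lookup_single when_def scaleC_complex_def in_keys_iff
          if_distrib [where f = "\<lambda>x. _ * x"] cong: if_cong)
  qed
qed

lemma perp_eq: "perp P = {q. \<forall>p\<in>P. pairing q p = 0}"
  by (simp add: perp_def diff_at_0_eq_pairing)

text \<open>Since \<open>act\<close> is a module action, the series killing q form an ideal, so the
  condition only concerns generators.\<close>

lemma perp_ideal_of: "q \<in> perp (ideal_of S) \<longleftrightarrow> (\<forall>s\<in>S. act s q = 0)"
proof -
  interpret R: module "(*) :: ('a, complex) mfps \<Rightarrow> _"
    by standard (simp_all add: algebra_simps)
  show ?thesis
  proof
    assume q: "q \<in> perp (ideal_of S)"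
    have "g * s \<in> ideal_of S" if "s \<in> S" for g s
      using that by (intro R.span_scale R.span_base)
    with q show "\<forall>s\<in>S. act s q = 0"
      by (auto simp: perp_eq act_eq_zero_iff mult.commute)
  next
    assume S: "\<forall>s\<in>S. act s q = 0"
    have "act p q = 0" if "p \<in> ideal_of S" for p
      using that by (induction rule: R.span_induct_alt) (use S in \<open>auto simp: act_add_left act_mult\<close>)
    \<comment> \<open>The pairing of q with p is the pairing of \<open>act p q\<close> with
      1.\<close>
    then show "q \<in> perp (ideal_of S)"
      by (auto simp: perp_eq) (metis mult.right_neutral pairing_act pairing_zero_left)
  qed
qed

section \<open>Units, squarefree monomials and falling factorials in \<complex>[[t]]\<close>

lemma mfps_nth_power_eq_0:
  fixes g :: "('n::finite, 'a::comm_ring_1) mfps"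
  assumes "mfps_nth g 0 = 0" and "(\<Sum>j\<in>UNIV. \<gamma> $ j) < k"
  shows "mfps_nth (g ^ k) \<gamma> = 0"
  using assms(2)
proof (induction k arbitrary: \<gamma>)
  case (Suc k)
  have "mfps_nth g a * mfps_nth (g ^ k) b = 0" if "a + b = \<gamma>" for a b
  proof (cases "a = 0")
    case False
    then have "(\<Sum>j\<in>UNIV. a $ j) \<noteq> 0" by (simp add: vec_eq_iff)
    moreover have "(\<Sum>j\<in>UNIV. \<gamma> $ j) = (\<Sum>j\<in>UNIV. a $ j) + (\<Sum>j\<in>UNIV. b $ j)"
      by (simp add: sum.distrib flip: that)
    ultimately have "(\<Sum>j\<in>UNIV. b $ j) < k" using Suc.prems by linarith
    then show ?thesis by (simp add: Suc.IH)
  qed (simp add: assms(1))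
  then show ?case by (auto simp: times_mfps.rep_eq intro!: sum.neutral)
qed simp

text \<open>After division by the constant term, f is 1 - g with g of zero constant term. The
  geometric series inverts 1 - g; it makes sense coefficientwise because \<open>g ^ k\<close> has no
  terms of degree below k.\<close>

lemma mfps_unit:
  fixes f :: "('n::finite, 'a::field) mfps"
  assumes "mfps_nth f 0 \<noteq> 0"
  shows "f dvd 1"
proof -
  define c where "c = mfps_nth f 0"
  define g where "g = 1 - mfps_const (1 / c) * f"
  have c: "c \<noteq> 0" using assms by (simp add: c_def)
  have g0: "mfps_nth g 0 = 0"
    using c by (simp add: g_def c_def minus_mfps.rep_eq one_mfps.rep_eq mfps_nth_const_mult)
  define deg where "deg \<gamma> = (\<Sum>j\<in>UNIV. \<gamma> $ j)" for \<gamma> :: "nat ^ 'n"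
  define h where "h = Mfps (\<lambda>\<gamma>. mfps_nth (\<Sum>k<Suc (deg \<gamma>). g ^ k) \<gamma>)"
  have h: "mfps_nth h b = mfps_nth (\<Sum>k<Suc m. g ^ k) b" if "deg b \<le> m" for b m
  proof -
    have "(\<Sum>k<Suc m. mfps_nth (g ^ k) b) = (\<Sum>k<Suc (deg b). mfps_nth (g ^ k) b)"
      by (rule sum.mono_neutral_right)
         (use that in \<open>auto intro!: mfps_nth_power_eq_0 [OF g0] simp: deg_def\<close>)
    then show ?thesis unfolding h_def mfps_nth_Mfps mfps_nth_sum by (rule sym)
  qed
  have "(1 - g) * h = 1"
  proof (rule mfps_eqI)
    fix \<gamma> :: "nat ^ 'n"
    have "mfps_nth ((1 - g) * h) \<gamma> = mfps_nth ((1 - g) * (\<Sum>k<Suc (deg \<gamma>). g ^ k)) \<gamma>"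
      unfolding times_mfps.rep_eq
    proof (rule sum.cong [OF refl], clarify)
      fix a b :: "nat ^ 'n"
      let ?g = "\<lambda>b. mfps_nth (\<Sum>k<Suc (deg (a + b)). g ^ k) b"
      have "deg b \<le> deg (a + b)" by (simp add: deg_def sum.distrib)
      then show "mfps_nth (1 - g) a * mfps_nth h b = mfps_nth (1 - g) a * ?g b"
        by (simp only: h)
    qed
    also have "(1 - g) * (\<Sum>k<Suc (deg \<gamma>). g ^ k) = 1 - g ^ Suc (deg \<gamma>)"
      by (rule one_diff_power_eq [symmetric])
    also have "mfps_nth \<dots> \<gamma> = mfps_nth 1 \<gamma>"
      using mfps_nth_power_eq_0 [OF g0, of \<gamma> "Suc (deg \<gamma>)"] by (simp add: minus_mfps.rep_eq deg_def)
    finally show "mfps_nth ((1 - g) * h) \<gamma> = mfps_nth 1 \<gamma>" .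
  qed
  then have "f * (mfps_const (1 / c) * h) = 1" by (simp add: g_def ac_simps)
  then show ?thesis by (rule dvdI [OF sym])
qed

lemma prod_unit: "(\<And>i. i \<in> I \<Longrightarrow> f i dvd 1) \<Longrightarrow> prod f I dvd (1 :: 'a::comm_ring_1)"
proof (induction I rule: infinite_finite_induct)
  case (insert x F)
  then show ?case using mult_dvd_mono [of "f x" 1 "prod f F" 1] by simp
qed simp_all

lemma mult_unit: "a dvd 1 \<Longrightarrow> b dvd 1 \<Longrightarrow> a * b dvd (1 :: 'a::comm_ring_1)"
  using mult_dvd_mono [of a 1 b 1] by simp

lemma mfps_var_nonzero: "mfps_var j \<noteq> (0 :: ('n::finite, complex) mfps)"
proof -
  have "mfps_nth (mfps_var j :: ('n::finite, complex) mfps) (unit_vec j) \<noteq> mfps_nth 0 (unit_vec j)"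
    by (simp add: mfps_var_def zero_mfps.rep_eq)
  then show ?thesis by metis
qed

lemma t_prod_nonzero: "t_prod S \<noteq> 0"
  by (simp add: t_prod_def mfps_var_nonzero)

lemma t_prod_empty [simp]: "t_prod {} = 1"
  by (simp add: t_prod_def)

lemma t_prod_Un: "S \<inter> T = {} \<Longrightarrow> t_prod (S \<union> T) = t_prod S * t_prod (T :: 'n::finite set)"
  unfolding t_prod_def by (rule prod.union_disjoint) auto

lemma t_prod_eq_monom: "t_prod S = mfps_monom (\<chi> j. if j \<in> S then 1 else 0)"
proof -
  have "finite S" by simp
  then show ?thesis
  proof (induction S)
    case empty
    have "(\<chi> j. if j \<in> {} then 1 else 0) = (0 :: nat ^ 'a)" by (simp add: vec_eq_iff)
    then show ?case by (simp only: t_prod_empty mfps_one_eq_monom)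
  next
    case (insert x F)
    have "unit_vec x + (\<chi> j. if j \<in> F then 1 else 0) = (\<chi> j. if j \<in> insert x F then 1 else (0::nat))"
      using insert.hyps by (auto simp: vec_eq_iff axis_def)
    with insert show ?case by (simp add: t_prod_def mfps_var_eq_monom mfps_monom_mult)
  qed
qed

text \<open>The series \<open>[v + t]_\<nu>\<close>. It occurs in two roles: as numerator or
  denominator of \<open>a_hat\<close>, and, with t replaced by \<open>\<partial>\<^sub>y\<close>, as
  the operator by which \<open>\<partial>^\<nu>\<close> acts on the coefficient at exponent
  v.\<close>

definition fall :: "complex ^ 'n \<Rightarrow> nat ^ 'n \<Rightarrow> ('n::finite, complex) mfps" where
  "fall v \<nu> = falling (perturb v) \<nu>"

lemma fall_eq: "fall v \<nu> = (\<Prod>j\<in>UNIV. \<Prod>k<\<nu> $ j. mfps_const (v $ j - of_nat k) + mfps_var j)"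
  by (simp add: fall_def falling_def perturb_def mfps_const_diff mfps_const_of_nat algebra_simps)

lemma prod_lessThan_add: "(\<Prod>k<m + (n::nat). f k) = (\<Prod>k<m. f k) * (\<Prod>k<n. f (m + k) :: 'a::comm_monoid_mult)"
  by (induction n) (simp_all add: ac_simps)

text \<open>Formally \<open>fall v \<nu>\<close> is \<Gamma>(v + t + 1) / \<Gamma>(v + t - \<nu> +
  1), so quotients along consecutive shifts multiply.\<close>

lemma fall_add: "fall v (\<mu> + \<nu>) = fall v \<mu> * fall (v - vec_of_nat \<mu>) \<nu>"
  by (simp add: fall_eq prod_lessThan_add vec_of_nat_def prod.distrib diff_diff_eq)

lemma fall_zero [simp]: "fall v 0 = 1"
  by (simp add: fall_eq)

lemma fall_unit_vec: "fall v (unit_vec j) = mfps_const (v $ j) + mfps_var j"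
proof -
  have "fall v (unit_vec j) = (\<Prod>i\<in>{j}. \<Prod>k<unit_vec j $ i. mfps_const (v $ i - of_nat k) + mfps_var i)"
    unfolding fall_eq by (rule prod.mono_neutral_right) (auto simp: unit_vec_nth)
  then show ?thesis by (simp add: unit_vec_nth One_nat_def)
qed

text \<open>The index j enters the negative support exactly when some factor
  \<open>v $ j - k + t_j\<close> of the falling factorial loses its constant term.\<close>

lemma nsupp_diff_iff:
  "j \<in> nsupp (v - vec_of_nat \<nu>) - nsupp v \<longleftrightarrow> (\<exists>k<\<nu> $ j. v $ j = of_nat k)"
proof
  assume "j \<in> nsupp (v - vec_of_nat \<nu>) - nsupp v"
  then obtain k :: int where k: "k < 0" "v $ j - of_nat (\<nu> $ j) = of_int k"
    and nn: "\<And>k :: int. v $ j = of_int k \<Longrightarrow> \<not> k < 0"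
    by (auto simp: nsupp_def vec_of_nat_def)
  then have v: "v $ j = of_int (k + int (\<nu> $ j))" by (simp add: diff_eq_eq)
  then have "v $ j = of_nat (nat (k + int (\<nu> $ j)))"
    using nn [OF v] by simp
  moreover have "nat (k + int (\<nu> $ j)) < \<nu> $ j" using k(1) nn [OF v] by linarith
  ultimately show "\<exists>k<\<nu> $ j. v $ j = of_nat k" by blast
next
  assume "\<exists>k<\<nu> $ j. v $ j = of_nat k"
  then obtain k where k: "k < \<nu> $ j" "v $ j = of_nat k" by blast
  have "v $ j - of_nat (\<nu> $ j) = of_int (int k - int (\<nu> $ j))" using k by simp
  moreover have "int k - int (\<nu> $ j) < 0" using k by simp
  ultimately have "j \<in> nsupp (v - vec_of_nat \<nu>)"
    unfolding nsupp_def vec_of_nat_def by (fastforce simp del: of_int_diff)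
  moreover have "j \<notin> nsupp v"
  proof
    assume "j \<in> nsupp v"
    then obtain l :: int where "l < 0" "of_int (int k) = (of_int l :: complex)" by (auto simp: nsupp_def k)
    then show False by (simp only: of_int_eq_iff)
  qed
  ultimately show "j \<in> nsupp (v - vec_of_nat \<nu>) - nsupp v" by blast
qed

text \<open>A factor with nonzero constant term is a unit. For each j at most one factor has zero
  constant term, and it is then the variable \<open>t_j\<close> itself; hence the remaining part is
  a squarefree monomial.\<close>

lemma fall_eq_unit:
  "\<exists>U. U dvd 1 \<and> fall v \<nu> = U * t_prod (nsupp (v - vec_of_nat \<nu>) - nsupp v)"
proof -
  let ?S = "nsupp (v - vec_of_nat \<nu>) - nsupp v"
  let ?f = "\<lambda>j k. mfps_const (v $ j - of_nat k) + mfps_var j :: ('a, complex) mfps"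
  define U where "U = (\<Prod>j\<in>UNIV. \<Prod>k | k < \<nu> $ j \<and> v $ j \<noteq> of_nat k. ?f j k)"
  have "U dvd 1"
    unfolding U_def
    by (intro prod_unit mfps_unit) (simp add: plus_mfps.rep_eq mfps_const_def mfps_var_def vec_eq_iff unit_vec_nth)
  have "(\<Prod>k<\<nu> $ j. ?f j k) = (\<Prod>k | k < \<nu> $ j \<and> v $ j \<noteq> of_nat k. ?f j k) * (if j \<in> ?S then mfps_var j else 1)" for j
  proof -
    have "(\<Prod>k<\<nu> $ j. ?f j k) = (\<Prod>k | k < \<nu> $ j \<and> v $ j \<noteq> of_nat k. ?f j k) * (\<Prod>k | k < \<nu> $ j \<and> v $ j = of_nat k. ?f j k)"
      by (subst prod.union_disjoint [symmetric]) (auto intro!: prod.cong)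
    also have "(\<Prod>k | k < \<nu> $ j \<and> v $ j = of_nat k. ?f j k) = (if j \<in> ?S then mfps_var j else 1)"
    proof (cases "j \<in> ?S")
      case True
      then obtain k where k: "k < \<nu> $ j" "v $ j = of_nat k" unfolding nsupp_diff_iff by blast
      then have "{k. k < \<nu> $ j \<and> v $ j = of_nat k} = {k}" by auto
      moreover have "mfps_const 0 = (0 :: ('a, complex) mfps)"
        using mfps_const_of_nat [of 0] by simp
      ultimately show ?thesis using True k by (simp only: prod.insert) simp
    next
      case False
      then have "{k. k < \<nu> $ j \<and> v $ j = of_nat k} = {}" unfolding nsupp_diff_iff by auto
      then show ?thesis using False by (simp only: prod.empty if_False)
    qed
    finally show ?thesis .
  qed
  then have "fall v \<nu> = U * t_prod ?S"
    unfolding fall_eq U_def t_prod_def by (simp only: prod.distrib) (simp only: prod.inter_restrict [symmetric] finite Int_UNIV_left)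
  with \<open>U dvd 1\<close> show ?thesis by blast
qed

lemma fall_nonzero: "fall v \<nu> \<noteq> 0"
proof -
  obtain U where U: "U dvd 1" "fall v \<nu> = U * t_prod (nsupp (v - vec_of_nat \<nu>) - nsupp v)"
    using fall_eq_unit by blast
  then have "U \<noteq> 0" by auto
  with U(2) show ?thesis by (simp add: t_prod_nonzero)
qed

section \<open>The coefficients of the perturbed series\<close>

lemma vec_of_int_add [simp]: "vec_of_int (u + u') = vec_of_int u + vec_of_int u'"
  and vec_of_int_diff [simp]: "vec_of_int (u - u') = vec_of_int u - vec_of_int u'"
  and vec_of_int_zero [simp]: "vec_of_int 0 = 0"
  and vec_of_int_vec_of_nat [simp]: "vec_of_int (vec_of_nat \<nu>) = vec_of_nat \<nu>"
  and vec_of_nat_add [simp]: "vec_of_nat (\<mu> + \<nu>) = vec_of_nat \<mu> + vec_of_nat \<nu>"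
  by (simp_all add: vec_of_int_def vec_of_nat_def vec_eq_iff)

lemma pos_part_minus_neg_part: "vec_of_nat (pos_part u) - vec_of_nat (neg_part u) = u"
  by (simp add: vec_of_nat_def pos_part_def neg_part_def vec_eq_iff)

text \<open>The vector \<open>- neg_part u\<close> is the componentwise minimum of 0 and u, and an
  integral coordinate is negative at a minimum if and only if it is negative at one of the two
  points.\<close>

lemma nsupp_at_neg_part:
  "nsupp_at v0 (- vec_of_nat (neg_part u)) = nsupp_at v0 0 \<union> nsupp_at v0 u"
proof -
  have *: "j \<in> nsupp_at v0 (- vec_of_nat (neg_part u)) \<longleftrightarrow> j \<in> nsupp_at v0 0 \<or> j \<in> nsupp_at v0 u" for j
  proof (cases "u $ j \<ge> 0")
    case True
    then have "j \<in> nsupp_at v0 0" if u: "j \<in> nsupp_at v0 u"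
    proof -
      obtain k :: int where k: "k < 0" "v0 $ j + of_int (u $ j) = of_int k"
        using u by (auto simp: nsupp_at_def nsupp_def vec_of_int_def)
      then have "v0 $ j = of_int (k - u $ j)" by (simp add: eq_diff_eq)
      moreover have "k - u $ j < 0" using k True by simp
      ultimately show ?thesis
        unfolding nsupp_at_def nsupp_def by (fastforce simp del: of_int_diff)
    qed
    with True show ?thesis by (auto simp: nsupp_at_def nsupp_def vec_of_int_def neg_part_def vec_of_nat_def)
  next
    case False
    then have "j \<in> nsupp_at v0 u" if u: "j \<in> nsupp_at v0 0"
    proof -
      obtain k :: int where k: "k < 0" "v0 $ j = of_int k"
        using u by (auto simp: nsupp_at_def nsupp_def)
      then have "v0 $ j + of_int (u $ j) = of_int (k + u $ j)" by simp
      moreover have "k + u $ j < 0" using k False by simp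
      ultimately show ?thesis
        unfolding nsupp_at_def nsupp_def vec_of_int_def by (fastforce simp del: of_int_add)
    qed
    with False show ?thesis by (auto simp: nsupp_at_def nsupp_def vec_of_int_def neg_part_def vec_of_nat_def)
  qed
  then show ?thesis by blast
qed

lemma nsupp_at_mono: "nsupp_at v0 u \<subseteq> nsupp_at v0 (u - vec_of_nat \<nu>)"
proof
  fix j assume "j \<in> nsupp_at v0 u"
  then obtain k :: int where k: "k < 0" "v0 $ j + of_int (u $ j) = of_int k"
    by (auto simp: nsupp_at_def nsupp_def vec_of_int_def)
  then have "v0 $ j + of_int (u $ j - int (\<nu> $ j)) = of_int (k - int (\<nu> $ j))" by simp
  moreover have "k - int (\<nu> $ j) < 0" using k by simp
  ultimately show "j \<in> nsupp_at v0 (u - vec_of_nat \<nu>)"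
    unfolding nsupp_at_def nsupp_def vec_of_int_def vec_of_nat_def
    by (fastforce simp del: of_int_diff)
qed

lemma fall_at_eq_unit:
  "\<exists>U. U dvd 1 \<and> fall (v0 + vec_of_int u) \<nu> = U * t_prod (nsupp_at v0 (u - vec_of_nat \<nu>) - nsupp_at v0 u)"
  using fall_eq_unit [of "v0 + vec_of_int u" \<nu>] by (simp add: nsupp_at_def add_diff_eq)

lemma fract_cancel:
  fixes a b c f :: "'a::idom"
  assumes "c \<noteq> 0"
  shows "Fract f 1 = Fract a 1 * Fract b c \<longleftrightarrow> f * c = a * b"
  using assms by (simp add: eq_fract)

text \<open>Write I, Z for the negative supports at u and 0, and K for the intersection of N. Up to
  units the fraction \<open>a_hat\<close> is \<open>t^(I - Z) / t^(Z - I)\<close>. Since K lies in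
  both I and Z, multiplying numerator and denominator suitably gives
  \<open>t^((I \<union> Z) - K)\<close>, so \<open>m_hat\<close> cancels the denominator and leaves
  \<open>t^(I - K)\<close>.\<close>

lemma ma_hat:
  assumes N: "nsupp_at v0 0 \<in> N" "nsupp_at v0 u \<in> N"
  shows ma_hat_mult: "ma_hat v0 N u * fall (v0 + vec_of_int u) (pos_part u) = m_hat v0 N * fall v0 (neg_part u)"
    and ma_hat_unit: "\<exists>U. U dvd 1 \<and> ma_hat v0 N u = U * t_prod (nsupp_at v0 u - \<Inter>N)"
proof -
  let ?I = "nsupp_at v0 u" and ?Z = "nsupp_at v0 0" and ?K = "\<Inter>N"
  have neg: "u - vec_of_nat (pos_part u) = - vec_of_nat (neg_part u)"
    using pos_part_minus_neg_part [of u] by (simp add: algebra_simps)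
  have "nsupp_at v0 (0 - vec_of_nat (neg_part u)) - ?Z = ?I - ?Z"
    unfolding diff_0 nsupp_at_neg_part by blast
  then obtain U1 where U1: "U1 dvd 1" "fall v0 (neg_part u) = U1 * t_prod (?I - ?Z)"
    using fall_at_eq_unit [of v0 0 "neg_part u"] by auto
  have "nsupp_at v0 (u - vec_of_nat (pos_part u)) - ?I = ?Z - ?I"
    unfolding neg nsupp_at_neg_part by blast
  then obtain U2 where U2: "U2 dvd 1" "fall (v0 + vec_of_int u) (pos_part u) = U2 * t_prod (?Z - ?I)"
    using fall_at_eq_unit [of v0 u "pos_part u"] by auto
  obtain V where V: "U2 * V = 1" "V dvd 1" using U2(1) by (rule dvd_one_obtain)
  have "t_prod (?I - ?K) * t_prod (?Z - ?I) = t_prod ((?I \<union> ?Z) - ?K)"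
    using N by (subst t_prod_Un [symmetric]) (auto intro: arg_cong [where f = t_prod])
  moreover have "t_prod (?Z - ?K) * t_prod (?I - ?Z) = t_prod ((?I \<union> ?Z) - ?K)"
    using N by (subst t_prod_Un [symmetric]) (auto intro: arg_cong [where f = t_prod])
  ultimately have *: "(U1 * V * t_prod (?I - ?K)) * fall (v0 + vec_of_int u) (pos_part u) = m_hat v0 N * fall v0 (neg_part u)"
  proof -
    assume eq: "t_prod (?I - ?K) * t_prod (?Z - ?I) = t_prod ((?I \<union> ?Z) - ?K)"
      "t_prod (?Z - ?K) * t_prod (?I - ?Z) = t_prod ((?I \<union> ?Z) - ?K)"
    have "(U1 * V * t_prod (?I - ?K)) * (U2 * t_prod (?Z - ?I)) = U1 * (U2 * V) * (t_prod (?I - ?K) * t_prod (?Z - ?I))"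
      by (simp only: ac_simps)
    also have "\<dots> = U1 * (t_prod (?Z - ?K) * t_prod (?I - ?Z))"
      using V(1) eq by simp
    finally show ?thesis unfolding m_hat_def U1(2) U2(2) by (simp only: ac_simps)
  qed
  have iff: "Fract f 1 = Fract (m_hat v0 N) 1 * a_hat v0 u
      \<longleftrightarrow> f * fall (v0 + vec_of_int u) (pos_part u) = m_hat v0 N * fall v0 (neg_part u)" for f
    unfolding a_hat_def fall_def [symmetric] by (rule fract_cancel [OF fall_nonzero])
  \<comment> \<open>The denominator is nonzero in a domain, so the quotient is unique and the
    definite description picks the candidate just found.\<close>
  have ma: "ma_hat v0 N u = U1 * V * t_prod (?I - ?K)"
    unfolding ma_hat_def iff
    by (rule the_equality, rule *, simp only: * [symmetric] mult_right_cancel [OF fall_nonzero])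
  show "ma_hat v0 N u * fall (v0 + vec_of_int u) (pos_part u) = m_hat v0 N * fall v0 (neg_part u)"
    unfolding ma by (rule *)
  show "\<exists>U. U dvd 1 \<and> ma_hat v0 N u = U * t_prod (?I - ?K)"
    using ma mult_unit [OF U1(1) V(2)] by blast
qed

lemma ma_hat_zero:
  assumes "nsupp_at v0 0 \<in> N"
  shows "ma_hat v0 N 0 = m_hat v0 N"
proof -
  have "pos_part 0 = (0 :: nat ^ 'a)" "neg_part 0 = (0 :: nat ^ 'a)"
    by (simp_all add: pos_part_def neg_part_def vec_eq_iff)
  then show ?thesis using ma_hat_mult [OF assms assms] by simp
qed

text \<open>Any representation of u as a difference of natural vectors exceeds
  \<open>pos_part u\<close> and \<open>neg_part u\<close> by a common \<kappa>, which contributes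
  the same factor to both sides.\<close>

lemma ma_hat_mult_general:
  assumes N: "nsupp_at v0 0 \<in> N" "nsupp_at v0 u \<in> N"
    and u: "u - vec_of_nat \<mu> = - vec_of_nat \<nu>"
  shows "ma_hat v0 N u * fall (v0 + vec_of_int u) \<mu> = m_hat v0 N * fall v0 \<nu>"
proof -
  have nth: "u $ j - int (\<mu> $ j) = - int (\<nu> $ j)" for j
    using arg_cong [OF u, of "\<lambda>x. x $ j"] by (simp add: vec_of_nat_def)
  define \<kappa> where "\<kappa> = \<nu> - neg_part u"
  have \<nu>: "\<nu> = neg_part u + \<kappa>" and \<mu>: "\<mu> = pos_part u + \<kappa>"
  proof -
    show "\<nu> = neg_part u + \<kappa>"
      unfolding vec_eq_iff
    proof
      fix j show "\<nu> $ j = (neg_part u + \<kappa>) $ j"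
        using nth [of j] by (simp add: \<kappa>_def neg_part_def)
    qed
    show "\<mu> = pos_part u + \<kappa>"
      unfolding vec_eq_iff
    proof
      fix j show "\<mu> $ j = (pos_part u + \<kappa>) $ j"
        using nth [of j] by (simp add: \<kappa>_def neg_part_def pos_part_def)
    qed
  qed
  have "v0 + vec_of_int u - vec_of_nat (pos_part u) = v0 - vec_of_nat (neg_part u)"
    using arg_cong [OF pos_part_minus_neg_part [of u], where f = "\<lambda>u. v0 + vec_of_int u"]
    by (simp add: algebra_simps)
  then have "fall (v0 + vec_of_int u) \<mu> = fall (v0 + vec_of_int u) (pos_part u) * fall (v0 - vec_of_nat (neg_part u)) \<kappa>"
    by (simp only: \<mu> fall_add)
  moreover have "fall v0 \<nu> = fall v0 (neg_part u) * fall (v0 - vec_of_nat (neg_part u)) \<kappa>"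
    by (simp add: \<nu> fall_add)
  ultimately show ?thesis
    by (simp only: ma_hat_mult [OF N] flip: mult.assoc)
qed

text \<open>Both sides are \<open>\<Gamma>(v\<^sub>0 + t + 1) / \<Gamma>(v\<^sub>0 + t + u - \<alpha> + 1)\<close> up to the factor \<open>m_hat\<close>.\<close>

lemma ma_hat_compatible:
  assumes N: "nsupp_at v0 0 \<in> N" "nsupp_at v0 u \<in> N" "nsupp_at v0 u' \<in> N"
    and eq: "u - vec_of_nat \<alpha> = u' - vec_of_nat \<beta>"
  shows "fall (v0 + vec_of_int u) \<alpha> * ma_hat v0 N u = fall (v0 + vec_of_int u') \<beta> * ma_hat v0 N u'"
proof -
  obtain z where z: "u = z + vec_of_nat \<alpha>" "u' = z + vec_of_nat \<beta>"
    using eq by (metis diff_add_cancel)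
  let ?p = "pos_part z" and ?n = "neg_part z" and ?F = "fall (v0 + vec_of_int z) (pos_part z)"
  \<comment> \<open>Descending further from z to the minimum of z and 0 makes both sides equal to
    \<open>m_hat v0 N * fall v0 ?n\<close>; the additional factor \<open>?F\<close> is nonzero and
    cancels.\<close>
  have "u - vec_of_nat (\<alpha> + ?p) = - vec_of_nat ?n" "u' - vec_of_nat (\<beta> + ?p) = - vec_of_nat ?n"
    using pos_part_minus_neg_part [of z] by (simp_all add: z algebra_simps)
  from ma_hat_mult_general [OF N(1,2) this(1)] ma_hat_mult_general [OF N(1,3) this(2)]
  have "ma_hat v0 N u * (fall (v0 + vec_of_int u) \<alpha> * ?F) = ma_hat v0 N u' * (fall (v0 + vec_of_int u') \<beta> * ?F)"
    by (simp add: fall_add z add_diff_eq)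
  then have "(fall (v0 + vec_of_int u) \<alpha> * ma_hat v0 N u) * ?F = (fall (v0 + vec_of_int u') \<beta> * ma_hat v0 N u') * ?F"
    by (simp only: ac_simps)
  then show ?thesis by (simp only: mult_right_cancel [OF fall_nonzero])
qed

section \<open>Annihilation in terms of coefficients\<close>

lemma vec_of_int_inject [simp]: "(vec_of_int u :: complex ^ 'n) = vec_of_int u' \<longleftrightarrow> u = u'"
  by (simp add: vec_of_int_def vec_eq_iff)

lemma log_series_at_nth [simp]: "log_series_at v0 r (v0 + vec_of_int u) = r u"
  by (simp add: log_series_at_def)

lemma log_series_at_outside: "(\<And>u. v \<noteq> v0 + vec_of_int u) \<Longrightarrow> log_series_at v0 r v = 0"
  by (simp add: log_series_at_def)

section \<open>Polynomials in commuting linear operators\<close>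

lemma poly_apply_eq:
  assumes "finite S" "keys p \<subseteq> S"
  shows "poly_apply T p m = (\<Sum>\<alpha>\<in>S. lookup p \<alpha> *\<^sub>C multi_pow T \<alpha> m)"
  unfolding poly_apply_def
  by (rule sum.mono_neutral_left) (use assms in \<open>auto simp: in_keys_iff\<close>)

lemma clinear_poly_apply_left: "clinear (\<lambda>p. poly_apply T p m)"
proof (rule clinearI)
  fix p q :: "'a cpoly"
  show "poly_apply T (p + q) m = poly_apply T p m + poly_apply T q m"
    using keys_add [of p q]
    by (simp add: poly_apply_eq [of "keys p \<union> keys q"] lookup_add scaleC_add_left sum.distrib)
next
  fix c and p :: "'a cpoly"
  have "keys (c *\<^sub>C p) \<subseteq> keys p" by (auto simp: in_keys_iff)
  then show "poly_apply T (c *\<^sub>C p) m = c *\<^sub>C poly_apply T p m"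
    by (simp add: poly_apply_eq [of "keys p"] scaleC_sum scaleC_complex_def)
qed

lemma poly_apply_single: "poly_apply T (Poly_Mapping.single \<alpha> c) m = c *\<^sub>C multi_pow T \<alpha> m"
  by (cases "c = 0") (simp_all add: poly_apply_def)

lemma poly_mapping_sum_single: "p = (\<Sum>\<alpha>\<in>keys p. Poly_Mapping.single \<alpha> (lookup p \<alpha>))"
  by (rule poly_mapping_eqI) (simp add: lookup_sum lookup_single when_def in_keys_iff)

lemma poly_mapping_induct_single:
  fixes p :: "'a \<Rightarrow>\<^sub>0 'b::comm_monoid_add"
  assumes "P 0" "\<And>\<alpha> c. P (Poly_Mapping.single \<alpha> c)" "\<And>p q. P p \<Longrightarrow> P q \<Longrightarrow> P (p + q)"
  shows "P p"
proof -
  have "P (\<Sum>\<alpha>\<in>S. Poly_Mapping.single \<alpha> (lookup p \<alpha>))" for S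
    by (induction S rule: infinite_finite_induct) (simp_all add: assms)
  from this [of "keys p"] show ?thesis by (simp flip: poly_mapping_sum_single)
qed

lemma clinear_diff: "clinear f \<Longrightarrow> f (x - y) = f x - f y"
  using clinear_add [of f "x - y" y] by (simp add: eq_diff_eq)

context
  fixes T :: "'n::finite \<Rightarrow> 'v \<Rightarrow> 'v::complex_vector"
  assumes commute: "\<And>i j m. T i (T j m) = T j (T i m)"
begin

lemma multi_pow_add: "multi_pow T (\<alpha> + \<beta>) m = multi_pow T \<alpha> (multi_pow T \<beta> m)"
proof (induction \<alpha> rule: multi_index_induct)
  case zero
  show ?case by (simp add: multi_pow_zero [where T = T, OF commute])
next
  case (Suc \<alpha> j)
  have "multi_pow T (\<alpha> + unit_vec j + \<beta>) m = multi_pow T ((\<alpha> + \<beta>) + unit_vec j) m"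
    by (simp only: ac_simps)
  also have "\<dots> = T j (multi_pow T \<alpha> (multi_pow T \<beta> m))"
    by (simp only: multi_pow_Suc [where T = T, OF commute] Suc)
  finally show ?case by (simp only: multi_pow_Suc [where T = T, OF commute])
qed

lemma multi_pow_unit_vec: "multi_pow T (unit_vec j) m = T j m"
  using multi_pow_Suc [where T = T and \<alpha> = 0, OF commute] by (simp add: multi_pow_zero [where T = T, OF commute])

context
  assumes linear: "\<And>j. clinear (T j)"
begin

lemma clinear_multi_pow: "clinear (multi_pow T \<alpha>)"
proof (induction \<alpha> rule: multi_index_induct)
  case zero
  show ?case by (rule clinearI) (simp_all add: multi_pow_zero [where T = T, OF commute])
next
  case (Suc \<alpha> j)
  then show ?case
    using clinear_comp [OF linear Suc, of j]
    by (simp add: multi_pow_Suc [where T = T, OF commute] clinear_def)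
qed

lemma poly_apply_mult: "poly_apply T (p * q) m = poly_apply T p (poly_apply T q m)"
proof (induction p rule: poly_mapping_induct_single)
  case (2 \<alpha> c)
  show ?case
  proof (induction q rule: poly_mapping_induct_single)
    case (2 \<beta> d)
    show ?case
      by (simp add: mult_single poly_apply_single multi_pow_add clinear_scale [OF clinear_multi_pow])
  next
    case (3 p q)
    then show ?case
      by (simp add: distrib_left clinear_add [OF clinear_poly_apply_left] poly_apply_single
          clinear_add [OF clinear_multi_pow] scaleC_add_right)
  qed (simp add: poly_apply_def poly_apply_single clinear_zero [OF clinear_multi_pow])
next
  case (3 p q)
  then show ?case
    by (simp add: distrib_right clinear_add [OF clinear_poly_apply_left])
qed (simp add: poly_apply_def)

end

end

section \<open>The Weyl algebra acting on the coefficients of a series\<close>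

lemma act_diff_left: "act (f - g) q = act f q - act g q"
  using act_add_left [of "f - g" g q] by (simp add: eq_diff_eq)

lemma log_d_eq: "log_d j \<phi> v = act (fall (v + unit_vec j) (unit_vec j)) (\<phi> (v + unit_vec j))"
  by (simp add: log_d_def fall_unit_vec act_add_left act_const act_var)

lemma vec_of_nat_unit_vec [simp]: "vec_of_nat (unit_vec j) = unit_vec j"
  by (simp add: vec_of_nat_def vec_eq_iff unit_vec_nth)

lemma vec_of_nat_zero [simp]: "vec_of_nat 0 = 0"
  by (simp add: vec_of_nat_def vec_eq_iff)

text \<open>A single \<open>\<partial>\<^sub>j\<close> moves the coefficient at v +
  \<open>unit_vec j\<close> to v through the operator
  \<open>v $ j + 1 + \<partial>/\<partial>y_j\<close>; by \<open>fall_add\<close> these operators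
  compose to one falling factorial.\<close>

lemma multi_pow_log_d:
  "multi_pow log_d \<alpha> \<phi> v = act (fall (v + vec_of_nat \<alpha>) \<alpha>) (\<phi> (v + vec_of_nat \<alpha>))"
proof (induction \<alpha> arbitrary: v rule: multi_index_induct)
  case zero
  show ?case by (simp add: log_series.D_pow_zero)
next
  case (Suc \<alpha> j)
  have "fall (v + (vec_of_nat \<alpha> + unit_vec j)) (\<alpha> + unit_vec j)
      = fall (v + unit_vec j) (unit_vec j) * fall (v + unit_vec j + vec_of_nat \<alpha>) \<alpha>"
    unfolding fall_add by (simp add: ac_simps)
  moreover have "multi_pow log_d (\<alpha> + unit_vec j) \<phi> v
      = act (fall (v + unit_vec j) (unit_vec j)) (multi_pow log_d \<alpha> \<phi> (v + unit_vec j))"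
    by (simp add: log_series.D_pow_Suc flip: log_d_eq)
  ultimately show ?case
    by (simp add: Suc act_mult) (simp add: ac_simps)
qed

lemma clinear_weyl_act_left: "clinear (\<lambda>P. weyl_act P \<phi>)"
  unfolding weyl_act_def by (rule log_series.clinear_apply_left)

lemma clinear_weyl_act_right: "clinear (weyl_act P)"
  unfolding weyl_act_def by (rule log_series.clinear_apply_right)

lemma weyl_act_one: "weyl_act 1 \<phi> = \<phi>"
  unfolding weyl_act_def by (rule log_series.apply_one)

lemma weyl_act_d: "weyl_act (weyl_d j) \<phi> = log_d j \<phi>"
  by (simp add: weyl_act_def weyl_d_def log_series.apply_monom log_series.X_pow_zero
      multi_pow_unit_vec [where T = log_d, OF log_series.commute_D])

lemma weyl_act_x: "weyl_act (weyl_x j) \<phi> = log_x j \<phi>"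
  by (simp add: weyl_act_def weyl_x_def log_series.apply_monom log_series.D_pow_zero
      multi_pow_unit_vec [where T = log_x, OF log_series.commute_X])

lemma weyl_d_left_commute: "weyl_d i * (weyl_d j * P) = weyl_d j * (weyl_d i * P)"
  by (metis mult.assoc weyl_relations(2))

lemma weyl_act_poly_d: "weyl_act (poly_d p) \<phi> = poly_apply log_d p \<phi>"
proof -
  have "weyl_act (multi_pow (\<lambda>j. (*) (weyl_d j)) \<alpha> 1) \<phi> = multi_pow log_d \<alpha> \<phi>" for \<alpha>
    by (induction \<alpha> rule: multi_index_induct)
       (simp_all add: multi_pow_zero [where T = "\<lambda>j. (*) (weyl_d j)", OF weyl_d_left_commute]
         multi_pow_Suc [where T = "\<lambda>j. (*) (weyl_d j)", OF weyl_d_left_commute]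
         log_series.D_pow_zero log_series.D_pow_Suc weyl_act_one weyl_act_times weyl_act_d)
  then show ?thesis
    by (simp add: poly_d_def poly_apply_def clinear_sum [OF clinear_weyl_act_left]
        clinear_scale [OF clinear_weyl_act_left])
qed

lemma weyl_theta_commute: "weyl_theta i * weyl_theta j = weyl_theta j * weyl_theta i"
proof (cases "i = j")
  case False
  have dx: "weyl_d i * weyl_x j = weyl_x j * weyl_d i" "weyl_d j * weyl_x i = weyl_x i * weyl_d j"
    using False weyl_relations(3) [of i j] weyl_relations(3) [of j i] by simp_all
  have "weyl_theta i * weyl_theta j = weyl_x i * (weyl_d i * weyl_x j) * weyl_d j"
    by (simp only: weyl_theta_def mult.assoc)
  also have "\<dots> = (weyl_x i * weyl_x j) * (weyl_d i * weyl_d j)"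
    by (simp only: dx mult.assoc)
  also have "\<dots> = (weyl_x j * weyl_x i) * (weyl_d j * weyl_d i)"
    by (simp only: weyl_relations(1) [of i j] weyl_relations(2) [of i j])
  also have "\<dots> = weyl_x j * (weyl_d j * weyl_x i) * weyl_d i"
    by (simp only: dx mult.assoc)
  finally show ?thesis by (simp only: weyl_theta_def mult.assoc)
qed simp

lemma weyl_theta_left_commute: "weyl_theta i * (weyl_theta j * P) = weyl_theta j * (weyl_theta i * P)"
  by (metis mult.assoc weyl_theta_commute)

lemma weyl_act_theta: "weyl_act (weyl_theta j) \<phi> v = act (mfps_const (v $ j) + mfps_var j) (\<phi> v)"
  by (simp add: weyl_theta_def weyl_act_times weyl_act_x weyl_act_d log_x_def log_d_eq fall_unit_vec)

lemma clinear_poly_theta: "clinear poly_theta"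
  unfolding poly_theta_def by (rule clinear_poly_apply_left)

lemma poly_theta_Var: "poly_theta (Var j) = weyl_theta j"
  by (simp add: poly_theta_def poly_apply_single
      multi_pow_unit_vec [where T = "\<lambda>j. (*) (weyl_theta j)", OF weyl_theta_left_commute])

lemma poly_theta_Const: "poly_theta (Const c) = c *\<^sub>C 1"
  by (simp add: poly_theta_def poly_apply_single
      multi_pow_zero [where T = "\<lambda>j. (*) (weyl_theta j)", OF weyl_theta_left_commute])

lemma of_int_mult_cpoly: "of_int k * p = of_int k *\<^sub>C (p :: 'n::finite cpoly)"
proof (rule poly_mapping_eqI)
  fix \<gamma>
  show "lookup (of_int k * p) \<gamma> = lookup (of_int k *\<^sub>C p) \<gamma>"
    by (cases k rule: int_cases2) (simp_all add: lookup_of_nat_mult scaleC_complex_def)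
qed

text \<open>On the coefficient at v each \<theta>_j acts as
  \<open>v $ j + \<partial>/\<partial>y_j\<close>, so an Euler operator splits into a linear form in
  the derivatives and a scalar.\<close>

lemma weyl_act_euler:
  "weyl_act (poly_theta (euler A \<beta> i)) \<phi> v =
     act (\<Sum>j\<in>UNIV. of_int (A $ i $ j) * mfps_var j) (\<phi> v)
       + ((\<Sum>j\<in>UNIV. of_int (A $ i $ j) * v $ j) - \<beta> $ i) *\<^sub>C \<phi> v"
proof -
  have eval: "clinear (\<lambda>P. weyl_act P \<phi> v)"
    using clinear_weyl_act_left [of \<phi>] by (simp add: clinear_def scaleC_fun_def)
  have "weyl_act (poly_theta (euler A \<beta> i)) \<phi> v
      = (\<Sum>j\<in>UNIV. of_int (A $ i $ j) *\<^sub>C act (mfps_const (v $ j) + mfps_var j) (\<phi> v)) - \<beta> $ i *\<^sub>C \<phi> v"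
    by (simp add: euler_def of_int_mult_cpoly clinear_diff [OF clinear_poly_theta]
        clinear_sum [OF clinear_poly_theta] clinear_scale [OF clinear_poly_theta]
        poly_theta_Var poly_theta_Const clinear_diff [OF eval] clinear_sum [OF eval]
        clinear_scale [OF eval] weyl_act_theta weyl_act_one)
  also have "\<dots> = act ((\<Sum>j\<in>UNIV. of_int (A $ i $ j) * (mfps_const (v $ j) + mfps_var j)) - mfps_const (\<beta> $ i)) (\<phi> v)"
    by (simp add: act_sum_left act_mult act_const act_diff_left scaleC_add_right
        flip: mfps_const_of_int)
  also have "(\<Sum>j\<in>UNIV. of_int (A $ i $ j) * (mfps_const (v $ j) + mfps_var j)) - mfps_const (\<beta> $ i)
      = (\<Sum>j\<in>UNIV. of_int (A $ i $ j) * mfps_var j) + mfps_const ((\<Sum>j\<in>UNIV. of_int (A $ i $ j) * v $ j) - \<beta> $ i)"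
  proof -
    have "mfps_const (\<Sum>j\<in>UNIV. of_int (A $ i $ j) * v $ j)
        = (\<Sum>j\<in>UNIV. of_int (A $ i $ j) * (mfps_const (v $ j) :: ('a, complex) mfps))"
      by (rule mfps_eqI)
         (simp add: mfps_nth_sum mfps_nth_const_mult flip: mfps_const_of_int, simp add: mfps_const_def)
    then show ?thesis by (simp add: mfps_const_diff distrib_left sum.distrib)
  qed
  finally show ?thesis by (simp only: act_add_left act_const)
qed

section \<open>The hypergeometric system as equations between coefficients\<close>

lemma annihilated_left_ideal:
  "(\<forall>P\<in>left_ideal S. weyl_act P \<phi> = 0) \<longleftrightarrow> (\<forall>P\<in>S. weyl_act P \<phi> = 0)"
proof
  assume *: "\<forall>P\<in>left_ideal S. weyl_act P \<phi> = 0"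
  have "P \<in> left_ideal S" if "P \<in> S" for P
    using left_ideal.step [OF that left_ideal.zero, of 1] by simp
  with * show "\<forall>P\<in>S. weyl_act P \<phi> = 0" by blast
next
  assume S: "\<forall>P\<in>S. weyl_act P \<phi> = 0"
  have "weyl_act P \<phi> = 0" if "P \<in> left_ideal S" for P
    using that
    by induction
       (use S in \<open>simp_all add: clinear_add [OF clinear_weyl_act_left] clinear_zero [OF clinear_weyl_act_left]
         weyl_act_times clinear_zero [OF clinear_weyl_act_right]\<close>)
  then show "\<forall>P\<in>left_ideal S. weyl_act P \<phi> = 0" by blast
qed

text \<open>Polynomials in the commuting \<partial>_j act as a ring, so the toric ideal kills a
  series as soon as its binomials do.\<close>

lemma annihilated_iff_generators:
  fixes A :: "int ^ 'n::finite ^ 'd"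
  shows
  "annihilated A \<beta> \<phi> \<longleftrightarrow>
     (\<forall>\<mu> \<nu>. A *v vec_of_nat \<mu> = A *v vec_of_nat \<nu> \<longrightarrow> multi_pow log_d \<mu> \<phi> = multi_pow log_d \<nu> \<phi>) \<and>
     (\<forall>i. weyl_act (poly_theta (euler A \<beta> i)) \<phi> = 0)"
proof -
  interpret R: module "(*) :: 'n cpoly \<Rightarrow> _"
    by standard (simp_all add: algebra_simps)
  let ?G = "{Poly_Mapping.single u 1 - Poly_Mapping.single v (1 :: complex) | u v. A *v vec_of_nat u = A *v vec_of_nat v} :: 'n cpoly set"
  have sing: "poly_apply log_d (Poly_Mapping.single \<mu> 1 - Poly_Mapping.single \<nu> 1) \<phi>
      = multi_pow log_d \<mu> \<phi> - multi_pow log_d \<nu> \<phi>" for \<mu> \<nu>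
    by (simp add: clinear_diff [OF clinear_poly_apply_left] poly_apply_single)
  have lin: "clinear (poly_apply log_d c)" for c :: "'n cpoly"
    using clinear_weyl_act_right [of "poly_d c"] by (simp add: weyl_act_poly_d clinear_def)
  have span: "poly_apply log_d p \<phi> = 0" if "p \<in> R.span ?G" and G: "\<forall>p\<in>?G. poly_apply log_d p \<phi> = 0" for p
    using that(1)
  proof (induction rule: R.span_induct_alt)
    case base
    show ?case by (rule clinear_zero [OF clinear_poly_apply_left])
  next
    case (step c x y)
    from G step.hyps have "poly_apply log_d x \<phi> = 0" by (rule bspec)
    then show ?case
      by (simp add: clinear_add [OF clinear_poly_apply_left] step.IH clinear_zero [OF lin]
          poly_apply_mult [where T = log_d, OF log_series.commute_D log_series.linear_D])
  qed
  have toric: "(\<forall>p\<in>toric_ideal A. poly_apply log_d p \<phi> = 0) \<longleftrightarrow> (\<forall>p\<in>?G. poly_apply log_d p \<phi> = 0)"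
  proof
    assume *: "\<forall>p\<in>toric_ideal A. poly_apply log_d p \<phi> = 0"
    show "\<forall>p\<in>?G. poly_apply log_d p \<phi> = 0"
    proof
      fix p assume "p \<in> ?G"
      then have "p \<in> toric_ideal A" unfolding toric_ideal_def by (rule R.span_base)
      with * show "poly_apply log_d p \<phi> = 0" by (rule bspec)
    qed
  next
    assume "\<forall>p\<in>?G. poly_apply log_d p \<phi> = 0"
    then show "\<forall>p\<in>toric_ideal A. poly_apply log_d p \<phi> = 0"
      unfolding toric_ideal_def using span by (intro ballI)
  qed
  have binom: "(\<forall>p\<in>?G. poly_apply log_d p \<phi> = 0)
      \<longleftrightarrow> (\<forall>\<mu> \<nu>. A *v vec_of_nat \<mu> = A *v vec_of_nat \<nu> \<longrightarrow> multi_pow log_d \<mu> \<phi> = multi_pow log_d \<nu> \<phi>)"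
    (is "?L \<longleftrightarrow> ?R")
  proof
    assume L: ?L
    show ?R
    proof (intro allI impI)
      fix \<mu> \<nu> :: "nat ^ 'n" assume "A *v vec_of_nat \<mu> = A *v vec_of_nat \<nu>"
      then have "Poly_Mapping.single \<mu> 1 - Poly_Mapping.single \<nu> 1 \<in> ?G" by blast
      from bspec [OF L this] show "multi_pow log_d \<mu> \<phi> = multi_pow log_d \<nu> \<phi>"
        unfolding sing by (rule eq_iff_diff_eq_0 [THEN iffD2])
    qed
  next
    assume R: ?R
    show ?L
    proof
      fix p assume "p \<in> ?G"
      then obtain \<mu> \<nu> where p: "p = Poly_Mapping.single \<mu> 1 - Poly_Mapping.single \<nu> 1"
        and "A *v vec_of_nat \<mu> = A *v vec_of_nat \<nu>" by blast
      then have "multi_pow log_d \<mu> \<phi> = multi_pow log_d \<nu> \<phi>" using R by blast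
      then show "poly_apply log_d p \<phi> = 0" unfolding p sing by (rule eq_iff_diff_eq_0 [THEN iffD1])
    qed
  qed
  have "annihilated A \<beta> \<phi> \<longleftrightarrow> (\<forall>p\<in>toric_ideal A. poly_apply log_d p \<phi> = 0) \<and>
      (\<forall>i. weyl_act (poly_theta (euler A \<beta> i)) \<phi> = 0)"
    unfolding annihilated_def hyp_ideal_def annihilated_left_ideal ball_Un
    by (simp add: weyl_act_poly_d)
  then show ?thesis unfolding toric binom .
qed

text \<open>At exponent v0 + z, the operators \<open>\<partial>^\<mu>\<close> and
  \<open>\<partial>^\<nu>\<close> read the coefficients at z + \<mu> and z + \<nu>. If A \<mu> = A
  \<nu>, these two points lie in the kernel together or both outside it, where the coefficients
  vanish. The scalar part of the Euler operators is zero because A (v0 + u) = \<beta> for u in the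
  kernel.\<close>

lemma annihilated_iff:
  fixes A :: "int ^ 'n::finite ^ 'd"
  assumes supp: "\<forall>u. r u \<noteq> 0 \<longrightarrow> u \<in> int_kernel A"
    and v0: "\<And>i. (\<Sum>j\<in>UNIV. of_int (A $ i $ j) * v0 $ j) = \<beta> $ i"
  shows "annihilated A \<beta> (log_series_at v0 r) \<longleftrightarrow>
     (\<forall>u\<in>int_kernel A. \<forall>u'\<in>int_kernel A. \<forall>\<mu> \<nu>. u - vec_of_nat \<mu> = u' - vec_of_nat \<nu> \<longrightarrow>
        act (fall (v0 + vec_of_int u) \<mu>) (r u) = act (fall (v0 + vec_of_int u') \<nu>) (r u')) \<and>
     (\<forall>u\<in>int_kernel A. \<forall>i. act (\<Sum>j\<in>UNIV. of_int (A $ i $ j) * mfps_var j) (r u) = 0)"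
    (is "_ \<longleftrightarrow> ?B \<and> ?E")
proof -
  let ?\<phi> = "log_series_at v0 r"
  have sumA: "(\<Sum>j\<in>UNIV. of_int (A $ i $ j) * (v0 + vec_of_int u) $ j) = \<beta> $ i" if "u \<in> int_kernel A" for u i
  proof -
    have "(\<Sum>j\<in>UNIV. A $ i $ j * u $ j) = 0"
      using that by (auto simp: int_kernel_def matrix_vector_mult_def vec_eq_iff)
    then have "(\<Sum>j\<in>UNIV. of_int (A $ i $ j) * of_int (u $ j)) = (0 :: complex)"
      using of_int_sum [of "\<lambda>j. A $ i $ j * u $ j" UNIV, where ?'a = complex] by simp
    then show ?thesis by (simp add: vec_of_int_def distrib_left sum.distrib v0)
  qed
  have E: "(\<forall>i. weyl_act (poly_theta (euler A \<beta> i)) ?\<phi> = 0) \<longleftrightarrow> ?E"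
  proof
    assume *: "\<forall>i. weyl_act (poly_theta (euler A \<beta> i)) ?\<phi> = 0"
    show ?E
    proof (intro ballI allI)
      fix u i assume "u \<in> int_kernel A"
      moreover have "weyl_act (poly_theta (euler A \<beta> i)) ?\<phi> (v0 + vec_of_int u) = 0" using * by simp
      ultimately show "act (\<Sum>j\<in>UNIV. of_int (A $ i $ j) * mfps_var j) (r u) = 0"
        by (simp only: weyl_act_euler sumA log_series_at_nth) simp
    qed
  next
    assume E: ?E
    have "weyl_act (poly_theta (euler A \<beta> i)) ?\<phi> v = 0" for i v
    proof (cases "\<exists>u\<in>int_kernel A. v = v0 + vec_of_int u")
      case True
      then obtain u where u: "u \<in> int_kernel A" "v = v0 + vec_of_int u" by blast
      then show ?thesis
        using E by (simp only: weyl_act_euler sumA log_series_at_nth u(2)) simp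
    next
      case False
      then have "?\<phi> v = 0"
      proof (cases "\<exists>u. v = v0 + vec_of_int u")
        case True
        then obtain u where u: "v = v0 + vec_of_int u" by blast
        with False supp have "r u = 0" by blast
        then show ?thesis by (simp add: u)
      qed (simp add: log_series_at_outside)
      then show ?thesis by (simp add: weyl_act_euler)
    qed
    then show "\<forall>i. weyl_act (poly_theta (euler A \<beta> i)) ?\<phi> = 0" by (simp add: fun_eq_iff)
  qed
  have B: "(\<forall>\<mu> \<nu>. A *v vec_of_nat \<mu> = A *v vec_of_nat \<nu> \<longrightarrow> multi_pow log_d \<mu> ?\<phi> = multi_pow log_d \<nu> ?\<phi>) \<longleftrightarrow> ?B"
  proof
    assume *: "\<forall>\<mu> \<nu>. A *v vec_of_nat \<mu> = A *v vec_of_nat \<nu> \<longrightarrow> multi_pow log_d \<mu> ?\<phi> = multi_pow log_d \<nu> ?\<phi>"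
    show ?B
    proof (intro ballI allI impI)
      fix u u' \<mu> \<nu> assume u: "u \<in> int_kernel A" "u' \<in> int_kernel A" and eq: "u - vec_of_nat \<mu> = u' - vec_of_nat \<nu>"
      obtain z where z: "u = z + vec_of_nat \<mu>" "u' = z + vec_of_nat \<nu>"
      proof
        show "u = (u - vec_of_nat \<mu>) + vec_of_nat \<mu>" by simp
        show "u' = (u - vec_of_nat \<mu>) + vec_of_nat \<nu>" by (simp add: eq)
      qed
      have "A *v vec_of_nat \<mu> = A *v vec_of_nat \<nu>"
      proof -
        have "A *v z + A *v vec_of_nat \<mu> = A *v z + A *v vec_of_nat \<nu>"
          using u by (simp add: z int_kernel_def matrix_vector_right_distrib)
        then show ?thesis by simp
      qed
      with * have "multi_pow log_d \<mu> ?\<phi> = multi_pow log_d \<nu> ?\<phi>" by blast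
      then have "multi_pow log_d \<mu> ?\<phi> (v0 + vec_of_int z) = multi_pow log_d \<nu> ?\<phi> (v0 + vec_of_int z)"
        by (rule fun_cong)
      moreover have "v0 + vec_of_int z + vec_of_nat \<mu> = v0 + vec_of_int u" "v0 + vec_of_int z + vec_of_nat \<nu> = v0 + vec_of_int u'"
        by (simp_all add: z add.assoc)
      ultimately show "act (fall (v0 + vec_of_int u) \<mu>) (r u) = act (fall (v0 + vec_of_int u') \<nu>) (r u')"
        by (simp only: multi_pow_log_d log_series_at_nth)
    qed
  next
    assume B: ?B
    show "\<forall>\<mu> \<nu>. A *v vec_of_nat \<mu> = A *v vec_of_nat \<nu> \<longrightarrow> multi_pow log_d \<mu> ?\<phi> = multi_pow log_d \<nu> ?\<phi>"
    proof (intro allI impI ext)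
      fix \<mu> \<nu> v assume A: "A *v vec_of_nat \<mu> = A *v vec_of_nat \<nu>"
      show "multi_pow log_d \<mu> ?\<phi> v = multi_pow log_d \<nu> ?\<phi> v"
      proof (cases "\<exists>z. v = v0 + vec_of_int z")
        case True
        then obtain z where v: "v = v0 + vec_of_int z" by blast
        have v': "v + vec_of_nat \<mu> = v0 + vec_of_int (z + vec_of_nat \<mu>)" "v + vec_of_nat \<nu> = v0 + vec_of_int (z + vec_of_nat \<nu>)"
          by (simp_all add: v add.assoc)
        have iff: "z + vec_of_nat \<mu> \<in> int_kernel A \<longleftrightarrow> z + vec_of_nat \<nu> \<in> int_kernel A"
          using A by (simp add: int_kernel_def matrix_vector_right_distrib)
        show ?thesis
        proof (cases "z + vec_of_nat \<mu> \<in> int_kernel A")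
          case True
          then show ?thesis
            unfolding multi_pow_log_d v' log_series_at_nth
            using iff by (intro B [rule_format]) simp_all
        next
          case False
          then have "r (z + vec_of_nat \<mu>) = 0" "r (z + vec_of_nat \<nu>) = 0" using iff supp by blast+
          then show ?thesis
            unfolding multi_pow_log_d v' log_series_at_nth by simp
        qed
      next
        case False
        have "?\<phi> (v + vec_of_nat \<kappa>) = 0" for \<kappa> :: "nat ^ 'n"
        proof (rule log_series_at_outside)
          fix u show "v + vec_of_nat \<kappa> \<noteq> v0 + vec_of_int u"
          proof
            assume "v + vec_of_nat \<kappa> = v0 + vec_of_int u"
            then have "v = v0 + vec_of_int (u - vec_of_nat \<kappa>)" by (simp add: algebra_simps)
            with False show False by blast
          qed
        qed
        then show ?thesis by (simp add: multi_pow_log_d)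
      qed
    qed
  qed
  show ?thesis unfolding annihilated_iff_generators E B ..
qed

text \<open>The Euler polynomials belong to the second summand of the fake indicial ideal, hence
  vanish at \<open>v0\<close>.\<close>

lemma fake_exponent_A:
  assumes "fake_exponent A \<beta> w v0"
  shows "(\<Sum>j\<in>UNIV. of_int (A $ i $ j) * v0 $ j) = \<beta> $ i"
proof -
  interpret R: module "(*) :: 'a cpoly \<Rightarrow> _"
    by standard (simp_all add: algebra_simps)
  have "poly_theta 0 = (0 :: 'a weyl)" by (rule clinear_zero [OF clinear_poly_theta])
  then have "euler A \<beta> i \<in> fake_indicial_ideal A \<beta> w"
    unfolding fake_indicial_ideal_def ideal_sum_def
    by (intro CollectI exI [of _ 0] exI [of _ "euler A \<beta> i"] conjI R.span_base)
       (auto intro: left_ideal.zero)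
  then have 0: "poly_eval (euler A \<beta> i) v0 = 0"
    using assms by (simp add: fake_exponent_def)
  let ?f = "\<lambda>p :: 'a cpoly. poly_eval p v0"
  have eval: "?f p = (\<Sum>\<alpha>\<in>S. lookup p \<alpha> * (\<Prod>j\<in>UNIV. v0 $ j ^ (\<alpha> $ j)))"
    if "finite S" "keys p \<subseteq> S" for p S
    unfolding poly_eval_def
    by (rule sum.mono_neutral_left) (use that in \<open>auto simp: in_keys_iff\<close>)
  have lin: "clinear ?f"
  proof (rule clinearI)
    fix p q :: "'a cpoly"
    show "?f (p + q) = ?f p + ?f q"
      using keys_add [of p q]
      by (simp add: eval [of "keys p \<union> keys q"] lookup_add distrib_right sum.distrib)
  next
    fix c and p :: "'a cpoly"
    have "keys (c *\<^sub>C p) \<subseteq> keys p" by (auto simp: in_keys_iff)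
    then show "?f (c *\<^sub>C p) = c *\<^sub>C ?f p"
      by (simp add: eval [of "keys p"] scaleC_complex_def sum_distrib_left mult.assoc)
  qed
  have "?f (Var j) = v0 $ j" for j
  proof -
    have "?f (Var j) = (\<Prod>i\<in>UNIV. v0 $ i ^ (unit_vec j $ i))"
      by (simp add: poly_eval_def)
    also have "\<dots> = (\<Prod>i\<in>{j}. v0 $ i ^ (unit_vec j $ i))"
      by (rule prod.mono_neutral_right) (auto simp: unit_vec_nth)
    finally show ?thesis by (simp add: unit_vec_nth)
  qed
  moreover have "?f (Const c) = c" for c
    by (cases "c = 0") (simp_all add: poly_eval_def)
  ultimately have "poly_eval (euler A \<beta> i) v0 = (\<Sum>j\<in>UNIV. of_int (A $ i $ j) * v0 $ j) - \<beta> $ i"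
    by (simp add: euler_def of_int_mult_cpoly clinear_diff [OF lin] clinear_sum [OF lin]
        clinear_scale [OF lin] scaleC_complex_def)
  with 0 show ?thesis by simp
qed

section \<open>Generators of the orthogonality conditions\<close>

lemma ideal_sum_span: "ideal_sum (ideal_of S) (ideal_of T) = ideal_of (S \<union> T :: 'a::comm_ring_1 set)"
proof -
  interpret R: module "(*) :: 'a \<Rightarrow> _" by standard (simp_all add: algebra_simps)
  show ?thesis unfolding ideal_sum_def R.span_Un by auto
qed

lemma ideal_prod_span:
  "ideal_prod (ideal_of S) (ideal_of T) = ideal_of {s * t | s t. s \<in> S \<and> t \<in> (T :: 'a::comm_ring_1 set)}"
proof -
  interpret R: module "(*) :: 'a \<Rightarrow> _" by standard (simp_all add: algebra_simps)
  let ?P = "R.span {s * t | s t. s \<in> S \<and> t \<in> T}"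
  have 1: "s * g \<in> ?P" if s: "s \<in> S" and "g \<in> R.span T" for s g
    using that(2)
  proof (induction rule: R.span_induct_alt)
    case (step c t g)
    have "s * t \<in> ?P" using s step.hyps by (blast intro: R.span_base)
    then have "c * (s * t) + s * g \<in> ?P" by (rule R.span_add [OF R.span_scale step.IH])
    then show ?case by (simp only: distrib_left mult.left_commute)
  qed (simp add: R.span_zero)
  have 2: "f * g \<in> ?P" if "f \<in> R.span S" and g: "g \<in> R.span T" for f g
    using that(1)
  proof (induction rule: R.span_induct_alt)
    case (step c s f)
    have "c * (s * g) + f * g \<in> ?P"
      by (rule R.span_add [OF R.span_scale [OF 1 [OF step.hyps g]] step.IH])
    then show ?case by (simp only: distrib_right mult.assoc)
  qed (simp add: R.span_zero)
  show ?thesis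
    unfolding ideal_prod_def
  proof
    show "R.span {f * g |f g. f \<in> R.span S \<and> g \<in> R.span T} \<subseteq> ?P"
      by (rule R.span_minimal) (use 2 in auto)
    show "?P \<subseteq> R.span {f * g |f g. f \<in> R.span S \<and> g \<in> R.span T}"
      by (rule R.span_mono) (use R.span_base in blast)
  qed
qed

definition At_form :: "int ^ 'n ^ 'd \<Rightarrow> 'd \<Rightarrow> ('n::finite, complex) mfps" where
  "At_form A i = (\<Sum>j\<in>UNIV. of_int (A $ i $ j) * mfps_var j)"

text \<open>Explicit generators turn orthogonality to \<open>Q_hat\<close> into differential
  equations. They are moreover all homogeneous, as the duality for colon ideals requires.\<close>

lemma Q_hat_eq:
  "Q_hat A v0 N = ideal_of ({At_form A i * t_prod (I - \<Inter>N) | i I. I \<in> N} \<union>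
      {t_prod ((I \<union> J) - \<Inter>N) | I J. I \<in> N \<and> J \<in> NS A v0 - N})"
  unfolding Q_hat_def At_ideal_def M_hat_def P_hat_def ideal_prod_span ideal_sum_span
  by (rule arg_cong [where f = "module.span (*)"]) (auto simp: At_form_def)

lemma perp_Q_hat:
  "q \<in> perp (Q_hat A v0 N) \<longleftrightarrow>
     (\<forall>i. \<forall>I\<in>N. act (At_form A i) (act (t_prod (I - \<Inter>N)) q) = 0) \<and>
     (\<forall>I\<in>N. \<forall>J\<in>NS A v0 - N. act (t_prod ((I \<union> J) - \<Inter>N)) q = 0)"
  unfolding Q_hat_eq perp_ideal_of act_mult [symmetric] by blast

section \<open>The series attached to an element of the orthogonal space\<close>

lemma diff_at_0_zero [simp]: "diff_at_0 q 0 = 0"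
  by (simp add: diff_at_0_eq zero_mfps.rep_eq)

lemma F_series_eq:
  "F_series A v0 N q u = (if u \<in> int_kernel A \<and> nsupp_at v0 u \<in> N then act (ma_hat v0 N u) q else 0)"
  by (simp add: F_series_def F_hat_def diff_at_0_exp)

lemma zero_in_int_kernel [simp]: "0 \<in> int_kernel A"
  by (simp add: int_kernel_def)

lemma F_series_zero:
  assumes "nsupp_at v0 0 \<in> N"
  shows "F_series A v0 N q 0 = act (m_hat v0 N) q"
  using assms by (simp add: F_series_eq ma_hat_zero)

lemma act_t_prod_mono:
  assumes "S \<subseteq> T" "act (t_prod S) q = 0"
  shows "act (t_prod T) q = 0"
proof -
  have "t_prod T = t_prod (T - S) * t_prod S"
    using assms(1) by (subst t_prod_Un [symmetric]) (auto intro: arg_cong [where f = t_prod])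
  with assms(2) show ?thesis by (simp add: act_mult)
qed

text \<open>The negative support at the common point contains those at u and at u'. The composed
  operator is therefore a multiple of \<open>t^((I \<union> J) - K)\<close> with I in N and J
  outside N, a generator of \<open>P_hat\<close>.\<close>

lemma fall_ma_hat_outside:
  assumes q: "q \<in> perp (Q_hat A v0 N)"
    and N: "nsupp_at v0 0 \<in> N" "nsupp_at v0 u \<in> N" "nsupp_at v0 u' \<in> NS A v0 - N"
    and eq: "u - vec_of_nat \<mu> = u' - vec_of_nat \<nu>"
  shows "act (fall (v0 + vec_of_int u) \<mu>) (act (ma_hat v0 N u) q) = 0"
proof -
  let ?K = "\<Inter>N" and ?z = "u - vec_of_nat \<mu>"
  obtain U where U: "fall (v0 + vec_of_int u) \<mu> = U * t_prod (nsupp_at v0 ?z - nsupp_at v0 u)"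
    using fall_at_eq_unit by blast
  obtain V where V: "ma_hat v0 N u = V * t_prod (nsupp_at v0 u - ?K)"
    using ma_hat_unit [OF N(1,2)] by blast
  have sub: "nsupp_at v0 u \<subseteq> nsupp_at v0 ?z" "nsupp_at v0 u' \<subseteq> nsupp_at v0 ?z"
    using nsupp_at_mono [of v0 u \<mu>] nsupp_at_mono [of v0 u' \<nu>] eq by auto
  have t: "t_prod (nsupp_at v0 ?z - nsupp_at v0 u) * t_prod (nsupp_at v0 u - ?K) = t_prod (nsupp_at v0 ?z - ?K)"
    using sub N(2) by (subst t_prod_Un [symmetric]) (auto intro: arg_cong [where f = t_prod])
  have "act (t_prod ((nsupp_at v0 u \<union> nsupp_at v0 u') - ?K)) q = 0"
    using q N(2,3) unfolding perp_Q_hat by blast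
  then have "act (t_prod (nsupp_at v0 ?z - ?K)) q = 0"
    by (rule act_t_prod_mono [rotated]) (use sub in auto)
  moreover have "act (fall (v0 + vec_of_int u) \<mu>) (act (ma_hat v0 N u) q)
      = act (U * V) (act (t_prod (nsupp_at v0 ?z - nsupp_at v0 u) * t_prod (nsupp_at v0 u - ?K)) q)"
    unfolding U V act_mult [symmetric] by (simp only: ac_simps)
  ultimately show ?thesis by (simp add: t)
qed

text \<open>A toric equation between two points with supports in N is the compatibility of the
  \<open>ma_hat\<close>; if exactly one support is in N, \<open>P_hat\<close> makes both sides zero.
  The Euler equations come from the products of the linear forms with the generators of
  \<open>M_hat\<close>.\<close>

lemma F_series_annihilated:
  assumes q: "q \<in> perp (Q_hat A v0 N)"
    and N: "nsupp_at v0 0 \<in> N"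
    and v0: "\<And>i. (\<Sum>j\<in>UNIV. of_int (A $ i $ j) * v0 $ j) = \<beta> $ i"
  shows "annihilated A \<beta> (log_series_at v0 (F_series A v0 N q))"
proof -
  have supp: "\<forall>u. F_series A v0 N q u \<noteq> 0 \<longrightarrow> u \<in> int_kernel A"
    by (auto simp: F_series_eq split: if_splits)
  have NS: "nsupp_at v0 u \<in> NS A v0" if "u \<in> int_kernel A" for u
    using that by (auto simp: NS_def)
  show ?thesis
    unfolding annihilated_iff [OF supp v0] At_form_def [symmetric]
  proof (intro conjI ballI allI impI)
    fix u u' \<mu> \<nu> assume u: "u \<in> int_kernel A" "u' \<in> int_kernel A" and eq: "u - vec_of_nat \<mu> = u' - vec_of_nat \<nu>"
    show "act (fall (v0 + vec_of_int u) \<mu>) (F_series A v0 N q u) = act (fall (v0 + vec_of_int u') \<nu>) (F_series A v0 N q u')"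
    proof (cases "nsupp_at v0 u \<in> N"; cases "nsupp_at v0 u' \<in> N")
      assume "nsupp_at v0 u \<in> N" "nsupp_at v0 u' \<in> N"
      with ma_hat_compatible [OF N this eq] u show ?thesis by (simp add: F_series_eq flip: act_mult)
    next
      assume in_N: "nsupp_at v0 u \<in> N" "nsupp_at v0 u' \<notin> N"
      with fall_ma_hat_outside [OF q N in_N(1) _ eq] u NS show ?thesis by (simp add: F_series_eq)
    next
      assume in_N: "nsupp_at v0 u \<notin> N" "nsupp_at v0 u' \<in> N"
      with fall_ma_hat_outside [OF q N in_N(2) _ eq [symmetric]] u NS show ?thesis by (simp add: F_series_eq)
    qed (simp add: F_series_eq)
  next
    fix u i assume u: "u \<in> int_kernel A"
    show "act (At_form A i) (F_series A v0 N q u) = 0"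
    proof (cases "nsupp_at v0 u \<in> N")
      case True
      obtain V where "ma_hat v0 N u = V * t_prod (nsupp_at v0 u - \<Inter>N)"
        using ma_hat_unit [OF N True] by blast
      moreover have "act (At_form A i) (act (t_prod (nsupp_at v0 u - \<Inter>N)) q) = 0"
        using q True unfolding perp_Q_hat by blast
      ultimately show ?thesis
        using True u by (simp add: F_series_eq act_mult act_commute [of "At_form A i" V])
    qed (simp add: F_series_eq)
  qed
qed

section \<open>Recovering the orthogonal element from a series\<close>

text \<open>\<open>\<complex>[y]\<close> is an injective \<open>\<complex>[t]\<close>-module, and the syzygies of a monomial ideal are generated by
  those between pairs of its generators.\<close>

lemma ex_common_antiderivative:
  fixes S :: "'i \<Rightarrow> 'n::finite set" and s :: "'i \<Rightarrow> 'n cpoly"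
  assumes compat: "\<And>i j. i \<in> F \<Longrightarrow> j \<in> F \<Longrightarrow> act (t_prod (S j - S i)) (s i) = act (t_prod (S i - S j)) (s j)"
  shows "\<exists>R. \<forall>i\<in>F. act (t_prod (S i)) R = s i"
proof -
  define ind where "ind T = (\<chi> j. if j \<in> T then 1 else (0::nat))" for T :: "'n set"
  have t: "t_prod T = mfps_monom (ind T)" for T :: "'n set"
    by (simp add: t_prod_eq_monom ind_def)
  \<comment> \<open>The values that the pairing of R with monomials must take: prescribed by
    \<open>s i\<close> on multiples of \<open>t_prod (S i)\<close>, and chosen as zero on all other
    monomials.\<close>
  define lam where "lam \<gamma> = (if \<exists>i\<in>F. ind (S i) \<le> \<gamma>
    then let i = (SOME i. i \<in> F \<and> ind (S i) \<le> \<gamma>) in pairing (s i) (mfps_monom (\<gamma> - ind (S i))) else 0)" for \<gamma>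
  \<comment> \<open>If two of the monomials divide \<open>t^\<gamma>\<close>, so does their least
    common multiple, the monomial of the union; the pairwise syzygy is then multiplied by the
    remaining factor.\<close>
  have well: "pairing (s i) (mfps_monom (\<gamma> - ind (S i))) = pairing (s j) (mfps_monom (\<gamma> - ind (S j)))"
    if "i \<in> F" "j \<in> F" "ind (S i) \<le> \<gamma>" "ind (S j) \<le> \<gamma>" for i j \<gamma>
  proof -
    have le: "ind (S i) $ k \<le> \<gamma> $ k" "ind (S j) $ k \<le> \<gamma> $ k" for k
      using that by (simp_all add: less_eq_vec_def)
    have "\<gamma> $ k - ind (S i) $ k = ind (S j - S i) $ k + (\<gamma> $ k - ind (S i \<union> S j) $ k)"
      "\<gamma> $ k - ind (S j) $ k = ind (S i - S j) $ k + (\<gamma> $ k - ind (S i \<union> S j) $ k)" for k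
      using le [of k] by (simp_all add: ind_def split: if_splits)
    then have "\<gamma> - ind (S i) = ind (S j - S i) + (\<gamma> - ind (S i \<union> S j))"
      "\<gamma> - ind (S j) = ind (S i - S j) + (\<gamma> - ind (S i \<union> S j))"
      by (simp_all only: vec_eq_iff vector_minus_component vector_add_component) auto
    then show ?thesis
      using compat [OF that(1,2)]
      by (simp only: mfps_monom_mult [symmetric] pairing_act [symmetric] t)
  qed
  have lam: "lam \<gamma> = pairing (s i) (mfps_monom (\<gamma> - ind (S i)))" if "i \<in> F" "ind (S i) \<le> \<gamma>" for i \<gamma>
  proof -
    define j where "j = (SOME i. i \<in> F \<and> ind (S i) \<le> \<gamma>)"
    have "j \<in> F \<and> ind (S j) \<le> \<gamma>" unfolding j_def by (rule someI) (use that in blast)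
    moreover have "lam \<gamma> = pairing (s j) (mfps_monom (\<gamma> - ind (S j)))"
      using that by (auto simp: lam_def j_def Let_def)
    ultimately show ?thesis using well [of i j \<gamma>] that by simp
  qed
  \<comment> \<open>F may be infinite, but only finitely many sets \<open>S i\<close> occur. One
    index for each set already bounds the support of \<open>lam\<close>.\<close>
  define rep where "rep T = (SOME i. i \<in> F \<and> S i = T)" for T
  have rep: "rep (S i) \<in> F \<and> S (rep (S i)) = S i" if "i \<in> F" for i
    unfolding rep_def by (rule someI) (use that in blast)
  have "{\<gamma>. lam \<gamma> / of_nat (mi_fact \<gamma>) \<noteq> 0} \<subseteq> (\<Union>T\<in>S ` F. (\<lambda>\<alpha>. \<alpha> + ind T) ` keys (s (rep T)))"
  proof
    fix \<gamma> assume "\<gamma> \<in> {\<gamma>. lam \<gamma> / of_nat (mi_fact \<gamma>) \<noteq> 0}"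
    then have nz: "lam \<gamma> \<noteq> 0" by auto
    then obtain i where i: "i \<in> F" "ind (S i) \<le> \<gamma>" by (auto simp: lam_def split: if_splits)
    with rep have "pairing (s (rep (S i))) (mfps_monom (\<gamma> - ind (S i))) \<noteq> 0"
      using lam [of "rep (S i)" \<gamma>] nz by simp
    then have "\<gamma> - ind (S i) \<in> keys (s (rep (S i)))" by (simp add: pairing_monom in_keys_iff)
    then have "\<gamma> \<in> (\<lambda>\<alpha>. \<alpha> + ind (S i)) ` keys (s (rep (S i)))"
      by (rule image_eqI [rotated]) (simp add: nat_vec_diff_add i)
    with i show "\<gamma> \<in> (\<Union>T\<in>S ` F. (\<lambda>\<alpha>. \<alpha> + ind T) ` keys (s (rep T)))" by blast
  qed
  then have "finite {\<gamma>. lam \<gamma> / of_nat (mi_fact \<gamma>) \<noteq> 0}"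
    by (rule finite_subset) (rule finite_UN_I, rule finite, intro finite_imageI finite_keys)
  then have "lookup (Abs_poly_mapping (\<lambda>\<gamma>. lam \<gamma> / of_nat (mi_fact \<gamma>))) \<gamma> = lam \<gamma> / of_nat (mi_fact \<gamma>)" for \<gamma>
    by simp
  then obtain R :: "'n cpoly" where "\<And>\<gamma>. lookup R \<gamma> = lam \<gamma> / of_nat (mi_fact \<gamma>)"
    by blast
  then have R: "pairing R (mfps_monom \<gamma>) = lam \<gamma>" for \<gamma> by (simp add: pairing_monom)
  have "act (t_prod (S i)) R = s i" if "i \<in> F" for i
    by (rule pairing_eqI) (simp add: pairing_act t mfps_monom_mult R lam [OF that])
  then show ?thesis by blast
qed

text \<open>The point reached is the componentwise minimum of u and u', so this is
  \<open>nsupp_at_neg_part\<close> with base point moved to u'.\<close>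

lemma nsupp_at_min:
  "nsupp_at v0 (u - vec_of_nat (pos_part (u - u'))) = nsupp_at v0 u \<union> nsupp_at v0 u'"
proof -
  have "u - vec_of_nat (pos_part (u - u')) = u' + - vec_of_nat (neg_part (u - u'))"
    using pos_part_minus_neg_part [of "u - u'"] by (simp add: algebra_simps)
  moreover have shift: "nsupp_at v0 (u' + x) = nsupp_at (v0 + vec_of_int u') x" for x
    by (simp add: nsupp_at_def add.assoc)
  moreover have "nsupp_at (v0 + vec_of_int u') 0 = nsupp_at v0 u'" "nsupp_at (v0 + vec_of_int u') (u - u') = nsupp_at v0 u"
    by (simp_all add: nsupp_at_def)
  ultimately show ?thesis
    by (simp only: nsupp_at_neg_part Un_commute)
qed

text \<open>After removal of units, the toric equations at the minimum of u and u' are the syzygies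
  between \<open>t^(I - K)\<close> and \<open>t^(J - K)\<close>, so a common antiderivative exists.
  The toric equations leading out of N and the Euler equations then say that it is orthogonal to
  \<open>Q_hat\<close>.\<close>

lemma annihilated_series_eq_F_series:
  fixes A :: "int ^ 'n ^ 'd"
  assumes supp: "\<And>u. r u \<noteq> 0 \<Longrightarrow> u \<in> int_kernel A \<and> nsupp_at v0 u \<in> N"
    and v0: "\<And>i. (\<Sum>j\<in>UNIV. of_int (A $ i $ j) * v0 $ j) = \<beta> $ i"
    and ann: "annihilated A \<beta> (log_series_at v0 r)"
    and N0: "nsupp_at v0 0 \<in> N" and NS: "N \<subseteq> NS A v0"
  shows "\<exists>q\<in>perp (Q_hat A v0 N). F_series A v0 N q = r"
proof -
  define F where "F = {u \<in> int_kernel A. nsupp_at v0 u \<in> N}"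
  have "\<forall>u\<in>F. \<exists>U. U dvd 1 \<and> ma_hat v0 N u = U * t_prod (nsupp_at v0 u - \<Inter>N)"
    using ma_hat_unit [OF N0] by (auto simp: F_def)
  then obtain U where U: "\<And>u. u \<in> F \<Longrightarrow> U u dvd 1"
    and ma: "\<And>u. u \<in> F \<Longrightarrow> ma_hat v0 N u = U u * t_prod (nsupp_at v0 u - \<Inter>N)"
    by metis
  have "\<forall>u\<in>F. \<exists>V. U u * V = 1" using U by (metis dvdE)
  then obtain V where V: "\<And>u. u \<in> F \<Longrightarrow> U u * V u = 1" by metis
  \<comment> \<open>With the unit of \<open>ma_hat\<close> divided out, the condition on R becomes
    that the pure monomial \<open>t^(I - K)\<close> sends R to \<open>s u\<close>.\<close>
  define s where "s u = act (V u) (r u)" for u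
  have r: "r u = act (U u) (s u)" if "u \<in> F" for u
    by (simp add: s_def V [OF that] flip: act_mult)
  have ker: "\<forall>u. r u \<noteq> 0 \<longrightarrow> u \<in> int_kernel A"
    using supp by blast
  have binom: "act (fall (v0 + vec_of_int u) \<mu>) (r u) = act (fall (v0 + vec_of_int u') \<nu>) (r u')"
    if "u \<in> int_kernel A" "u' \<in> int_kernel A" "u - vec_of_nat \<mu> = u' - vec_of_nat \<nu>" for u u' \<mu> \<nu>
    using ann that unfolding annihilated_iff [OF ker v0] by blast
  have euler: "act (At_form A i) (r u) = 0" if "u \<in> int_kernel A" for u i
    using ann that unfolding annihilated_iff [OF ker v0] At_form_def by blast
  have step: "u - vec_of_nat (pos_part (u - u')) = u' - vec_of_nat (pos_part (u' - u))" for u u' :: "int ^ 'n"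
  proof -
    have "pos_part (u' - u) = neg_part (u - u')"
      by (simp add: pos_part_def neg_part_def vec_eq_iff)
    then show ?thesis
      using pos_part_minus_neg_part [of "u - u'"] by (simp add: algebra_simps)
  qed
  have fall: "\<exists>W. W dvd 1 \<and> fall (v0 + vec_of_int u) (pos_part (u - u')) = W * t_prod (nsupp_at v0 u' - nsupp_at v0 u)" for u u'
    using fall_at_eq_unit [of v0 u "pos_part (u - u')"] unfolding nsupp_at_min Un_Diff by simp
  have compat: "act (t_prod (nsupp_at v0 u' - nsupp_at v0 u)) (s u) = act (t_prod (nsupp_at v0 u - nsupp_at v0 u')) (s u')"
    if uF: "u \<in> F" "u' \<in> F" for u u'
  proof -
    let ?I = "nsupp_at v0 u" and ?J = "nsupp_at v0 u'" and ?K = "\<Inter>N"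
    have ker: "u \<in> int_kernel A" "u' \<in> int_kernel A" and N: "?I \<in> N" "?J \<in> N" using uF by (auto simp: F_def)
    obtain W where W: "W dvd 1" "fall (v0 + vec_of_int u) (pos_part (u - u')) = W * t_prod (?J - ?I)"
      using fall by blast
    obtain W' where W': "fall (v0 + vec_of_int u') (pos_part (u' - u)) = W' * t_prod (?I - ?J)"
      using fall by blast
    have t: "t_prod (?J - ?I) * t_prod (?I - ?K) = t_prod ((?I \<union> ?J) - ?K)"
      "t_prod (?I - ?J) * t_prod (?J - ?K) = t_prod ((?I \<union> ?J) - ?K)"
      using N by (subst t_prod_Un [symmetric]; auto intro!: arg_cong [where f = t_prod])+
    have "(W * U u) * (t_prod (?J - ?I) * t_prod (?I - ?K)) = (W' * U u') * (t_prod (?I - ?J) * t_prod (?J - ?K))"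
      using ma_hat_compatible [OF N0 N step] unfolding W(2) W' ma [OF uF(1)] ma [OF uF(2)]
      by (simp only: ac_simps)
    \<comment> \<open>The \<open>ma_hat\<close> satisfy the same relation as the coefficients r,
      which forces the units on the two sides to agree; they can then be cancelled from the relation
      for r.\<close>
    then have unit: "W * U u = W' * U u'"
      unfolding t by (simp only: mult_right_cancel [OF t_prod_nonzero])
    have "act (W * t_prod (?J - ?I)) (act (U u) (s u)) = act (W' * t_prod (?I - ?J)) (act (U u') (s u'))"
      using binom [OF ker step] unfolding W(2) W' r [OF uF(1)] r [OF uF(2)] .
    then have "act (W * U u) (act (t_prod (?J - ?I)) (s u)) = act (W' * U u') (act (t_prod (?I - ?J)) (s u'))"
      by (simp only: act_mult [symmetric] ac_simps)
    then show ?thesis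
      unfolding unit [symmetric] act_unit_cancel [OF mult_unit [OF W(1) U [OF uF(1)]]] .
  qed
  have outside: "act (t_prod (nsupp_at v0 u' - nsupp_at v0 u)) (s u) = 0"
    if uF: "u \<in> F" and u': "u' \<in> int_kernel A" "nsupp_at v0 u' \<notin> N" for u u'
  proof -
    let ?T = "t_prod (nsupp_at v0 u' - nsupp_at v0 u)"
    obtain W where W: "W dvd 1" "fall (v0 + vec_of_int u) (pos_part (u - u')) = W * ?T"
      using fall by blast
    have "r u' = 0" using supp u'(2) by blast
    moreover have "u \<in> int_kernel A" using uF by (simp add: F_def)
    ultimately have "act W (act ?T (r u)) = act W 0"
      using binom [OF _ u'(1) step, of u] by (simp add: W(2) act_mult)
    then have "act ?T (r u) = 0" unfolding act_unit_cancel [OF W(1)] .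
    then show ?thesis by (simp add: s_def act_commute [of ?T])
  qed
  have diff: "(nsupp_at v0 u' - \<Inter>N) - (nsupp_at v0 u - \<Inter>N) = nsupp_at v0 u' - nsupp_at v0 u" if "u \<in> F" "u' \<in> F" for u u'
    using that by (auto simp: F_def)
  have "\<exists>R. \<forall>u\<in>F. act (t_prod (nsupp_at v0 u - \<Inter>N)) R = s u"
    by (rule ex_common_antiderivative) (simp add: diff compat)
  then obtain R where R: "\<And>u. u \<in> F \<Longrightarrow> act (t_prod (nsupp_at v0 u - \<Inter>N)) R = s u"
    by blast
  have "F_series A v0 N R u = r u" for u
  proof (cases "u \<in> F")
    case True
    then have "u \<in> int_kernel A \<and> nsupp_at v0 u \<in> N" by (simp add: F_def)
    then show ?thesis using True by (simp add: F_series_eq ma act_mult R r)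
  next
    case False
    then show ?thesis using supp [of u] by (auto simp: F_series_eq F_def)
  qed
  moreover have "R \<in> perp (Q_hat A v0 N)"
    unfolding perp_Q_hat
  proof (intro conjI allI ballI)
    fix i I assume "I \<in> N"
    with NS obtain u where u: "u \<in> F" "I = nsupp_at v0 u" by (auto simp: F_def NS_def)
    then show "act (At_form A i) (act (t_prod (I - \<Inter>N)) R) = 0"
      using euler [of u i] by (simp add: R s_def act_commute [of "At_form A i"] F_def)
  next
    fix I J assume I: "I \<in> N" and J: "J \<in> NS A v0 - N"
    obtain u where u: "u \<in> F" "I = nsupp_at v0 u" using NS I by (auto simp: F_def NS_def)
    obtain u' where u': "u' \<in> int_kernel A" "J = nsupp_at v0 u'" using J by (auto simp: NS_def)
    have "t_prod ((I \<union> J) - \<Inter>N) = t_prod (J - I) * t_prod (I - \<Inter>N)"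
      using I by (subst t_prod_Un [symmetric]) (auto intro: arg_cong [where f = t_prod])
    then show "act (t_prod ((I \<union> J) - \<Inter>N)) R = 0"
      using outside [OF u(1) u'(1)] J u u'(2) by (simp add: act_mult R)
  qed
  ultimately show ?thesis by blast
qed

section \<open>Orthogonal spaces and colon ideals\<close>

text \<open>The partial functional is given by its graph, so that being well defined is a condition
  at 0 alone. It is fixed on a basis of its domain and extended linearly; additivity and homogeneity
  of the graph keep the extension inside it.\<close>

lemma clinear_extension:
  fixes R :: "('v::complex_vector \<times> complex) set"
  assumes add: "\<And>x a y b. (x, a) \<in> R \<Longrightarrow> (y, b) \<in> R \<Longrightarrow> (x + y, a + b) \<in> R"
    and scale: "\<And>x a c. (x, a) \<in> R \<Longrightarrow> (c *\<^sub>C x, c * a) \<in> R"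
    and single_valued: "\<And>a. (0, a) \<in> R \<Longrightarrow> a = 0"
  shows "\<exists>\<Lambda> :: 'v \<Rightarrow> complex. clinear \<Lambda> \<and> (\<forall>(x, a)\<in>R. \<Lambda> x = a)"
proof -
  interpret VC: vector_space_pair "(*\<^sub>C) :: complex \<Rightarrow> 'v \<Rightarrow> 'v" "(*) :: complex \<Rightarrow> complex \<Rightarrow> complex"
    by standard (simp_all add: scaleC_add_right scaleC_add_left algebra_simps)
  obtain B where B: "B \<subseteq> fst ` R" "VC.vs1.independent B" "fst ` R \<subseteq> VC.vs1.span B"
    by (rule VC.vs1.maximal_independent_subset [of "fst ` R"]) blast
  have "\<forall>b\<in>B. \<exists>a. (b, a) \<in> R" using B(1) by force
  then obtain h where h: "\<And>b. b \<in> B \<Longrightarrow> (b, h b) \<in> R"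
    using bchoice [of B "\<lambda>b a. (b, a) \<in> R"] by blast
  obtain \<Lambda> where "Vector_Spaces.linear (*\<^sub>C) (*) \<Lambda>" and \<Lambda>: "\<And>b. b \<in> B \<Longrightarrow> \<Lambda> b = h b"
    using VC.linear_independent_extend [OF B(2), of h] by blast
  then interpret L: Vector_Spaces.linear "(*\<^sub>C)" "(*)" \<Lambda> by simp
  have span: "(x, \<Lambda> x) \<in> R" if "x \<in> VC.vs1.span B" "R \<noteq> {}" for x
    using that(1)
  proof (induction rule: VC.vs1.span_induct_alt)
    case base
    obtain x a where "(x, a) \<in> R" using \<open>R \<noteq> {}\<close> by auto
    from scale [OF this, of 0] show ?case by (simp add: L.zero)
  next
    case (step c x y)
    from add [OF scale [OF h [OF step.hyps], of c] step.IH] show ?case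
      by (simp add: L.add L.scale \<Lambda> [OF step.hyps])
  qed
  have "\<Lambda> x = a" if "(x, a) \<in> R" for x a
  proof -
    have "x \<in> VC.vs1.span B" using B(3) that by force
    then have "(x, \<Lambda> x) \<in> R" using span that by blast
    from add [OF that scale [OF this, of "-1"]] have "(x + - 1 *\<^sub>C x, a - \<Lambda> x) \<in> R" by simp
    also have "x + - 1 *\<^sub>C x = 0"
      using scaleC_add_left [of 1 "-1" x] by simp
    finally show ?thesis using single_valued [of "a - \<Lambda> x"] by simp
  qed
  moreover have "clinear \<Lambda>"
    by (rule clinearI) (simp_all add: L.add L.scale scaleC_complex_def)
  ultimately show ?thesis by blast
qed

section \<open>Homogeneous parts and functionals of finite order\<close>

definition mi_deg :: "nat ^ 'n::finite \<Rightarrow> nat" where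
  "mi_deg \<gamma> = (\<Sum>j\<in>UNIV. \<gamma> $ j)"

lemma mi_deg_add [simp]: "mi_deg (\<alpha> + \<beta>) = mi_deg \<alpha> + mi_deg \<beta>"
  by (simp add: mi_deg_def sum.distrib)

lemma mi_deg_unit_vec [simp]: "mi_deg (unit_vec j) = 1"
  by (simp add: mi_deg_def unit_vec_nth)

lemma finite_mi_deg_le: "finite {\<gamma> :: nat ^ 'n::finite. mi_deg \<gamma> \<le> D}"
proof (rule finite_subset)
  have "\<gamma> $ j \<le> mi_deg \<gamma>" for \<gamma> :: "nat ^ 'n" and j
    unfolding mi_deg_def by (rule member_le_sum) simp_all
  then show "{\<gamma> :: nat ^ 'n. mi_deg \<gamma> \<le> D} \<subseteq> {\<gamma>. \<forall>j. \<gamma> $ j \<le> (\<chi> j. D) $ j}"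
    by (auto intro: order_trans)
qed (rule finite_nat_vec_atMost)

definition homogeneous :: "nat \<Rightarrow> ('n::finite, complex) mfps \<Rightarrow> bool" where
  "homogeneous d f \<longleftrightarrow> (\<forall>\<gamma>. mfps_nth f \<gamma> \<noteq> 0 \<longrightarrow> mi_deg \<gamma> = d)"

definition hom_part :: "nat \<Rightarrow> ('n::finite, complex) mfps \<Rightarrow> ('n, complex) mfps" where
  "hom_part d f = Mfps (\<lambda>\<gamma>. if mi_deg \<gamma> = d then mfps_nth f \<gamma> else 0)"

lemma hom_part_add: "hom_part d (f + g) = hom_part d f + hom_part d g"
  by (rule mfps_eqI) (simp add: hom_part_def plus_mfps.rep_eq)

lemma hom_part_zero [simp]: "hom_part d 0 = 0"
  by (rule mfps_eqI) (simp add: hom_part_def zero_mfps.rep_eq)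

lemma mfps_mult_nonzero:
  assumes "mfps_nth (f * g) \<gamma> \<noteq> 0"
  shows "\<exists>\<alpha> \<beta>. \<alpha> + \<beta> = \<gamma> \<and> mfps_nth f \<alpha> \<noteq> 0 \<and> mfps_nth g \<beta> \<noteq> 0"
proof (rule ccontr)
  assume "\<not> ?thesis"
  then have "mfps_nth f a = 0 \<or> mfps_nth g b = 0" if "a + b = \<gamma>" for a b using that by blast
  then have "mfps_nth f a * mfps_nth g b = 0" if "a + b = \<gamma>" for a b using that by fastforce
  then have "mfps_nth (f * g) \<gamma> = 0" unfolding times_mfps.rep_eq by (intro sum.neutral) auto
  with assms show False by simp
qed

lemma homogeneous_mult: "homogeneous d f \<Longrightarrow> homogeneous e g \<Longrightarrow> homogeneous (d + e) (f * g)"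
  unfolding homogeneous_def by (metis mfps_mult_nonzero mi_deg_add)

lemma homogeneous_monom: "homogeneous (mi_deg \<alpha>) (mfps_monom \<alpha>)"
  by (simp add: homogeneous_def mfps_nth_monom)

lemma homogeneous_sum: "(\<And>i. i \<in> I \<Longrightarrow> homogeneous d (f i)) \<Longrightarrow> homogeneous d (\<Sum>i\<in>I. f i)"
  unfolding homogeneous_def mfps_nth_sum by (metis (mono_tags, lifting) sum.neutral)

lemma hom_part_mult:
  assumes "homogeneous e g"
  shows "hom_part d (f * g) = (if e \<le> d then hom_part (d - e) f * g else 0)"
proof (rule mfps_eqI)
  fix \<gamma>
  have "mfps_nth (hom_part d (f * g)) \<gamma>
      = (\<Sum>(a, b)\<in>{(a, b). a + b = \<gamma>}. if mi_deg \<gamma> = d then mfps_nth f a * mfps_nth g b else 0)"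
    by (simp add: hom_part_def times_mfps.rep_eq)
  also have "\<dots> = (\<Sum>(a, b)\<in>{(a, b). a + b = \<gamma>}. if e \<le> d then mfps_nth (hom_part (d - e) f) a * mfps_nth g b else 0)"
  proof (rule sum.cong [OF refl], clarify)
    fix a b :: "nat ^ 'a"
    show "(if mi_deg (a + b) = d then mfps_nth f a * mfps_nth g b else 0)
        = (if e \<le> d then mfps_nth (hom_part (d - e) f) a * mfps_nth g b else 0)"
    proof (cases "mfps_nth g b = 0")
      case False
      then have "mi_deg b = e" using assms by (simp add: homogeneous_def)
      then show ?thesis by (auto simp: hom_part_def)
    qed simp
  qed
  also have "\<dots> = mfps_nth (if e \<le> d then hom_part (d - e) f * g else 0) \<gamma>"
    by (simp add: times_mfps.rep_eq zero_mfps.rep_eq)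
  finally show "mfps_nth (hom_part d (f * g)) \<gamma> = mfps_nth (if e \<le> d then hom_part (d - e) f * g else 0) \<gamma>" .
qed

text \<open>Taking the part of degree d of c * x with x homogeneous only replaces c by one of its
  own homogeneous parts.\<close>

lemma hom_part_ideal:
  assumes G: "\<And>g. g \<in> G \<Longrightarrow> \<exists>e. homogeneous e g" and "f \<in> ideal_of G"
  shows "hom_part d f \<in> ideal_of G"
proof -
  interpret R: module "(*) :: ('a, complex) mfps \<Rightarrow> _" by standard (simp_all add: algebra_simps)
  show ?thesis
    using assms(2)
  proof (induction rule: R.span_induct_alt)
    case base
    show ?case by (simp add: R.span_zero)
  next
    case (step c x y)
    obtain e where "homogeneous e x" using G [OF step.hyps] by blast
    then have "hom_part d (c * x) \<in> R.span G"
      using R.span_scale [OF R.span_base [OF step.hyps]] by (simp add: hom_part_mult R.span_zero)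
    then show ?case unfolding hom_part_add by (rule R.span_add [OF _ step.IH])
  qed
qed

lemma scaleC_mfps_eq: "c *\<^sub>C f = mfps_const c * (f :: ('n::finite, complex) mfps)"
  by (rule mfps_eqI) (simp add: mfps_nth_const_mult scaleC_mfps.rep_eq scaleC_complex_def)

text \<open>A series differs from its truncation at degree D by an element on which the functional
  vanishes. So finitely many values on monomials, divided by \<gamma>!, are the coefficients of
  q.\<close>

lemma functional_eq_pairing:
  fixes \<Lambda> :: "('n::finite, complex) mfps \<Rightarrow> complex"
  assumes lin: "clinear \<Lambda>" and high: "\<And>h. (\<And>\<gamma>. mi_deg \<gamma> \<le> D \<Longrightarrow> mfps_nth h \<gamma> = 0) \<Longrightarrow> \<Lambda> h = 0"
  shows "\<exists>q. \<forall>f. \<Lambda> f = pairing q f"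
proof -
  let ?S = "{\<gamma> :: nat ^ 'n. mi_deg \<gamma> \<le> D}"
  let ?c = "\<lambda>\<gamma>. if mi_deg \<gamma> \<le> D then \<Lambda> (mfps_monom \<gamma>) / of_nat (mi_fact \<gamma>) else 0"
  have "finite {\<gamma>. ?c \<gamma> \<noteq> 0}"
    by (rule finite_subset [OF _ finite_mi_deg_le [of D]]) auto
  then have "lookup (Abs_poly_mapping ?c) \<gamma> = ?c \<gamma>" for \<gamma>
    by simp
  then obtain q :: "'n cpoly" where q: "\<And>\<gamma>. lookup q \<gamma> = ?c \<gamma>"
    by blast
  have "\<Lambda> f = pairing q f" for f
  proof -
    let ?p = "\<Sum>\<gamma>\<in>?S. mfps_nth f \<gamma> *\<^sub>C mfps_monom \<gamma> :: ('n, complex) mfps"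
    have "\<Lambda> (f - ?p) = 0"
    proof (rule high)
      fix \<gamma> :: "nat ^ 'n" assume "mi_deg \<gamma> \<le> D"
      then show "mfps_nth (f - ?p) \<gamma> = 0"
        by (simp add: minus_mfps.rep_eq mfps_nth_sum scaleC_mfps_eq mfps_nth_const_mult mfps_nth_monom
            finite_mi_deg_le if_distrib [where f = "\<lambda>x. _ * x"] cong: if_cong)
    qed
    then have "\<Lambda> f = (\<Sum>\<gamma>\<in>?S. mfps_nth f \<gamma> * \<Lambda> (mfps_monom \<gamma>))"
      by (simp add: clinear_diff [OF lin] clinear_sum [OF lin] clinear_scale [OF lin] scaleC_complex_def)
    also have "\<dots> = pairing q f"
    proof -
      have "keys q \<subseteq> ?S" by (auto simp: in_keys_iff q split: if_splits)
      then have "pairing q f = (\<Sum>\<gamma>\<in>?S. lookup q \<gamma> * of_nat (mi_fact \<gamma>) * mfps_nth f \<gamma>)"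
        by (rule pairing_eq [OF finite_mi_deg_le])
      also have "\<dots> = (\<Sum>\<gamma>\<in>?S. mfps_nth f \<gamma> * \<Lambda> (mfps_monom \<gamma>))"
        by (rule sum.cong) (simp_all add: q)
      finally show ?thesis by simp
    qed
    finally show ?thesis .
  qed
  then show ?thesis by blast
qed

text \<open>The functional \<open>m f + g \<mapsto> q'(\<partial>) \<bullet> f\<close> on \<open>\<langle>m\<rangle> + Q\<close>, \<open>g \<in> Q\<close>, is well defined and, by
  homogeneity, still so modulo all series of sufficiently high order. Hence it extends to a
  functional on \<open>\<complex>[[t]]\<close> that is given by a polynomial.\<close>

lemma perp_colon:
  assumes G: "\<And>g. g \<in> G \<Longrightarrow> \<exists>e. homogeneous e g" and m: "homogeneous e m"
  shows "{act m q | q. q \<in> perp (ideal_of G)} = perp (ideal_colon (ideal_of G) m)"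
proof -
  interpret R: module "(*) :: ('a, complex) mfps \<Rightarrow> _" by standard (simp_all add: algebra_simps)
  let ?Q = "R.span G"
  have "act m q \<in> perp (ideal_colon ?Q m)" if "q \<in> perp ?Q" for q
    using that by (simp add: perp_eq ideal_colon_def pairing_act mult.commute)
  moreover have "\<exists>q\<in>perp ?Q. act m q = q'" if q': "q' \<in> perp (ideal_colon ?Q m)" for q'
  proof -
    \<comment> \<open>A degree bound for q', which thus sees only the parts of f of degree at most
      s. Multiplication by m raises degrees by e, whence the threshold s + e below.\<close>
    define s where "s = Max (insert 0 (mi_deg ` keys q'))"
    have s: "mi_deg \<gamma> \<le> s" if "\<gamma> \<in> keys q'" for \<gamma>
      unfolding s_def by (rule Max_ge) (use that in auto)
    define high where "high h \<longleftrightarrow> (\<forall>\<gamma>. mi_deg \<gamma> \<le> s + e \<longrightarrow> mfps_nth h \<gamma> = 0)" for h :: "('a, complex) mfps"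
    define R where "R = {(f * m + g + h, pairing q' f) | f g h. g \<in> ?Q \<and> high h}"
    have R_I: "(f * m + g + h, pairing q' f) \<in> R" if "g \<in> ?Q" "high h" for f g h
      using that by (auto simp: R_def)
    have R_E: "\<exists>f g h. x = f * m + g + h \<and> a = pairing q' f \<and> g \<in> ?Q \<and> high h" if "(x, a) \<in> R" for x a
      using that unfolding R_def by blast
    have high0: "high 0" by (simp add: high_def zero_mfps.rep_eq)
    have "\<exists>\<Lambda>. clinear \<Lambda> \<and> (\<forall>(x, a)\<in>R. \<Lambda> x = a)"
    proof (rule clinear_extension)
      fix x a y b assume R: "(x, a) \<in> R" "(y, b) \<in> R"
      from R_E [OF R(1)] R_E [OF R(2)] obtain f g h f' g' h' where *: "x = f * m + g + h" "a = pairing q' f" "g \<in> ?Q" "high h"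
        "y = f' * m + g' + h'" "b = pairing q' f'" "g' \<in> ?Q" "high h'" by blast
      have "x + y = (f + f') * m + (g + g') + (h + h')" by (simp add: * algebra_simps)
      moreover have "a + b = pairing q' (f + f')" by (simp add: * pairing_add_right)
      moreover have "high (h + h')" using * by (simp add: high_def plus_mfps.rep_eq)
      ultimately show "(x + y, a + b) \<in> R" using R_I [OF R.span_add [OF *(3,7)]] by simp
    next
      fix x a c assume R: "(x, a) \<in> R"
      from R_E [OF R] obtain f g h where *: "x = f * m + g + h" "a = pairing q' f" "g \<in> ?Q" "high h" by blast
      have "c *\<^sub>C x = (mfps_const c * f) * m + (mfps_const c * g) + (mfps_const c * h)"
        by (simp only: *(1) scaleC_mfps_eq distrib_left mult.assoc)
      moreover have "c * a = pairing q' (mfps_const c * f)" by (simp add: * pairing_const_mult)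
      moreover have "high (mfps_const c * h)" using * by (simp add: high_def mfps_nth_const_mult)
      ultimately show "(c *\<^sub>C x, c * a) \<in> R" using R_I [OF R.span_scale [OF *(3)]] by simp
    next
      fix a assume R: "(0, a) \<in> R"
      from R_E [OF R] obtain f g h where *: "0 = f * m + g + h" "a = pairing q' f" "g \<in> ?Q" "high h"
        by blast
      \<comment> \<open>In degree d + e the term h has no part, so the degree d part of f times m
        lies in the homogeneous ideal \<open>?Q\<close>. That part of f is then in the colon ideal,
        to which q' is orthogonal.\<close>
      have zero: "pairing q' (hom_part d f) = 0" if "d \<le> s" for d
      proof -
        have "hom_part (d + e) h = 0"
          by (rule mfps_eqI) (use that *(4) in \<open>simp add: hom_part_def high_def zero_mfps.rep_eq\<close>)
        moreover have "hom_part (d + e) (f * m + g + h) = 0" unfolding *(1) [symmetric] by simp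
        ultimately have "hom_part d f * m = - hom_part (d + e) g"
          by (simp add: hom_part_add hom_part_mult [OF m] eq_neg_iff_add_eq_0)
        then have "hom_part d f * m \<in> ?Q"
          using R.span_neg [OF hom_part_ideal [OF G *(3)]] by simp
        then show ?thesis using q' by (simp add: perp_eq ideal_colon_def)
      qed
      have "pairing q' f = pairing q' (\<Sum>d\<le>s. hom_part d f)"
        unfolding pairing_def
        by (rule sum.cong) (simp_all add: mfps_nth_sum hom_part_def s)
      also have "\<dots> = 0" by (simp add: pairing_sum_right zero)
      finally show "a = 0" by (simp add: *(2))
    qed
    then obtain \<Lambda> where lin: "clinear \<Lambda>" and "\<forall>(x, a)\<in>R. \<Lambda> x = a"
      by blast
    then have \<Lambda>: "\<Lambda> (f * m + g + h) = pairing q' f" if "g \<in> ?Q" "high h" for f g h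
      using R_I [OF that, of f] by auto
    have "\<Lambda> h = 0" if "high h" for h
      using \<Lambda> [OF R.span_zero that, of 0] by simp
    then obtain q where q: "\<And>f. \<Lambda> f = pairing q f"
      using functional_eq_pairing [OF lin, of "s + e"] unfolding high_def by blast
    \<comment> \<open>The choice f = 0, h = 0 gives orthogonality to \<open>?Q\<close>; the choice g
      = h = 0 gives \<open>act m q = q'\<close>.\<close>
    have "q \<in> perp ?Q"
      using \<Lambda> [OF _ high0, of _ 0] by (simp add: perp_eq q)
    moreover have "act m q = q'"
      using \<Lambda> [OF R.span_zero high0] by (intro pairing_eqI) (simp add: pairing_act q mult.commute [of m])
    ultimately show ?thesis by blast
  qed
  ultimately show ?thesis by blast
qed

lemma homogeneous_t_prod: "\<exists>e. homogeneous e (t_prod S)"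
  using homogeneous_monom t_prod_eq_monom by metis

lemma homogeneous_At_form: "homogeneous 1 (At_form A i)"
  unfolding At_form_def
proof (rule homogeneous_sum)
  fix j :: 'a
  have "homogeneous 1 (mfps_monom (unit_vec j))" using homogeneous_monom [of "unit_vec j"] by simp
  then show "homogeneous 1 (of_int (A $ i $ j) * mfps_var j)"
    by (simp add: homogeneous_def mfps_nth_const_mult mfps_var_eq_monom flip: mfps_const_of_int)
qed

lemma perp_Q_hat_colon:
  "{act (m_hat v0 N) q | q. q \<in> perp (Q_hat A v0 N)} = perp (ideal_colon (Q_hat A v0 N) (m_hat v0 N))"
proof -
  obtain e where "homogeneous e (m_hat v0 N)" unfolding m_hat_def using homogeneous_t_prod by blast
  then show ?thesis
    unfolding Q_hat_eq
    by (intro perp_colon) (auto intro: homogeneous_t_prod, metis homogeneous_At_form homogeneous_mult homogeneous_t_prod)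
qed

section \<open>Supports of the series\<close>

text \<open>Subsequences are refined to be nondecreasing in one more coordinate at a time. A
  nonincreasing sequence of natural numbers is constant from the point where it attains its least
  value.\<close>

lemma nat_vec_seq_le:
  fixes f :: "nat \<Rightarrow> nat ^ 'n::finite"
  obtains i j where "i < j" "f i \<le> f j"
proof -
  have "\<exists>\<sigma> :: nat \<Rightarrow> nat. strict_mono \<sigma> \<and> (\<forall>i j k. i \<le> j \<longrightarrow> k \<in> S \<longrightarrow> f (\<sigma> i) $ k \<le> f (\<sigma> j) $ k)"
    if "finite S" for S :: "'n set"
    using that
  proof (induction S)
    case empty
    show ?case by (intro exI [of _ "\<lambda>i. i"]) (simp add: strict_mono_def)
  next
    case (insert x S)
    then obtain \<sigma> :: "nat \<Rightarrow> nat" where \<sigma>: "strict_mono \<sigma>"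
      "\<And>i j k. i \<le> j \<Longrightarrow> k \<in> S \<Longrightarrow> f (\<sigma> i) $ k \<le> f (\<sigma> j) $ k" by blast
    let ?s = "\<lambda>i. f (\<sigma> i) $ x"
    have "\<exists>\<tau> :: nat \<Rightarrow> nat. strict_mono \<tau> \<and> (\<forall>i j. i \<le> j \<longrightarrow> ?s (\<tau> i) \<le> ?s (\<tau> j))"
    proof -
      obtain \<tau> :: "nat \<Rightarrow> nat" where \<tau>: "strict_mono \<tau>" "monoseq (\<lambda>n. ?s (\<tau> n))"
        using seq_monosub [of ?s] by blast
      show ?thesis
      proof (cases "\<forall>m. \<forall>n\<ge>m. ?s (\<tau> m) \<le> ?s (\<tau> n)")
        case True
        with \<tau>(1) show ?thesis by blast
      next
        case False
        with \<tau>(2) have dec: "?s (\<tau> n) \<le> ?s (\<tau> m)" if "m \<le> n" for m n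
          using that unfolding monoseq_def by blast
        obtain m where m: "\<And>n. ?s (\<tau> m) \<le> ?s (\<tau> n)"
          using ex_has_least_nat [of "\<lambda>_. True" 0 "\<lambda>n. ?s (\<tau> n)"] by blast
        have const: "?s (\<tau> (m + i)) = ?s (\<tau> m)" for i
          using dec [of m "m + i"] m [of "m + i"] by simp
        have "strict_mono (\<lambda>i. \<tau> (m + i))"
          using \<tau>(1) by (simp add: strict_mono_def)
        then show ?thesis
          by (intro exI [of _ "\<lambda>i. \<tau> (m + i)"]) (simp add: const)
      qed
    qed
    then obtain \<tau> :: "nat \<Rightarrow> nat" where \<tau>: "strict_mono \<tau>" "\<And>i j. i \<le> j \<Longrightarrow> ?s (\<tau> i) \<le> ?s (\<tau> j)" by blast
    have mono: "f (\<sigma> (\<tau> i)) $ k \<le> f (\<sigma> (\<tau> j)) $ k" if "i \<le> j" "k \<in> insert x S" for i j k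
    proof (cases "k = x")
      case False
      moreover have "\<tau> i \<le> \<tau> j" using \<tau>(1) that(1) by (simp add: strict_mono_less_eq)
      ultimately show ?thesis using that(2) \<sigma>(2) by simp
    qed (simp add: \<tau>(2) that(1))
    show ?case
    proof (intro exI conjI allI impI)
      show "strict_mono (\<sigma> \<circ> \<tau>)" by (rule strict_mono_o [OF \<sigma>(1) \<tau>(1)])
      show "f ((\<sigma> \<circ> \<tau>) i) $ k \<le> f ((\<sigma> \<circ> \<tau>) j) $ k" if "i \<le> j" "k \<in> insert x S" for i j k
        using mono [OF that] by simp
    qed
  qed
  from this [of UNIV] obtain \<sigma> :: "nat \<Rightarrow> nat" where "strict_mono \<sigma>" "\<And>i j. i \<le> j \<Longrightarrow> f (\<sigma> i) \<le> f (\<sigma> j)"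
    by (auto simp: less_eq_vec_def)
  then show ?thesis
    by (intro that [of "\<sigma> 0" "\<sigma> 1"]) (simp_all add: strict_mono_less)
qed

text \<open>The minimal elements form an antichain, which \<open>nat_vec_seq_le\<close> forces to be
  finite. Below any x, an element of X of least total degree is minimal.\<close>

lemma dickson:
  fixes X :: "(nat ^ 'n::finite) set"
  shows "\<exists>T. finite T \<and> T \<subseteq> X \<and> (\<forall>x\<in>X. \<exists>t\<in>T. t \<le> x)"
proof -
  define T where "T = {t \<in> X. \<forall>s\<in>X. s \<le> t \<longrightarrow> s = t}"
  have "finite T"
  proof (rule ccontr)
    assume "infinite T"
    then obtain f :: "nat \<Rightarrow> nat ^ 'n" where f: "inj f" "range f \<subseteq> T"
      using infinite_countable_subset by blast
    obtain i j where ij: "i < j" "f i \<le> f j" by (rule nat_vec_seq_le)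
    moreover have "f i \<in> T" "f j \<in> T" using f(2) by blast+
    ultimately have "f i = f j" by (simp add: T_def)
    with f(1) ij(1) show False by (simp add: inj_eq)
  qed
  moreover have "\<exists>t\<in>T. t \<le> x" if "x \<in> X" for x
  proof -
    obtain t where t: "t \<in> X" "t \<le> x" "\<And>s. s \<in> X \<Longrightarrow> s \<le> x \<Longrightarrow> mi_deg t \<le> mi_deg s"
      using ex_has_least_nat [of "\<lambda>t. t \<in> X \<and> t \<le> x" x mi_deg] \<open>x \<in> X\<close> by blast
    have "s = t" if s: "s \<in> X" "s \<le> t" for s
    proof -
      obtain \<delta> where \<delta>: "t = s + \<delta>" using s(2) nat_vec_le_iff by blast
      have "mi_deg t \<le> mi_deg s" using t(2,3) that by (meson order_trans)
      then have "mi_deg \<delta> = 0" by (simp add: \<delta>)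
      then have "\<delta> = 0" by (simp add: mi_deg_def vec_eq_iff)
      then show ?thesis by (simp add: \<delta>)
    qed
    with t show ?thesis by (auto simp: T_def)
  qed
  ultimately show ?thesis by (auto simp: T_def)
qed

section \<open>Kernel elements in closed orthants and the cones they generate\<close>

definition orthant :: "'n set \<Rightarrow> (int ^ 'n) set" where
  "orthant \<sigma> = {x. \<forall>j. if j \<in> \<sigma> then x $ j \<le> 0 else 0 \<le> x $ j}"

lemma orthant_nth: "x \<in> orthant \<sigma> \<Longrightarrow> (j \<in> \<sigma> \<longrightarrow> x $ j \<le> 0) \<and> (j \<notin> \<sigma> \<longrightarrow> 0 \<le> x $ j)"
  by (simp add: orthant_def)

text \<open>Absolute values identify the orthant with the natural vectors, and the componentwise
  order on c + X then means that differences stay in the orthant.\<close>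

lemma dickson_orthant:
  fixes X :: "(int ^ 'n::finite) set" and c :: "int ^ 'n"
  assumes X: "\<forall>x\<in>X. c + x \<in> orthant \<sigma>"
  shows "\<exists>T. finite T \<and> T \<subseteq> X \<and> (\<forall>x\<in>X. \<exists>t\<in>T. x - t \<in> orthant \<sigma>)"
proof -
  define h where "h x = (\<chi> j. nat \<bar>(c + x) $ j\<bar>)" for x :: "int ^ 'n"
  have le: "x - y \<in> orthant \<sigma>" if "x \<in> X" "y \<in> X" "h y \<le> h x" for x y
    unfolding orthant_def
  proof (intro CollectI allI)
    fix j
    have "nat \<bar>c $ j + y $ j\<bar> \<le> nat \<bar>c $ j + x $ j\<bar>"
      using that(3) by (simp add: less_eq_vec_def h_def)
    moreover have "if j \<in> \<sigma> then c $ j + x $ j \<le> 0 else 0 \<le> c $ j + x $ j"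
      "if j \<in> \<sigma> then c $ j + y $ j \<le> 0 else 0 \<le> c $ j + y $ j"
      using orthant_nth [OF bspec [OF X that(1)], of j] orthant_nth [OF bspec [OF X that(2)], of j] by simp_all
    ultimately show "if j \<in> \<sigma> then (x - y) $ j \<le> 0 else 0 \<le> (x - y) $ j"
      by (auto split: if_splits)
  qed
  obtain T where T: "finite T" "T \<subseteq> h ` X" and min: "\<forall>y\<in>h ` X. \<exists>t\<in>T. t \<le> y"
    using dickson [of "h ` X"] by blast
  obtain T' where T': "T' \<subseteq> X" "finite T'" "T = h ` T'"
    using finite_subset_image [OF T(1,2)] by blast
  have "\<exists>t\<in>T'. x - t \<in> orthant \<sigma>" if "x \<in> X" for x
  proof -
    from that have "h x \<in> h ` X" by (rule imageI)
    from bspec [OF min this] obtain t where t: "t \<in> T'" "h t \<le> h x" unfolding T'(3) by blast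
    have "x - t \<in> orthant \<sigma>" by (rule le) (use t that T'(1) in auto)
    with t(1) show ?thesis ..
  qed
  with T' show ?thesis by blast
qed

lemma int_kernel_add: "x \<in> int_kernel A \<Longrightarrow> y \<in> int_kernel A \<Longrightarrow> x + y \<in> int_kernel A"
  by (simp add: int_kernel_def matrix_vector_right_distrib)

lemma int_kernel_minus: "x \<in> int_kernel A \<Longrightarrow> y \<in> int_kernel A \<Longrightarrow> x - y \<in> int_kernel (A :: int ^ 'n ^ 'd)"
  by (simp add: int_kernel_def matrix_vector_mult_diff_distrib)

lemma vec_of_int_convex_cone:
  assumes "vec_of_int x \<in> convex_cone hull G" "vec_of_int y \<in> convex_cone hull G"
  shows "(vec_of_int (x + y) :: real ^ 'n) \<in> convex_cone hull G"
  using assms convex_cone_convex_cone_hull [of G] by (simp add: convex_cone_add)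

text \<open>Finitely many nonzero elements lie below all others in the order of the orthant.
  Subtracting one of them stays in the kernel and the orthant and lowers the sum of absolute values,
  which is additive there.\<close>

lemma orthant_kernel_generators:
  fixes A :: "int ^ 'n::finite ^ 'd"
  shows "\<exists>G. finite G \<and> G \<subseteq> int_kernel A \<inter> orthant \<sigma> - {0} \<and>
    (\<forall>x\<in>int_kernel A \<inter> orthant \<sigma>. (vec_of_int x :: real ^ 'n) \<in> convex_cone hull (vec_of_int ` G))"
proof -
  define X where "X = int_kernel A \<inter> orthant \<sigma> - {0}"
  have "\<forall>x\<in>X. 0 + x \<in> orthant \<sigma>"
    by (simp add: X_def)
  from dickson_orthant [OF this] obtain G where G: "finite G" "G \<subseteq> X" "\<forall>x\<in>X. \<exists>t\<in>G. x - t \<in> orthant \<sigma>"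
    by blast
  define size where "size x = (\<Sum>j\<in>UNIV. nat \<bar>x $ j\<bar>)" for x :: "int ^ 'n"
  have "(vec_of_int x :: real ^ 'n) \<in> convex_cone hull (vec_of_int ` G)" if "x \<in> int_kernel A \<inter> orthant \<sigma>" for x
    using that
  proof (induction "size x" arbitrary: x rule: less_induct)
    case less
    show ?case
    proof (cases "x = 0")
      case True
      then show ?thesis by (simp add: convex_cone_hull_contains_0)
    next
      case False
      then have "x \<in> X" using less.prems by (simp add: X_def)
      with G(3) obtain t where t: "t \<in> G" "x - t \<in> orthant \<sigma>" by blast
      then have tX: "t \<in> X" using G(2) by blast
      have abs: "nat \<bar>x $ j\<bar> = nat \<bar>(x - t) $ j\<bar> + nat \<bar>t $ j\<bar>" for j
      proof -
        have "if j \<in> \<sigma> then t $ j \<le> 0 else 0 \<le> t $ j" "if j \<in> \<sigma> then x $ j - t $ j \<le> 0 else 0 \<le> x $ j - t $ j"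
          using orthant_nth [OF t(2), of j] orthant_nth [of t \<sigma> j] tX by (simp_all add: X_def)
        then show ?thesis by (auto split: if_splits)
      qed
      have "size t \<noteq> 0" using tX by (auto simp: size_def X_def vec_eq_iff)
      moreover have "size x = size (x - t) + size t"
        unfolding size_def sum.distrib [symmetric] by (rule sum.cong) (simp_all only: abs)
      ultimately have "size (x - t) < size x" by simp
      moreover have "x - t \<in> int_kernel A \<inter> orthant \<sigma>"
        using t(2) tX less.prems by (auto simp: X_def intro: int_kernel_minus)
      ultimately have "(vec_of_int (x - t) :: real ^ 'n) \<in> convex_cone hull (vec_of_int ` G)" by (rule less.hyps)
      from vec_of_int_convex_cone [OF this hull_inc [OF imageI [OF t(1)]]]
      show ?thesis by simp
    qed
  qed
  with G show ?thesis unfolding X_def by blast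
qed

text \<open>The origin together with an open half-space is itself a convex cone.\<close>

lemma inner_pos_convex_cone_hull:
  assumes G: "\<And>g. g \<in> G \<Longrightarrow> 0 < w \<bullet> g" and x: "x \<in> convex_cone hull G" "x \<noteq> 0"
  shows "0 < w \<bullet> x"
proof -
  let ?C = "insert 0 {x. 0 < w \<bullet> x}"
  have "convex_cone ?C"
    unfolding convex_cone_iff
    by (auto simp: inner_add_right)
  then have "convex_cone hull G \<subseteq> ?C" by (intro hull_minimal) (use G in auto)
  with x show ?thesis by auto
qed

text \<open>Within one orthant of the shifted lattice, adding elements of the kernel in that orthant does
  not change the negative support. This makes \<open>w\<close> nonnegative, hence by genericity positive, on a
  finite generating set of those elements.\<close>

lemma support_in_cone:
  fixes A :: "int ^ 'n::finite ^ 'd"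
  assumes generic: "generic_weight A w" and N: "N \<subseteq> NS_nonneg A w v0"
  shows "\<exists>C T. rational_polyhedral_cone C \<and> (\<forall>x\<in>C. x \<noteq> 0 \<longrightarrow> w \<bullet> x > 0) \<and> finite T \<and>
    (\<forall>u\<in>int_kernel A. nsupp_at v0 u \<in> N \<longrightarrow> vec_of_int u \<in> (\<Union>p\<in>T. (+) p ` C))"
proof -
  \<comment> \<open>The integral coordinates of \<open>v0\<close>, with default 0 elsewhere. The
    signs of c + u then place u in one of finitely many classes, each with constant negative support
    and contained in one shifted orthant.\<close>
  define c where "c = (\<chi> j. if v0 $ j \<in> \<int> then \<lfloor>Re (v0 $ j)\<rfloor> else 0)"
  define sgn where "sgn u = {j. c $ j + u $ j < 0}" for u :: "int ^ 'n"
  have nsupp: "nsupp_at v0 u = {j \<in> sgn u. v0 $ j \<in> \<int>}" for u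
  proof -
    have "j \<in> nsupp_at v0 u \<longleftrightarrow> j \<in> sgn u \<and> v0 $ j \<in> \<int>" for j
    proof (cases "v0 $ j \<in> \<int>")
      case True
      then obtain k :: int where k: "v0 $ j = of_int k" by (auto elim: Ints_cases)
      have "(\<exists>l<0. of_int (k + u $ j) = (of_int l :: complex)) \<longleftrightarrow> k + u $ j < 0"
        unfolding of_int_eq_iff by auto
      moreover have "c $ j = k" by (simp add: c_def k)
      ultimately show ?thesis by (simp add: nsupp_at_def nsupp_def vec_of_int_def sgn_def k)
    next
      case False
      have "v0 $ j \<in> \<int>" if "v0 $ j + of_int (u $ j) = of_int l" for l
        using that by (metis Ints_diff Ints_of_int add_diff_cancel_right')
      with False show ?thesis by (auto simp: nsupp_at_def nsupp_def vec_of_int_def)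
    qed
    then show ?thesis by blast
  qed
  define S where "S = {u \<in> int_kernel A. nsupp_at v0 u \<in> N}"
  define P where "P \<sigma> = {u \<in> S. sgn u = \<sigma>}" for \<sigma>
  have P_orthant: "\<forall>u\<in>P \<sigma>. c + u \<in> orthant \<sigma>" for \<sigma>
    by (auto simp: P_def sgn_def orthant_def)
  have P_add: "u + x \<in> P \<sigma>" if "u \<in> P \<sigma>" "x \<in> int_kernel A \<inter> orthant \<sigma>" for u x \<sigma>
  proof -
    have "sgn (u + x) = sgn u"
    proof -
      have "c $ j + (u + x) $ j < 0 \<longleftrightarrow> c $ j + u $ j < 0" for j
      proof -
        have "if c $ j + u $ j < 0 then x $ j \<le> 0 else 0 \<le> x $ j"
          using that by (auto simp: P_def sgn_def orthant_def)
        then show ?thesis by (auto split: if_splits)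
      qed
      then show ?thesis by (simp add: sgn_def)
    qed
    moreover from this have "nsupp_at v0 (u + x) = nsupp_at v0 u" by (simp add: nsupp)
    ultimately show ?thesis using that by (simp add: P_def S_def int_kernel_add)
  qed
  have nonneg: "0 \<le> w \<bullet> vec_of_int u" if "u \<in> S" for u
    using that N by (auto simp: S_def NS_nonneg_def)
  \<comment> \<open>The ray u + k x stays in the class of u, where w is nonnegative. Growing k
    excludes a negative value at x, and genericity excludes zero.\<close>
  have pos: "0 < w \<bullet> vec_of_int x" if u: "u \<in> P \<sigma>" and x: "x \<in> int_kernel A \<inter> orthant \<sigma>" "x \<noteq> 0" for u x \<sigma>
  proof -
    have "u + of_nat k * x \<in> P \<sigma> \<and> of_nat k * x \<in> int_kernel A" for k
    proof (induction k)
      case (Suc k)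
      have "u + of_nat (Suc k) * x = (u + of_nat k * x) + x" "of_nat (Suc k) * x = of_nat k * x + x"
        by (simp_all add: distrib_right add_ac)
      with Suc show ?case using P_add [OF _ x(1), of "u + of_nat k * x"] x(1)
        by (simp only:) (simp add: int_kernel_add)
    qed (simp add: u)
    then have "0 \<le> w \<bullet> vec_of_int (u + of_nat k * x)" for k
      using nonneg unfolding P_def by blast
    moreover have "(vec_of_int (of_nat k * x) :: real ^ 'n) = real k *\<^sub>R vec_of_int x" for k
    proof (induction k)
      case (Suc k)
      then show ?case by (simp add: distrib_right scaleR_add_left)
    qed simp
    ultimately have k: "0 \<le> w \<bullet> vec_of_int u + real k * (w \<bullet> vec_of_int x)" for k
      by (simp add: inner_add_right)
    have "\<not> w \<bullet> vec_of_int x < 0"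
    proof
      assume neg: "w \<bullet> vec_of_int x < 0"
      then obtain k where "w \<bullet> vec_of_int u < real k * - (w \<bullet> vec_of_int x)"
        using ex_less_of_nat_mult [of "- (w \<bullet> vec_of_int x)"] by auto
      with k [of k] show False by simp
    qed
    moreover have "w \<bullet> vec_of_int x \<noteq> 0" using generic x by (auto simp: generic_weight_def)
    ultimately show ?thesis by simp
  qed
  define good where "good \<sigma> G T \<longleftrightarrow> finite G \<and> finite T \<and> (\<forall>g\<in>G. 0 < w \<bullet> vec_of_int g) \<and>
      (\<forall>u\<in>P \<sigma>. \<exists>t\<in>T. (vec_of_int (u - t) :: real ^ 'n) \<in> convex_cone hull (vec_of_int ` G))" for \<sigma> G T
  have "\<exists>G T. good \<sigma> G T" for \<sigma>
  \<comment> \<open>The positivity statement \<open>pos\<close> starts from an element of the class,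
    so an empty class receives empty data.\<close>
  proof (cases "P \<sigma> = {}")
    case True
    then have "good \<sigma> {} {}" by (simp add: good_def)
    then show ?thesis by blast
  next
    case False
    then obtain u0 where u0: "u0 \<in> P \<sigma>" by blast
    obtain G where G: "finite G" "G \<subseteq> int_kernel A \<inter> orthant \<sigma> - {0}"
      and gen: "\<forall>x\<in>int_kernel A \<inter> orthant \<sigma>. (vec_of_int x :: real ^ 'n) \<in> convex_cone hull (vec_of_int ` G)"
      using orthant_kernel_generators [of A \<sigma>] by (elim exE conjE)
    obtain T where T: "finite T" "T \<subseteq> P \<sigma>" and min: "\<forall>u\<in>P \<sigma>. \<exists>t\<in>T. u - t \<in> orthant \<sigma>"
      using dickson_orthant [OF P_orthant, of \<sigma>] by (elim exE conjE)
    have ker: "u \<in> int_kernel A" if "u \<in> P \<sigma>" for u using that by (simp add: P_def S_def)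
    have "\<exists>t\<in>T. (vec_of_int (u - t) :: real ^ 'n) \<in> convex_cone hull (vec_of_int ` G)" if u: "u \<in> P \<sigma>" for u
    proof -
      from bspec [OF min u] obtain t where t: "t \<in> T" "u - t \<in> orthant \<sigma>" ..
      then have "u - t \<in> int_kernel A" using T(2) by (intro int_kernel_minus ker u) auto
      with t(2) have "u - t \<in> int_kernel A \<inter> orthant \<sigma>" by blast
      from t(1) bspec [OF gen this] show ?thesis ..
    qed
    moreover have "0 < w \<bullet> vec_of_int g" if "g \<in> G" for g
      using that G(2) by (intro pos [OF u0]) auto
    ultimately have "good \<sigma> G T" using G(1) T(1) by (simp add: good_def)
    then show ?thesis by blast
  qed
  then obtain G T where good: "\<And>\<sigma>. good \<sigma> (G \<sigma>) (T \<sigma>)"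
    by metis
  then have fin: "finite (G \<sigma>)" "finite (T \<sigma>)" and G: "\<forall>g\<in>G \<sigma>. 0 < w \<bullet> vec_of_int g"
    and T: "\<forall>u\<in>P \<sigma>. \<exists>t\<in>T \<sigma>. (vec_of_int (u - t) :: real ^ 'n) \<in> convex_cone hull (vec_of_int ` G \<sigma>)" for \<sigma>
    unfolding good_def by auto
  \<comment> \<open>There are only finitely many \<sigma>, so one cone generated by all the classes
    together is still finitely generated, and w is positive on each generator.\<close>
  let ?G = "\<Union>\<sigma>. vec_of_int ` G \<sigma> :: (real ^ 'n) set"
  let ?C = "convex_cone hull ?G" and ?T = "\<Union>\<sigma>. vec_of_int ` T \<sigma> :: (real ^ 'n) set"
  have "rational_polyhedral_cone ?C"
    unfolding rational_polyhedral_cone_def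
    by (intro exI [of _ ?G]) (auto simp: fin vec_of_int_def)
  moreover have "\<forall>x\<in>?C. x \<noteq> 0 \<longrightarrow> 0 < w \<bullet> x"
  proof (intro ballI impI)
    fix x assume "x \<in> ?C" "x \<noteq> 0"
    then show "0 < w \<bullet> x" by (rule inner_pos_convex_cone_hull [rotated]) (use G in auto)
  qed
  moreover have "finite ?T" by (simp add: fin)
  moreover have "vec_of_int u \<in> (\<Union>p\<in>?T. (+) p ` ?C)" if "u \<in> int_kernel A" "nsupp_at v0 u \<in> N" for u
  proof -
    have "u \<in> P (sgn u)" using that by (simp add: P_def S_def)
    from bspec [OF T this] obtain t where t: "t \<in> T (sgn u)"
      and cone: "(vec_of_int (u - t) :: real ^ 'n) \<in> convex_cone hull (vec_of_int ` G (sgn u))" ..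
    have "convex_cone hull (vec_of_int ` G (sgn u)) \<subseteq> ?C" by (rule hull_mono) blast
    with cone have C: "(vec_of_int (u - t) :: real ^ 'n) \<in> ?C" by (rule subsetD [rotated])
    have eq: "(vec_of_int u :: real ^ 'n) = vec_of_int t + vec_of_int (u - t)" by simp
    have "(vec_of_int t :: real ^ 'n) \<in> ?T" using t by blast
    then show ?thesis by (rule UN_I) (use eq C in blast)
  qed
  ultimately show ?thesis by blast
qed

text \<open>Differential operators only lower exponents: \<alpha> occurs in \<open>act f q\<close>
  only below some exponent of q.\<close>

lemma keys_act_le:
  assumes "\<alpha> \<in> keys (act f q)"
  shows "\<exists>\<gamma>\<in>keys q. mi_deg \<alpha> \<le> mi_deg \<gamma>"
proof -
  have "pairing q (mfps_monom \<alpha> * f) \<noteq> 0" using assms by (auto simp: in_keys_iff lookup_act)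
  then obtain \<gamma> where "\<gamma> \<in> keys q" "mfps_nth (mfps_monom \<alpha> * f) \<gamma> \<noteq> 0"
    unfolding pairing_def by (metis (mono_tags, lifting) mult_zero_right sum.neutral)
  moreover from this(2) have "\<alpha> \<le> \<gamma>" by (auto simp: mfps_nth_monom_mult split: if_splits)
  then have "mi_deg \<alpha> \<le> mi_deg \<gamma>" unfolding nat_vec_le_iff by auto
  ultimately show ?thesis by blast
qed

text \<open>All coefficients are obtained by differentiating the one polynomial q, whose degree
  bounds theirs uniformly.\<close>

lemma F_series_in_direction:
  assumes "generic_weight A w" and N: "N \<subseteq> NS_nonneg A w v0"
  shows "in_direction w (F_series A v0 N q)"
proof -
  let ?r = "F_series A v0 N q"
  have supp: "u \<in> int_kernel A \<and> nsupp_at v0 u \<in> N" if "?r u \<noteq> 0" for u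
    using that by (auto simp: F_series_eq split: if_splits)
  have "(\<Sum>j\<in>UNIV. \<alpha> $ j) \<le> Max (insert 0 (mi_deg ` keys q))" if \<alpha>: "\<alpha> \<in> keys (?r u)" for u \<alpha>
  proof -
    obtain \<gamma> where "\<gamma> \<in> keys q" "mi_deg \<alpha> \<le> mi_deg \<gamma>"
    proof -
      have "\<alpha> \<in> keys (act (ma_hat v0 N u) q)" using \<alpha> by (simp add: F_series_eq split: if_splits)
      from keys_act_le [OF this] show thesis using that by blast
    qed
    then show ?thesis
      unfolding mi_deg_def [symmetric] by (intro order_trans [OF _ Max_ge]) auto
  qed
  moreover have "w \<bullet> vec_of_int u \<ge> 0" if "?r u \<noteq> 0" for u
    using supp [OF that] N by (auto simp: NS_nonneg_def)
  ultimately show ?thesis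
    unfolding in_direction_def using support_in_cone [OF assms] supp by meson
qed

theorem theorem5p5:
  fixes A :: "int ^ 'n ^ 'd" and \<beta> :: "complex ^ 'd" and w :: "real ^ 'n"
    and v0 :: "complex ^ 'n" and N :: "'n set set"
  assumes "rank (\<chi> i j. of_int (A $ i $ j) :: rat ^ 'n ^ 'd) = CARD('d)"
    and "in_affine_hyperplane A"
    and "generic_weight A w"
    and "fake_exponent A \<beta> w v0"
    and "negative_support_family A w v0 N"
    and "ordered_family A v0 N"
  shows "(\<forall>q\<in>perp (Q_hat A v0 N).
            hypergeometric_series A \<beta> v0 (F_series A v0 N q) \<and>
            in_direction w (F_series A v0 N q)) \<and>
         {F_series A v0 N q 0 | q. q \<in> perp (Q_hat A v0 N)}
           = Xi ` perp (ideal_colon (Q_hat A v0 N) (m_hat v0 N)) \<and>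
         initial_coeff_space A \<beta> v0 N
           = Xi ` perp (ideal_colon (Q_hat A v0 N) (m_hat v0 N))"
proof -
  let ?Q = "Q_hat A v0 N"
  have N0: "nsupp_at v0 0 \<in> N" and N: "N \<subseteq> NS_nonneg A w v0"
    using assms(5) by (simp_all add: negative_support_family_def)
  then have NS: "N \<subseteq> NS A v0" by (auto simp: NS_nonneg_def)
  note v0 = fake_exponent_A [OF assms(4)]
  have supp: "u \<in> int_kernel A \<and> nsupp_at v0 u \<in> N" if "F_series A v0 N q u \<noteq> 0" for q u
    using that by (auto simp: F_series_eq split: if_splits)
  have ann: "annihilated A \<beta> (log_series_at v0 (F_series A v0 N q))" if "q \<in> perp ?Q" for q
    by (rule F_series_annihilated [OF that N0 v0])
  have hyp: "hypergeometric_series A \<beta> v0 (F_series A v0 N q)" if "q \<in> perp ?Q" for q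
    using ann [OF that] supp by (auto simp: hypergeometric_series_def)
  \<comment> \<open>The coefficient at u = 0 is \<open>act (m_hat v0 N) q\<close>, so the duality
    for colon ideals describes exactly these polynomials.\<close>
  have colon: "{F_series A v0 N q 0 | q. q \<in> perp ?Q} = Xi ` perp (ideal_colon ?Q (m_hat v0 N))"
    by (simp add: F_series_zero [OF N0] perp_Q_hat_colon)
  \<comment> \<open>Every solution supported on N is the series of some orthogonal q, and every such
    series is a solution supported on N.\<close>
  have "initial_coeff_space A \<beta> v0 N = {F_series A v0 N q 0 | q. q \<in> perp ?Q}"
  proof
    show "initial_coeff_space A \<beta> v0 N \<subseteq> {F_series A v0 N q 0 | q. q \<in> perp ?Q}"
    proof
      fix p assume "p \<in> initial_coeff_space A \<beta> v0 N"
      then obtain r where r: "p = r 0" "\<And>u. r u \<noteq> 0 \<Longrightarrow> u \<in> int_kernel A \<and> nsupp_at v0 u \<in> N"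
        "annihilated A \<beta> (log_series_at v0 r)" by (auto simp: initial_coeff_space_def)
      obtain q where "q \<in> perp ?Q" "F_series A v0 N q = r"
        using annihilated_series_eq_F_series [OF r(2) v0 r(3) N0 NS] by blast
      with r(1) show "p \<in> {F_series A v0 N q 0 | q. q \<in> perp ?Q}" by blast
    qed
    show "{F_series A v0 N q 0 | q. q \<in> perp ?Q} \<subseteq> initial_coeff_space A \<beta> v0 N"
      unfolding initial_coeff_space_def using ann supp by blast
  qed
  with hyp colon show ?thesis
    using F_series_in_direction [OF assms(3) N] by simp
qed

end
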